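(* Assume that (a) $\theta\mapsto H^\alpha$ and $\theta\mapsto L_k^\beta$ ($k=1,\dots,r$) are once continuously differentiable on $\Theta$; (b) (identifiability) for every $\theta=(\alpha,\beta)\in\Theta$ with $\theta\neq\theta_0$ there is at least one $t\in[0,T]$ with $b(\mathbf L^\beta,\bar\rho_t^\theta)\neq b(\mathbf L^{\beta_0},\bar\rho_t^{\theta_0})$. For $n\ge1$ let $\Delta_n=T/n$, $t_j=j\Delta_n$, $\Delta_j\overline{\mathbf Y}^N=\overline{\mathbf Y}^N_{t_j}-\overline{\mathbf Y}^N_{t_{j-1}}$, and $$\Phi_{N,n}(\theta)=\sum_{j=1}^n h(t_{j-1},\theta)\cdot\Delta_j\overline{\mathbf Y}^N-\frac12\sum_{j=1}^n\|h(t_{j-1},\theta)\|_{\mathbb R^r}^2\Delta_n,\qquad \hat\theta_{N,n}=\operatorname{arg\,max}_{\theta\in\Theta}\Phi_{N,n}(\theta).$$ Then $\hat\theta_{N,n}\to\theta_0$ almost surely as $N\to\infty$ and $n\to\infty$.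
   Context: Fix $T>0$ and integers $d,r,p\ge1$. Let $\Theta^\circ\subset\mathbb R^p$ be a bounded convex open set, $\Theta=\overline{\Theta^\circ}$ (compact), and let the true parameter $\theta_0=(\alpha_0,\beta_0)$ lie in $\Theta^\circ$. Each $\theta\in\Theta$ is written $\theta=(\alpha,\beta)$ with $\alpha,\beta$ vector-valued. For each $\theta$ there are given a self-adjoint matrix $H^\alpha\in M_d(\mathbb C)$ and matrices $L_1^\beta,\dots,L_r^\beta\in M_d(\mathbb C)$; $\mathbf L^\beta=(L_1^\beta,\dots,L_r^\beta)$. "$\ell$-times continuously differentiable on $\Theta$" means on $\Theta^\circ$, with all derivatives of order at most $\ell$ extending continuously to $\Theta$. Put $b(A,B)=2\operatorname{Re}\operatorname{Tr}(A^*B)$ for $A,B\in M_d(\mathbb C)$ and $b(\mathbf L^\beta,\rho)=(b(L_1^\beta,\rho),\dots,b(L_r^\beta,\rho))^\top\in\mathbb R^r$. With $[A,B]=AB-BA$, $\{A,B\}=AB+BA$, put $$\mathcal L^\theta(\rho)=-i[H^\alpha,\rho]+\sum_{k=1}^r\Big(L_k^\beta\rho(L_k^\beta)^*-\tfrac12\{(L_k^\beta)^*L_k^\beta,\rho\}\Big),\qquad \mathcal H_k^\beta(\rho)=L_k^\beta\rho+\rho(L_k^\beta)^*-b(L_k^\beta,\rho)\rho.$$ Let $\mathbf W^{(1)},\mathbf W^{(2)},\dots$ be independent $r$-dimensional standard Wiener processes on $[0,T]$, $\mathbf W^{(i)}=(W^{(i,1)},\dots,W^{(i,r)})^\top$,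 and let $\rho_0\in M_d(\mathbb C)$ be a fixed (known) density matrix (positive semidefinite, trace one). For $\theta\in\Theta$, $i\ge1$, $\rho_t^{\theta,(i)}$ is the unique solution of $$d\rho_t^{\theta,(i)}=\mathcal L^\theta(\rho_t^{\theta,(i)})\,dt+\sum_{k=1}^r\mathcal H_k^\beta(\rho_t^{\theta,(i)})\,dW_t^{(i,k)},\qquad \rho_0^{\theta,(i)}=\rho_0;$$ it is known that it exists, is unique and is density-matrix valued. Put $\bar\rho_t^\theta=\mathbb E[\rho_t^{\theta,(i)}]$ (independent of $i$) and $h(t,\theta)=b(\mathbf L^\beta,\bar\rho_t^\theta)\in\mathbb R^r$. Observations: the records are generated under $\theta_0$, i.e. $d\mathbf Y^{(i)}_t=b(\mathbf L^{\beta_0},\rho_t^{\theta_0,(i)})\,dt+d\mathbf W^{(i)}_t$, $\mathbf Y_0^{(i)}=0$; $\overline{\mathbf Y}^N=\frac1N\sum_{i=1}^N\mathbf Y^{(i)}$. $\hat\theta_{N,n}$ is a measurable choice of a maximizer. Almost sure convergence $X_{N,n}\to x$ as $N\to\infty$ and $n\to\infty$ is in the double-index sense: almost surely, $\lim_{K\to\infty}\sup_{N\ge K,\,n\ge K}|X_{N,n}-x|=0$. *)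

theory Defs
  imports "HOL-Probability.Probability"
begin

section \<open>Complex matrices\<close>

definition ctranspose :: "complex^'n^'m \<Rightarrow> complex^'m^'n" where
  "ctranspose A = map_matrix cnj (transpose A)"

definition selfadjoint :: "complex^'d^'d \<Rightarrow> bool" where
  "selfadjoint A \<longleftrightarrow> ctranspose A = A"

definition pos_semidef :: "complex^'d^'d \<Rightarrow> bool" where
  "pos_semidef A \<longleftrightarrow>
     selfadjoint A \<and> (\<forall>v. 0 \<le> Re (\<Sum>i\<in>UNIV. cnj (v $ i) * (A *v v) $ i))"

definition density_matrix :: "complex^'d^'d \<Rightarrow> bool" where
  "density_matrix \<rho> \<longleftrightarrow> pos_semidef \<rho> \<and> trace \<rho> = 1"

definition comm :: "complex^'d^'d \<Rightarrow> complex^'d^'d \<Rightarrow> complex^'d^'d" where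
  "comm A B = A ** B - B ** A"

definition anticomm :: "complex^'d^'d \<Rightarrow> complex^'d^'d \<Rightarrow> complex^'d^'d" where
  "anticomm A B = A ** B + B ** A"

definition bform :: "complex^'d^'d \<Rightarrow> complex^'d^'d \<Rightarrow> real" where
  "bform A B = 2 * Re (trace (ctranspose A ** B))"

definition bvec :: "('r \<Rightarrow> complex^'d^'d) \<Rightarrow> complex^'d^'d \<Rightarrow> real^'r::finite" where
  "bvec L \<rho> = (\<chi> k. bform (L k) \<rho>)"

text \<open>Drift and diffusion coefficients; \<^term>\<open>mat c ** A\<close> is the complex scalar multiple
  of \<open>A\<close> by \<open>c\<close>.\<close>

definition lindblad ::
  "complex^'d^'d \<Rightarrow> ('r::finite \<Rightarrow> complex^'d^'d) \<Rightarrow> complex^'d^'d \<Rightarrow> complex^'d^'d" where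
  "lindblad H L \<rho> = mat (- \<i>) ** comm H \<rho>
     + (\<Sum>k\<in>UNIV. L k ** \<rho> ** ctranspose (L k)
                 - (1/2) *\<^sub>R anticomm (ctranspose (L k) ** L k) \<rho>)"

definition diffusion :: "complex^'d^'d \<Rightarrow> complex^'d^'d \<Rightarrow> complex^'d^'d" where
  "diffusion Lk \<rho> = Lk ** \<rho> + \<rho> ** ctranspose Lk - bform Lk \<rho> *\<^sub>R \<rho>"


section \<open>Parameters\<close>

text \<open>A splitting \<open>\<theta> = (\<alpha>, \<beta>)\<close> of the coordinates is given by an index set \<open>A\<close>:
  \<open>\<alpha>\<close> is \<open>coords A \<theta>\<close> and \<open>\<beta>\<close> is \<open>coords (- A) \<theta>\<close>, each padded by zeros. Either part may
  be empty, so that one-dimensional parameters are covered.\<close>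

definition coords :: "'p set \<Rightarrow> real^'p \<Rightarrow> real^'p::finite" where
  "coords A \<theta> = (\<chi> j. if j \<in> A then \<theta> $ j else 0)"

text \<open>Once continuously differentiable on the closure of the open set \<open>U\<close>: differentiable on
  \<open>U\<close>, where \<open>f\<close> and its derivative extend continuously to the closure. As \<open>f\<close> is given on
  the closure, it is its own extension there; outside \<open>U\<close> the values of \<open>f'\<close> are the
  extension of the derivative.\<close>

definition C1_on_closure ::
  "'a::euclidean_space set \<Rightarrow> ('a \<Rightarrow> 'b::real_normed_vector) \<Rightarrow> bool" where
  "C1_on_closure U f \<longleftrightarrow> continuous_on (closure U) f \<and>
     (\<exists>f' :: 'a \<Rightarrow> 'a \<Rightarrow>\<^sub>L 'b. (\<forall>x\<in>U. (f has_derivative blinfun_apply (f' x)) (at x)) \<and>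
        continuous_on (closure U) f')"


section \<open>Wiener processes\<close>

text \<open>Standard \<open>r\<close>-dimensional Wiener process on \<open>[0, T]\<close>. Independence is required jointly
  over the increments \<open>j < n\<close> and the components \<open>k\<close>, so it contains both the independence
  of vector increments and that of the components.\<close>

definition std_wiener :: "'w measure \<Rightarrow> real \<Rightarrow> (real \<Rightarrow> 'w \<Rightarrow> real^'r::finite) \<Rightarrow> bool" where
  "std_wiener M T W \<longleftrightarrow>
     (\<forall>t\<in>{0..T}. W t \<in> borel_measurable M) \<and>
     (AE \<omega> in M. W 0 \<omega> = 0) \<and>
     (AE \<omega> in M. continuous_on {0..T} (\<lambda>t. W t \<omega>)) \<and>
     (\<forall>s t k. 0 \<le> s \<and> s < t \<and> t \<le> T \<longrightarrow>
        distributed M lborel (\<lambda>\<omega>. W t \<omega> $ k - W s \<omega> $ k)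
          (\<lambda>x. ennreal (normal_density 0 (sqrt (t - s)) x))) \<and>
     (\<forall>n (t :: nat \<Rightarrow> real). 0 \<le> t 0 \<and> (\<forall>j<n. t j < t (Suc j)) \<and> t n \<le> T \<longrightarrow>
        prob_space.indep_vars M (\<lambda>_. borel)
          (\<lambda>(j, k) \<omega>. W (t (Suc j)) \<omega> $ k - W (t j) \<omega> $ k) ({..<n} \<times> UNIV))"

definition indep_processes ::
  "'w measure \<Rightarrow> real \<Rightarrow> (nat \<Rightarrow> real \<Rightarrow> 'w \<Rightarrow> 'b::topological_space) \<Rightarrow> nat set \<Rightarrow> bool" where
  "indep_processes M T W I \<longleftrightarrow>
     prob_space.indep_vars M (\<lambda>_. \<Pi>\<^sub>M t\<in>{0..T}. borel) (\<lambda>i \<omega>. \<lambda>t\<in>{0..T}. W i t \<omega>) I"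

text \<open>Natural filtration of \<open>W\<close>, augmented by the null sets.\<close>

definition aug_filtration ::
  "'w measure \<Rightarrow> (real \<Rightarrow> 'w \<Rightarrow> 'b::topological_space) \<Rightarrow> real \<Rightarrow> 'w measure" where
  "aug_filtration M W t = sigma (space M)
     ({W s -` B \<inter> space M | s B. s \<in> {0..t} \<and> B \<in> sets borel} \<union> null_sets M)"


section \<open>The It\^o integral\<close>

definition progressive ::
  "real \<Rightarrow> (real \<Rightarrow> 'w measure) \<Rightarrow> (real \<Rightarrow> 'w \<Rightarrow> 'b::topological_space) \<Rightarrow> bool" where
  "progressive T F X \<longleftrightarrow> (\<forall>t\<in>{0..T}.
     (\<lambda>(s, \<omega>). X s \<omega>) \<in> borel_measurable (restrict_space borel {0..t} \<Otimes>\<^sub>M F t))"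

text \<open>The triple \<open>n\<close>, \<open>t\<close>, \<open>\<xi>\<close> encodes the elementary process
  \<open>\<Sum>j<n. \<xi>\<^sub>j \<one>\<^bsub>(t\<^sub>j, t\<^sub>j\<^sub>+\<^sub>1]\<^esub>\<close> with bounded \<open>\<xi>\<^sub>j\<close>, measurable at time \<open>t\<^sub>j\<close>.\<close>

definition elementary ::
  "real \<Rightarrow> (real \<Rightarrow> 'w measure) \<Rightarrow> nat \<Rightarrow> (nat \<Rightarrow> real) \<Rightarrow>
     (nat \<Rightarrow> 'w \<Rightarrow> 'b::real_normed_vector) \<Rightarrow> bool" where
  "elementary T F n t \<xi> \<longleftrightarrow>
     0 \<le> t 0 \<and> (\<forall>j<n. t j \<le> t (Suc j)) \<and> t n \<le> T \<and>
     (\<forall>j<n. \<xi> j \<in> borel_measurable (F (t j)) \<and>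
            (\<exists>C. \<forall>\<omega>\<in>space (F (t j)). norm (\<xi> j \<omega>) \<le> C))"

definition elem_process ::
  "nat \<Rightarrow> (nat \<Rightarrow> real) \<Rightarrow> (nat \<Rightarrow> 'w \<Rightarrow> 'b::real_normed_vector) \<Rightarrow> real \<Rightarrow> 'w \<Rightarrow> 'b" where
  "elem_process n t \<xi> s \<omega> = (\<Sum>j<n. indicator {t j<..t (Suc j)} s *\<^sub>R \<xi> j \<omega>)"

definition elem_integral ::
  "(real \<Rightarrow> 'w \<Rightarrow> real) \<Rightarrow> nat \<Rightarrow> (nat \<Rightarrow> real) \<Rightarrow> (nat \<Rightarrow> 'w \<Rightarrow> 'b::real_normed_vector) \<Rightarrow>
     real \<Rightarrow> 'w \<Rightarrow> 'b" where
  "elem_integral B n t \<xi> u \<omega> =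
     (\<Sum>j<n. (B (min (t (Suc j)) u) \<omega> - B (min (t j) u) \<omega>) *\<^sub>R \<xi> j \<omega>)"

text \<open>\<open>I\<close> is a continuous version of the It\^o integral process
  \<open>u \<mapsto> \<integral>\<^sub>0\<^sup>u X dB\<close>, \<open>u \<in> [0, T]\<close>, of the square-integrable progressive process \<open>X\<close>
  (vector-valued, \<open>B\<close> scalar): the \<open>L\<^sup>2\<close> limit of the integrals of elementary processes that
  approximate \<open>X\<close> in \<open>L\<^sup>2([0, T] \<times> \<Omega>)\<close>. By the It\^o isometry the limit does not depend on the
  approximating sequence.\<close>

definition ito_integral ::
  "'w measure \<Rightarrow> real \<Rightarrow> (real \<Rightarrow> 'w measure) \<Rightarrow> (real \<Rightarrow> 'w \<Rightarrow> real) \<Rightarrow>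
     (real \<Rightarrow> 'w \<Rightarrow> 'b::euclidean_space) \<Rightarrow> (real \<Rightarrow> 'w \<Rightarrow> 'b) \<Rightarrow> bool" where
  "ito_integral M T F B X I \<longleftrightarrow>
     progressive T F X \<and>
     (\<integral>\<^sup>+ \<omega>. (\<integral>\<^sup>+ s\<in>{0..T}. ennreal ((norm (X s \<omega>))\<^sup>2) \<partial>lborel) \<partial>M) < \<infinity> \<and>
     (\<forall>u\<in>{0..T}. I u \<in> borel_measurable (F u)) \<and>
     (AE \<omega> in M. continuous_on {0..T} (\<lambda>u. I u \<omega>)) \<and>
     (\<exists>(n :: nat \<Rightarrow> nat) (t :: nat \<Rightarrow> nat \<Rightarrow> real) (\<xi> :: nat \<Rightarrow> nat \<Rightarrow> 'w \<Rightarrow> 'b).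
        (\<forall>m. elementary T F (n m) (t m) (\<xi> m)) \<and>
        (\<lambda>m. \<integral>\<^sup>+ \<omega>. (\<integral>\<^sup>+ s\<in>{0..T}.
            ennreal ((norm (X s \<omega> - elem_process (n m) (t m) (\<xi> m) s \<omega>))\<^sup>2) \<partial>lborel) \<partial>M)
          \<longlonglongrightarrow> 0 \<and>
        (\<forall>u\<in>{0..T}. (\<lambda>m. \<integral>\<^sup>+ \<omega>.
            ennreal ((norm (I u \<omega> - elem_integral B (n m) (t m) (\<xi> m) u \<omega>))\<^sup>2) \<partial>M)
          \<longlonglongrightarrow> 0))"


section \<open>State and observation processes\<close>

text \<open>\<open>\<rho>\<close> is a (strong, i.e. adapted to the augmented filtration of \<open>W\<close>, and continuous) solution of
  \<open>d\<rho>\<^sub>t = lindblad H L \<rho>\<^sub>t dt + \<Sum>k. diffusion (L k) \<rho>\<^sub>t dW\<^sub>t\<^sup>k\<close> on \<open>[0, T]\<close> with initial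
  value \<open>\<rho>0\<close>.\<close>

definition sde_solution ::
  "'w measure \<Rightarrow> real \<Rightarrow> (real \<Rightarrow> 'w \<Rightarrow> real^'r::finite) \<Rightarrow>
     complex^'d^'d \<Rightarrow> ('r \<Rightarrow> complex^'d^'d) \<Rightarrow> complex^'d^'d \<Rightarrow>
     (real \<Rightarrow> 'w \<Rightarrow> complex^'d^'d) \<Rightarrow> bool" where
  "sde_solution M T W H L \<rho>0 \<rho> \<longleftrightarrow>
     progressive T (aug_filtration M W) \<rho> \<and>
     (AE \<omega> in M. continuous_on {0..T} (\<lambda>t. \<rho> t \<omega>)) \<and>
     (\<exists>I :: 'r \<Rightarrow> real \<Rightarrow> 'w \<Rightarrow> complex^'d^'d.
        (\<forall>k. ito_integral M T (aug_filtration M W) (\<lambda>t \<omega>. W t \<omega> $ k)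
               (\<lambda>t \<omega>. diffusion (L k) (\<rho> t \<omega>)) (I k)) \<and>
        (AE \<omega> in M. \<forall>t\<in>{0..T}.
           \<rho> t \<omega> = \<rho>0 + (LINT s:{0..t}|lborel. lindblad H L (\<rho> s \<omega>)) + (\<Sum>k\<in>UNIV. I k t \<omega>)))"

text \<open>\<open>Y\<close> is the record \<open>dY\<^sub>t = b(L, \<rho>\<^sub>t) dt + dW\<^sub>t\<close> with \<open>Y\<^sub>0 = 0\<close>.\<close>

definition observation ::
  "'w measure \<Rightarrow> real \<Rightarrow> (real \<Rightarrow> 'w \<Rightarrow> real^'r::finite) \<Rightarrow> ('r \<Rightarrow> complex^'d^'d) \<Rightarrow>
     (real \<Rightarrow> 'w \<Rightarrow> complex^'d^'d) \<Rightarrow> (real \<Rightarrow> 'w \<Rightarrow> real^'r) \<Rightarrow> bool" where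
  "observation M T W L \<rho> Y \<longleftrightarrow>
     (AE \<omega> in M. \<forall>t\<in>{0..T}.
        Y t \<omega> = (LINT s:{0..t}|lborel. bvec L (\<rho> s \<omega>)) + (W t \<omega> - W 0 \<omega>))"

text \<open>Average over the trajectories \<open>i = 1, \<dots>, N\<close>.\<close>

definition mean_record :: "(nat \<Rightarrow> real \<Rightarrow> 'w \<Rightarrow> real^'r::finite) \<Rightarrow> nat \<Rightarrow> real \<Rightarrow> 'w \<Rightarrow> real^'r" where
  "mean_record Y N t \<omega> = (1 / real N) *\<^sub>R (\<Sum>i=1..N. Y i t \<omega>)"

text \<open>The discretized contrast built from \<open>h\<close> and a path \<open>y\<close>, with \<open>t\<^sub>j = j T / n\<close>.\<close>

definition contrast ::
  "real \<Rightarrow> (real \<Rightarrow> 'q \<Rightarrow> real^'r::finite) \<Rightarrow> (real \<Rightarrow> real^'r) \<Rightarrow> nat \<Rightarrow> 'q \<Rightarrow> real" where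
  "contrast T h y n \<theta> =
     (let \<Delta> = T / real n; t = (\<lambda>j::nat. real j * \<Delta>) in
       (\<Sum>j=1..n. h (t (j - 1)) \<theta> \<bullet> (y (t j) - y (t (j - 1))))
       - (1/2) * (\<Sum>j=1..n. (norm (h (t (j - 1)) \<theta>))\<^sup>2 * \<Delta>))"

text \<open>Convergence as both indices tend to infinity:
  \<open>sup\<^bsub>N \<ge> K, n \<ge> K\<^esub> |X\<^bsub>N,n\<^esub> - x| \<rightarrow> 0\<close> as \<open>K \<rightarrow> \<infinity>\<close>; the supremum is
  taken in \<^typ>\<open>ennreal\<close>, where it always exists.\<close>

definition double_limit :: "(nat \<Rightarrow> nat \<Rightarrow> 'b::real_normed_vector) \<Rightarrow> 'b \<Rightarrow> bool" where
  "double_limit X x \<longleftrightarrow>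
     (\<lambda>K. SUP (N, n)\<in>{K..} \<times> {K..}. ennreal (norm (X N n - x))) \<longlonglongrightarrow> 0"

end

theory Submission
  imports Defs
begin

text \<open>
  The contrast \<open>\<Phi>\<^sub>N\<^sub>,\<^sub>n\<close> converges, uniformly in \<open>\<theta>\<close>, to the deterministic function
  \<open>J \<theta> = \<integral>\<^sub>0\<^sup>T (h(s,\<theta>) \<bullet> h(s,\<theta>\<^sub>0) - \<parallel>h(s,\<theta>)\<parallel>\<^sup>2/2) ds\<close>. Since
  \<open>J \<theta>\<^sub>0 - J \<theta> = 1/2 \<integral>\<^sub>0\<^sup>T \<parallel>h(s,\<theta>) - h(s,\<theta>\<^sub>0)\<parallel>\<^sup>2 ds\<close>, identifiability and continuity of \<open>h\<close> in
  \<open>s\<close> make \<open>\<theta>\<^sub>0\<close> the only maximizer of \<open>J\<close> on the compact set \<open>\<Theta>\<close>, so maximizers of functions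
  uniformly close to \<open>J\<close> are close to \<open>\<theta>\<^sub>0\<close> (lemma \<open>contrast_argmax_consistent\<close>).

  Regularity of \<open>h\<close>. It\^o integrals have mean zero (\<open>ito_integral_mean_zero\<close>), hence the mean state
  solves the linear equation \<open>e(t) = \<rho>\<^sub>0 + \<integral>\<^sub>0\<^sup>t \<L> e(s) ds\<close> (\<open>mean_state_equation\<close>). As density
  matrices are bounded, \<open>e\<close> and hence \<open>h\<close> are Lipschitz in time, uniformly on \<open>\<Theta>\<close>. A Gronwall
  argument for this equation (\<open>integral_equation_stability\<close>) serves twice: with two parameters it
  shows that \<open>h\<close> is continuous in \<open>\<theta>\<close>; with one parameter it shows that all trajectories \<open>i\<close> have the
  same mean, which is all that the law of large numbers below asks of their distributions.

  The random part. Let \<open>y(t) = \<integral>\<^sub>0\<^sup>t h(s,\<theta>\<^sub>0) ds\<close>. The centred records \<open>Y\<^sup>i\<^sub>t - y(t)\<close> are independent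
  in \<open>i\<close>, because each is measurable with respect to the augmented filtration of its own Wiener
  process, and their increments have fourth moment at most a constant times \<open>(t - s)\<^sup>2\<close>. The fourth
  moment of an increment of the average of \<open>N\<close> of them is therefore of order \<open>(t - s)\<^sup>2 / N\<^sup>2\<close>. The
  power of \<open>t - s\<close> exceeds one, which permits chaining over dyadic grids, and the power of
  \<open>1/N\<close> permits Borel-Cantelli: almost surely \<open>sup\<^sub>t \<parallel>Y\<^sup>N\<^sub>t - y(t)\<parallel> \<rightarrow> 0\<close> for the averages \<open>Y\<^sup>N\<close>
  (\<open>uniform_slln\<close>, \<open>mean_record_uniform_slln\<close>).

  The double limit. Summation by parts moves the increments from the record to \<open>h\<close>, which is
  Lipschitz in time, so replacing the averaged record by \<open>y\<close> changes the contrast by at most a constant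
  times \<open>sup\<^sub>t \<parallel>Y\<^sup>N\<^sub>t - y(t)\<parallel>\<close>, whatever the mesh (\<open>contrast_perturbation\<close>). What remains is a
  Riemann sum with error \<open>O(1/n)\<close>, free of \<open>N\<close> (\<open>contrast_riemann_error\<close>). The two errors are thus
  controlled separately and \<open>N\<close>, \<open>n\<close> may tend to infinity independently.
\<close>

section \<open>Matrices\<close>

lemma bounded_bilinear_matrix_mult:
  "bounded_bilinear ((**) :: complex^'n^'m \<Rightarrow> complex^'k^'n \<Rightarrow> complex^'k^'m)"
  unfolding bilinear_conv_bounded_bilinear[symmetric] bilinear_def
  by (auto intro!: linearI simp: matrix_matrix_mult_def vec_eq_iff scaleR_sum_right
      sum.distrib algebra_simps)

lemma bounded_linear_ctranspose:
  "bounded_linear (ctranspose :: complex^'n^'m \<Rightarrow> complex^'m^'n)"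
  unfolding linear_conv_bounded_linear[symmetric]
  by (auto intro!: linearI simp: ctranspose_def map_matrix_def transpose_def vec_eq_iff)

lemma bounded_linear_trace: "bounded_linear (trace :: complex^'n^'n \<Rightarrow> complex)"
  unfolding linear_conv_bounded_linear[symmetric]
  by (auto intro!: linearI simp: trace_def sum.distrib scaleR_sum_right)

lemmas matrix_mult_simps =
  bounded_bilinear.add_left[OF bounded_bilinear_matrix_mult]
  bounded_bilinear.add_right[OF bounded_bilinear_matrix_mult]
  bounded_bilinear.diff_left[OF bounded_bilinear_matrix_mult]
  bounded_bilinear.diff_right[OF bounded_bilinear_matrix_mult]
  bounded_bilinear.scaleR_left[OF bounded_bilinear_matrix_mult]
  bounded_bilinear.scaleR_right[OF bounded_bilinear_matrix_mult]

lemma bounded_bilinear_bform: "bounded_bilinear (bform :: complex^'d^'d \<Rightarrow> _)"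
  unfolding bilinear_conv_bounded_bilinear[symmetric] bilinear_def
  by (auto intro!: linearI simp: bform_def matrix_mult_simps algebra_simps
      linear_simps[OF bounded_linear_ctranspose] linear_simps[OF bounded_linear_trace])

lemma bounded_linear_lindblad: "bounded_linear (lindblad H L)"
  unfolding linear_conv_bounded_linear[symmetric]
  by (auto intro!: linearI simp: lindblad_def comm_def anticomm_def matrix_mult_simps
      algebra_simps sum.distrib sum_subtractf scaleR_sum_right)

lemma continuous_on_lindblad:
  assumes "continuous_on S H" and "\<And>k. continuous_on S (\<lambda>x. L x k)"
  shows "continuous_on S (\<lambda>x. lindblad (H x) (L x) \<rho>)"
  unfolding lindblad_def comm_def anticomm_def
  by (intro continuous_intros assms
      bounded_bilinear.continuous_on[OF bounded_bilinear_matrix_mult]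
      bounded_linear.continuous_on[OF bounded_linear_ctranspose])

lemma bounded_linear_bvec: "bounded_linear (bvec L)"
  unfolding linear_conv_bounded_linear[symmetric]
  by (auto intro!: linearI simp: bvec_def vec_eq_iff
      bounded_bilinear.add_right[OF bounded_bilinear_bform]
      bounded_bilinear.scaleR_right[OF bounded_bilinear_bform])

lemma continuous_on_bvec:
  assumes "\<And>k. continuous_on S (\<lambda>x. L x k)"
  shows "continuous_on S (\<lambda>x. bvec (L x) \<rho>)"
  unfolding bvec_def
  by (intro continuous_intros assms bounded_bilinear.continuous_on[OF bounded_bilinear_bform])

text \<open>Testing positivity on vectors supported on two coordinates bounds the off-diagonal entries of a
density matrix by the diagonal ones.\<close>

lemma quadratic_form_two_points:
  fixes A :: "complex^'d^'d" and c :: complex and i j :: 'd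
  defines "v \<equiv> (\<chi> a. (if a = i then 1 else 0) + (if a = j then c else 0))"
  shows "(\<Sum>a\<in>UNIV. cnj (v $ a) * (A *v v) $ a)
    = A $ i $ i + c * A $ i $ j + cnj c * A $ j $ i + cnj c * c * A $ j $ j"
proof -
  have Av: "(A *v v) $ a = A $ a $ i + c * A $ a $ j" for a
    by (simp add: matrix_vector_mult_def v_def distrib_left sum.distrib if_distrib[of "\<lambda>x. _ * x"]
        mult.commute cong: if_cong)
  have cv: "cnj (v $ a) = (if a = i then 1 else 0) + (if a = j then cnj c else 0)" for a
    by (simp add: v_def)
  have delta: "(\<Sum>a\<in>UNIV. (if a = l then x else 0) * f a) = x * f l" for l :: 'd and x :: complex and f
    by (simp add: if_distrib[of "\<lambda>x. x * _"] cong: if_cong)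
  show ?thesis
    unfolding Av cv by (simp add: distrib_right sum.distrib delta) (simp add: algebra_simps)
qed

text \<open>The diagonal entries lie in \<open>[0, 1]\<close> because they are nonnegative with sum one; choosing the
phase \<open>c\<close> in the two-point form turns positivity into
\<open>2 \<bar>A\<^sub>i\<^sub>j\<bar> \<le> A\<^sub>i\<^sub>i + A\<^sub>j\<^sub>j\<close>. The bound
serves as a domination that is uniform in time, path and parameter.\<close>

lemma norm_density_matrix_le:
  fixes A :: "complex^'d^'d"
  assumes "density_matrix A"
  shows "norm A \<le> real CARD('d) * real CARD('d)"
proof -
  have sa: "A $ j $ i = cnj (A $ i $ j)" for i j
  proof -
    have "ctranspose A $ j $ i = A $ j $ i"
      using assms by (simp add: density_matrix_def pos_semidef_def selfadjoint_def)
    then show ?thesis by (simp add: ctranspose_def transpose_def map_matrix_def)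
  qed
  have psd: "0 \<le> Re (A $ i $ i + c * A $ i $ j + cnj c * A $ j $ i + cnj c * c * A $ j $ j)" for i j c
  proof -
    have "0 \<le> Re (\<Sum>a\<in>UNIV. cnj (v $ a) * (A *v v) $ a)" for v
      using assms by (simp add: density_matrix_def pos_semidef_def)
    then show ?thesis unfolding quadratic_form_two_points[symmetric] .
  qed
  have nn: "0 \<le> Re (A $ i $ i)" for i
    using psd[of i 0 i] by simp
  have le1: "Re (A $ i $ i) \<le> 1" for i
  proof -
    have "Re (trace A) = 1" using assms by (simp add: density_matrix_def)
    then have "(\<Sum>i\<in>UNIV. Re (A $ i $ i)) = 1" by (simp add: trace_def)
    then show ?thesis using member_le_sum[of i UNIV "\<lambda>i. Re (A $ i $ i)"] nn by simp
  qed
  have entry: "norm (A $ i $ j) \<le> 1" for i j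
  proof (cases "A $ i $ j = 0")
    case False
    let ?z = "A $ i $ j"
    (* The phase for which the cross term of the two-point form is -|z|. *)
    define c where "c = - cnj ?z / complex_of_real (norm ?z)"
    have z: "cnj ?z * ?z = complex_of_real ((norm ?z)\<^sup>2)"
      by (metis complex_norm_square mult.commute)
    have "c * ?z = - (cnj ?z * ?z) / complex_of_real (norm ?z)" by (simp only: c_def) simp
    also have "\<dots> = complex_of_real (- norm ?z)"
      unfolding z using False by (simp add: power2_eq_square)
    finally have cz: "c * ?z = complex_of_real (- norm ?z)" .
    have "norm c = 1" using False by (simp add: c_def norm_divide)
    then have cc: "cnj c * c = 1" using complex_norm_square[of c] by (simp add: mult.commute)
    have "cnj c * A $ j $ i = cnj (c * ?z)" by (simp only: sa[of j i] complex_cnj_mult)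
    then have "cnj c * A $ j $ i = complex_of_real (- norm ?z)" by (simp only: cz complex_cnj_complex_of_real)
    then have "0 \<le> Re (A $ i $ i) + Re (A $ j $ j) - 2 * norm ?z"
      using psd[of i c j] unfolding cz cc by simp
    then show ?thesis using le1[of i] le1[of j] by simp
  qed simp
  have "norm A \<le> (\<Sum>i\<in>UNIV. norm (A $ i))"
    unfolding norm_vec_def[of A] by (intro L2_set_le_sum) simp
  also have "\<dots> \<le> (\<Sum>i\<in>(UNIV::'d set). real CARD('d))"
  proof (rule sum_mono)
    fix i
    have "norm (A $ i) \<le> (\<Sum>j\<in>UNIV. norm (A $ i $ j))"
      unfolding norm_vec_def[of "A $ i"] by (intro L2_set_le_sum) simp
    also have "\<dots> \<le> (\<Sum>j\<in>(UNIV::'d set). 1)" by (intro sum_mono entry)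
    finally show "norm (A $ i) \<le> real CARD('d)" by simp
  qed
  finally show ?thesis by simp
qed

section \<open>Linear integral equations\<close>

lemma set_integral_increment_bound:
  fixes f :: "real \<Rightarrow> 'b::euclidean_space"
  assumes int: "set_integrable lborel {0..T} f" and B: "\<And>s. s \<in> {0..T} \<Longrightarrow> norm (f s) \<le> B"
    and s: "s \<in> {0..T}" and t: "t \<in> {0..T}"
  shows "norm ((LINT r:{0..t}|lborel. f r) - (LINT r:{0..s}|lborel. f r)) \<le> B * \<bar>t - s\<bar>"
proof -
  have *: "norm ((LINT r:{0..t}|lborel. f r) - (LINT r:{0..s}|lborel. f r)) \<le> B * (t - s)"
    if st: "s \<in> {0..T}" "t \<in> {0..T}" "s \<le> t" for s t
  proof -
    have i0: "f integrable_on {0..T}" by (rule set_borel_integral_eq_integral(1)[OF int])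
    have "(LINT r:{0..u}|lborel. f r) = integral {0..u} f" if "u \<in> {0..T}" for u
      by (rule set_borel_integral_eq_integral(2)[OF set_integrable_subset[OF int]]) (use that in auto)
    from this[OF st(1)] this[OF st(2)]
    have "(LINT r:{0..t}|lborel. f r) - (LINT r:{0..s}|lborel. f r) = integral {0..t} f - integral {0..s} f"
      by simp
    also have "\<dots> = integral {s..t} f"
      using Henstock_Kurzweil_Integration.integral_combine[of 0 s t, where f = f] st
        integrable_on_subinterval[OF i0, where a = 0 and b = t]
      by (simp add: algebra_simps)
    also have "norm \<dots> \<le> integral {s..t} (\<lambda>_. B)"
      by (intro integral_norm_bound_integral integrable_on_subinterval[OF i0] integrable_const_ivl B)
        (use st in auto)
    finally show ?thesis using st by (simp add: mult.commute)
  qed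
  show ?thesis
  proof (cases "s \<le> t")
    case True
    then show ?thesis using *[OF s t] by simp
  next
    case False
    then show ?thesis using *[OF t s] by (simp add: norm_minus_commute abs_if)
  qed
qed

lemma lipschitz_integral_equation:
  fixes \<Lambda> :: "'a::euclidean_space \<Rightarrow>\<^sub>L 'a"
  assumes eq: "\<And>t. t \<in> {0..T} \<Longrightarrow> e t = e0 + (LINT s:{0..t}|lborel. \<Lambda> (e s))"
    and int: "set_integrable lborel {0..T} (\<lambda>s. \<Lambda> (e s))"
    and C: "\<And>t. t \<in> {0..T} \<Longrightarrow> norm (e t) \<le> C"
    and s: "s \<in> {0..T}" and t: "t \<in> {0..T}"
  shows "norm (e t - e s) \<le> norm \<Lambda> * C * \<bar>t - s\<bar>"
proof -
  have bound: "norm (\<Lambda> (e r)) \<le> norm \<Lambda> * C" if "r \<in> {0..T}" for r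
    by (rule order_trans[OF norm_blinfun mult_left_mono[OF C[OF that]]]) simp
  show ?thesis
    using set_integral_increment_bound[OF int bound s t] by (simp add: eq[OF s] eq[OF t])
qed

text \<open>Let \<open>m\<close> be the maximum of the weighted function \<open>exp (-2bt) u t\<close>. Inserting
\<open>u r \<le> m exp (2br)\<close> into the hypothesis at the maximizer gives \<open>m \<le> a + m/2\<close>.\<close>

lemma gronwall_weighted:
  fixes u :: "real \<Rightarrow> real"
  assumes T: "0 \<le> T" and b: "0 < b"
    and u: "continuous_on {0..T} u"
    and a: "0 \<le> a"
    and le: "\<And>t. t \<in> {0..T} \<Longrightarrow> u t \<le> a + b * integral {0..t} u"
    and t: "t \<in> {0..T}"
  shows "u t \<le> 2 * a * exp (2 * b * t)"
proof -
  define v where "v t = u t * exp (- 2 * b * t)" for t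
  have "continuous_on {0..T} v" unfolding v_def by (intro continuous_intros u)
  then obtain s where s: "s \<in> {0..T}" and max: "\<And>r. r \<in> {0..T} \<Longrightarrow> v r \<le> v s"
    using continuous_attains_sup[of "{0..T}" v] T by auto
  have ur: "u r \<le> v s * exp (2 * b * r)" if "r \<in> {0..T}" for r
  proof -
    have "u r = v r * exp (2 * b * r)" by (simp add: v_def exp_minus)
    also have "\<dots> \<le> v s * exp (2 * b * r)" using max[OF that] by simp
    finally show ?thesis .
  qed
  have int: "((\<lambda>r. v s * exp (2 * b * r)) has_integral
      (v s * exp (2 * b * s) / (2 * b) - v s * exp (2 * b * 0) / (2 * b))) {0..s}"
    using s b by (intro fundamental_theorem_of_calculus)
      (auto intro!: derivative_eq_intros simp: has_real_derivative_iff_has_vector_derivative[symmetric])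
  have "u s \<le> a + b * integral {0..s} u" by (rule le[OF s])
  also have "integral {0..s} u \<le> integral {0..s} (\<lambda>r. v s * exp (2 * b * r))"
    using s int ur
    by (intro integral_le integrable_continuous_real continuous_on_subset[OF u] continuous_intros) auto
  also have "\<dots> = v s * (exp (2 * b * s) - 1) / (2 * b)"
    by (subst integral_unique[OF int]) (simp add: algebra_simps diff_divide_distrib)
  finally have "u s \<le> a + v s * (exp (2 * b * s) - 1) / 2" using b by simp
  moreover have "u s = v s * exp (2 * b * s)" by (simp add: v_def exp_minus)
  ultimately have vs: "v s * exp (2 * b * s) + v s \<le> 2 * a" by (simp add: field_simps)
  have "v s \<le> 2 * a"
  proof (cases "v s \<ge> 0")
    case True
    then have "0 \<le> v s * exp (2 * b * s)" by simp
    then show ?thesis using vs by linarith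
  next
    case False
    then show ?thesis using a by linarith
  qed
  then have "v s * exp (2 * b * t) \<le> 2 * a * exp (2 * b * t)" by simp
  then show ?thesis using ur[OF t] by linarith
qed

text \<open>The difference of the solutions satisfies a Gronwall inequality whose inhomogeneity is
\<open>\<parallel>\<Lambda> - \<Lambda>'\<parallel> C T\<close>. For \<open>\<Lambda> = \<Lambda>'\<close> this is uniqueness, otherwise continuous dependence on the
coefficient.\<close>

lemma integral_equation_stability:
  fixes \<Lambda> \<Lambda>' :: "'a::euclidean_space \<Rightarrow>\<^sub>L 'a"
  assumes eq: "\<And>t. t \<in> {0..T} \<Longrightarrow> e t = e0 + (LINT s:{0..t}|lborel. \<Lambda> (e s))"
    and eq': "\<And>t. t \<in> {0..T} \<Longrightarrow> e' t = e0 + (LINT s:{0..t}|lborel. \<Lambda>' (e' s))"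
    and int: "set_integrable lborel {0..T} (\<lambda>s. \<Lambda> (e s))"
    and int': "set_integrable lborel {0..T} (\<lambda>s. \<Lambda>' (e' s))"
    and C: "\<And>t. t \<in> {0..T} \<Longrightarrow> norm (e t) \<le> C" "\<And>t. t \<in> {0..T} \<Longrightarrow> norm (e' t) \<le> C"
    and b: "norm \<Lambda> \<le> b" "0 < b" and t: "t \<in> {0..T}"
  shows "norm (e t - e' t) \<le> 2 * (norm (\<Lambda> - \<Lambda>') * C * T) * exp (2 * b * T)"
proof -
  have T: "0 \<le> T" using t by auto
  have C0: "0 \<le> C" using C(1)[OF t] norm_ge_zero order_trans by blast
  have cont: "continuous_on {0..T} e"
  proof (rule lipschitz_on_continuous_on)
    show "(norm \<Lambda> * C)-lipschitz_on {0..T} e"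
      using lipschitz_integral_equation[OF eq int C(1)] C0
      by (intro lipschitz_onI) (auto simp: dist_norm dist_real_def)
  qed
  have cont': "continuous_on {0..T} e'"
  proof (rule lipschitz_on_continuous_on)
    show "(norm \<Lambda>' * C)-lipschitz_on {0..T} e'"
      using lipschitz_integral_equation[OF eq' int' C(2)] C0
      by (intro lipschitz_onI) (auto simp: dist_norm dist_real_def)
  qed
  define a where "a = norm (\<Lambda> - \<Lambda>') * C * T"
  have a0: "0 \<le> a" using C0 T by (simp add: a_def)
  have "norm (e t - e' t) \<le> 2 * a * exp (2 * b * t)"
  proof (rule gronwall_weighted[OF T b(2) _ a0 _ t])
    show "continuous_on {0..T} (\<lambda>t. norm (e t - e' t))" by (intro continuous_intros cont cont')
    fix r assume r: "r \<in> {0..T}"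
    have sub: "{0..r} \<subseteq> {0..T}" using r by auto
    have c: "continuous_on {0..r} e" "continuous_on {0..r} e'"
      using cont cont' sub by (auto intro: continuous_on_subset)
    have "e r - e' r = (LINT s:{0..r}|lborel. \<Lambda> (e s)) - (LINT s:{0..r}|lborel. \<Lambda>' (e' s))"
      using eq[OF r] eq'[OF r] by simp
    also have "\<dots> = integral {0..r} (\<lambda>s. \<Lambda> (e s)) - integral {0..r} (\<lambda>s. \<Lambda>' (e' s))"
      by (subst (1 2) set_borel_integral_eq_integral(2))
        (use sub in \<open>auto intro!: set_integrable_subset[OF int] set_integrable_subset[OF int']\<close>)
    also have "\<dots> = integral {0..r} (\<lambda>s. \<Lambda> (e s) - \<Lambda>' (e' s))"
      by (intro integral_diff[symmetric] integrable_continuous_real continuous_intros c)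
    also have "norm \<dots> \<le> integral {0..r} (\<lambda>s. norm (\<Lambda> - \<Lambda>') * C + b * norm (e s - e' s))"
    proof (intro integral_norm_bound_integral integrable_continuous_real continuous_intros c)
      fix s assume s: "s \<in> {0..r}"
      have "\<Lambda> (e s) - \<Lambda>' (e' s) = (\<Lambda> - \<Lambda>') (e' s) + \<Lambda> (e s - e' s)"
        by (simp add: blinfun.diff_left blinfun.diff_right)
      also have "norm \<dots> \<le> norm ((\<Lambda> - \<Lambda>') (e' s)) + norm (\<Lambda> (e s - e' s))" by (rule norm_triangle_ineq)
      also have "norm ((\<Lambda> - \<Lambda>') (e' s)) \<le> norm (\<Lambda> - \<Lambda>') * C"
        using C(2)[of s] s sub by (intro order_trans[OF norm_blinfun] mult_left_mono) auto
      also have "norm (\<Lambda> (e s - e' s)) \<le> b * norm (e s - e' s)"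
        by (intro order_trans[OF norm_blinfun] mult_right_mono b) auto
      finally show "norm (\<Lambda> (e s) - \<Lambda>' (e' s)) \<le> norm (\<Lambda> - \<Lambda>') * C + b * norm (e s - e' s)" by simp
    qed
    also have "\<dots> = norm (\<Lambda> - \<Lambda>') * C * r + b * integral {0..r} (\<lambda>s. norm (e s - e' s))"
      using r by (subst integral_add) (auto intro!: integrable_continuous_real continuous_intros c)
    also have "norm (\<Lambda> - \<Lambda>') * C * r \<le> a"
      unfolding a_def using r C0 by (intro mult_left_mono) auto
    finally show "norm (e r - e' r) \<le> a + b * integral {0..r} (\<lambda>s. norm (e s - e' s))" by simp
  qed
  also have "\<dots> \<le> 2 * a * exp (2 * b * T)"
    using a0 t b by (intro mult_left_mono) auto
  finally show ?thesis by (simp add: a_def)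
qed

text \<open>In finite dimension, pointwise continuity of a family of linear maps is continuity in operator
norm, and compactness then yields a common bound.\<close>

lemma uniformly_bounded_continuous_blinfun:
  fixes f :: "'q::metric_space \<Rightarrow> 'a::euclidean_space \<Rightarrow> 'b::euclidean_space"
  assumes S: "compact S" and lin: "\<And>\<theta>. bounded_linear (f \<theta>)"
    and cont: "\<And>x. continuous_on S (\<lambda>\<theta>. f \<theta> x)"
  obtains F b where "\<And>\<theta>. blinfun_apply (F \<theta>) = f \<theta>" "continuous_on S F" "0 < b"
    "\<And>\<theta>. \<theta> \<in> S \<Longrightarrow> norm (F \<theta>) \<le> b"
proof -
  define F where "F \<theta> = Blinfun (f \<theta>)" for \<theta>
  have F: "blinfun_apply (F \<theta>) = f \<theta>" for \<theta> unfolding F_def by (rule bounded_linear_Blinfun_apply[OF lin])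
  have Fc: "continuous_on S F" by (rule continuous_on_blinfun_componentwise) (simp add: F cont)
  have "bounded (F ` S)" by (intro compact_imp_bounded compact_continuous_image Fc S)
  then obtain b where "0 < b" "\<forall>x\<in>F ` S. norm x \<le> b" by (auto simp: bounded_pos)
  with F Fc show thesis by (intro that[of F b]) auto
qed

text \<open>The properties of \<open>h(t, \<theta>) = b(L\<^sub>\<theta>, e\<^sub>\<theta>(t))\<close> that the contrast needs, with one constant for all
parameters. Continuity in the parameter comes from stability of the linear equation,
the Lipschitz bound in time from boundedness of its right-hand side.\<close>

lemma mean_signal_regularity:
  fixes H :: "'q::metric_space \<Rightarrow> complex^'d^'d" and L :: "'q \<Rightarrow> 'r::finite \<Rightarrow> complex^'d^'d"
    and e :: "'q \<Rightarrow> real \<Rightarrow> complex^'d^'d"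
  assumes T: "0 < T" and \<Theta>: "compact \<Theta>" and B: "0 \<le> B"
    and Hc: "continuous_on \<Theta> H" and Lc: "\<And>k. continuous_on \<Theta> (\<lambda>\<theta>. L \<theta> k)"
    and eq: "\<And>\<theta> t. \<theta> \<in> \<Theta> \<Longrightarrow> t \<in> {0..T} \<Longrightarrow> e \<theta> t = \<rho>0 + (LINT s:{0..t}|lborel. lindblad (H \<theta>) (L \<theta>) (e \<theta> s))"
    and int: "\<And>\<theta>. \<theta> \<in> \<Theta> \<Longrightarrow> set_integrable lborel {0..T} (\<lambda>s. lindblad (H \<theta>) (L \<theta>) (e \<theta> s))"
    and eB: "\<And>\<theta> t. \<theta> \<in> \<Theta> \<Longrightarrow> t \<in> {0..T} \<Longrightarrow> norm (e \<theta> t) \<le> B"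
  obtains C where "0 \<le> C"
    "\<And>\<theta> t. \<theta> \<in> \<Theta> \<Longrightarrow> t \<in> {0..T} \<Longrightarrow> norm (bvec (L \<theta>) (e \<theta> t)) \<le> C"
    "\<And>\<theta> s t. \<theta> \<in> \<Theta> \<Longrightarrow> s \<in> {0..T} \<Longrightarrow> t \<in> {0..T} \<Longrightarrow>
      norm (bvec (L \<theta>) (e \<theta> t) - bvec (L \<theta>) (e \<theta> s)) \<le> C * \<bar>t - s\<bar>"
    "\<And>t. t \<in> {0..T} \<Longrightarrow> continuous_on \<Theta> (\<lambda>\<theta>. bvec (L \<theta>) (e \<theta> t))"
proof -
  obtain \<Lambda> b where \<Lambda>: "\<And>\<theta>. blinfun_apply (\<Lambda> \<theta>) = lindblad (H \<theta>) (L \<theta>)" and \<Lambda>c: "continuous_on \<Theta> \<Lambda>"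
    and b: "0 < b" "\<And>\<theta>. \<theta> \<in> \<Theta> \<Longrightarrow> norm (\<Lambda> \<theta>) \<le> b"
    by (rule uniformly_bounded_continuous_blinfun[where f = "\<lambda>\<theta>. lindblad (H \<theta>) (L \<theta>)", OF \<Theta> bounded_linear_lindblad continuous_on_lindblad[OF Hc Lc]]) blast
  obtain G g where G: "\<And>\<theta>. blinfun_apply (G \<theta>) = bvec (L \<theta>)" and Gc: "continuous_on \<Theta> G"
    and g: "0 < g" "\<And>\<theta>. \<theta> \<in> \<Theta> \<Longrightarrow> norm (G \<theta>) \<le> g"
    by (rule uniformly_bounded_continuous_blinfun[where f = "\<lambda>\<theta>. bvec (L \<theta>)", OF \<Theta> bounded_linear_bvec continuous_on_bvec[OF Lc]]) blast
  note eq' = eq[folded \<Lambda>] and int' = int[folded \<Lambda>]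
  have Gx: "norm (bvec (L \<theta>) x) \<le> g * norm x" if "\<theta> \<in> \<Theta>" for \<theta> x
    unfolding G[symmetric] by (rule order_trans[OF norm_blinfun mult_right_mono[OF g(2)[OF that]]]) simp
  have ec: "continuous_on \<Theta> (\<lambda>\<theta>. e \<theta> t)" if t: "t \<in> {0..T}" for t
    unfolding continuous_on_def
  proof
    fix \<theta> assume \<theta>: "\<theta> \<in> \<Theta>"
    let ?F = "at \<theta> within \<Theta>"
    have "((\<lambda>\<eta>. e \<eta> t - e \<theta> t) \<longlongrightarrow> 0) ?F"
    proof (rule Lim_null_comparison)
      have "norm (e \<eta> t - e \<theta> t) \<le> 2 * (norm (\<Lambda> \<eta> - \<Lambda> \<theta>) * B * T) * exp (2 * b * T)" if "\<eta> \<in> \<Theta>" for \<eta>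
        by (rule integral_equation_stability[OF eq'[OF that] eq'[OF \<theta>] int'[OF that] int'[OF \<theta>]
              eB[OF that] eB[OF \<theta>] b(2)[OF that] b(1) t])
      then show "\<forall>\<^sub>F \<eta> in ?F. norm (e \<eta> t - e \<theta> t) \<le> 2 * (norm (\<Lambda> \<eta> - \<Lambda> \<theta>) * B * T) * exp (2 * b * T)"
        unfolding eventually_at_filter by (intro always_eventually) auto
      have "(\<Lambda> \<longlongrightarrow> \<Lambda> \<theta>) ?F" using \<Lambda>c \<theta> by (simp add: continuous_on_def)
      then have "((\<lambda>\<eta>. 2 * (norm (\<Lambda> \<eta> - \<Lambda> \<theta>) * B * T) * exp (2 * b * T)) \<longlongrightarrow>
          2 * (norm (\<Lambda> \<theta> - \<Lambda> \<theta>) * B * T) * exp (2 * b * T)) ?F" by (intro tendsto_intros)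
      then show "((\<lambda>\<eta>. 2 * (norm (\<Lambda> \<eta> - \<Lambda> \<theta>) * B * T) * exp (2 * b * T)) \<longlongrightarrow> 0) ?F" by simp
    qed
    then show "((\<lambda>\<theta>. e \<theta> t) \<longlongrightarrow> e \<theta> t) ?F" by (rule LIM_zero_cancel)
  qed
  define C where "C = max (g * B) (g * (b * B))"
  show thesis
  proof (rule that[of C])
    show "0 \<le> C" using g(1) B by (simp add: C_def le_max_iff_disj)
    show "norm (bvec (L \<theta>) (e \<theta> t)) \<le> C" if "\<theta> \<in> \<Theta>" "t \<in> {0..T}" for \<theta> t
    proof -
      have "norm (bvec (L \<theta>) (e \<theta> t)) \<le> g * B"
        using eB[OF that] g(1) by (intro order_trans[OF Gx[OF that(1)] mult_left_mono]) auto
      then show ?thesis by (simp add: C_def)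
    qed
    show "norm (bvec (L \<theta>) (e \<theta> t) - bvec (L \<theta>) (e \<theta> s)) \<le> C * \<bar>t - s\<bar>"
      if \<theta>: "\<theta> \<in> \<Theta>" and st: "s \<in> {0..T}" "t \<in> {0..T}" for \<theta> s t
    proof -
      have "norm (e \<theta> t - e \<theta> s) \<le> norm (\<Lambda> \<theta>) * B * \<bar>t - s\<bar>"
        by (rule lipschitz_integral_equation[OF eq'[OF \<theta>] int'[OF \<theta>] eB[OF \<theta>] st])
      also have "\<dots> \<le> b * B * \<bar>t - s\<bar>" using b(2)[OF \<theta>] B by (intro mult_right_mono) auto
      finally have "g * norm (e \<theta> t - e \<theta> s) \<le> g * (b * B * \<bar>t - s\<bar>)" using g(1) by simp
      moreover have "norm (bvec (L \<theta>) (e \<theta> t) - bvec (L \<theta>) (e \<theta> s)) \<le> g * norm (e \<theta> t - e \<theta> s)"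
        unfolding linear_diff[OF bounded_linear.linear[OF bounded_linear_bvec], symmetric] by (rule Gx[OF \<theta>])
      moreover have "g * (b * B) * \<bar>t - s\<bar> \<le> C * \<bar>t - s\<bar>" by (intro mult_right_mono) (simp_all add: C_def)
      ultimately show ?thesis by (simp add: mult.assoc)
    qed
    show "continuous_on \<Theta> (\<lambda>\<theta>. bvec (L \<theta>) (e \<theta> t))" if "t \<in> {0..T}" for t
      unfolding G[symmetric] by (intro continuous_intros Gc ec that)
  qed
qed

section \<open>Independence up to null sets\<close>

text \<open>Working with sets up to null sets handles two things at once: the null sets added to the
filtrations, and \<open>W\<^sub>0 = 0\<close>, which holds only almost surely.\<close>

definition ae_hull :: "'a measure \<Rightarrow> 'a set set \<Rightarrow> 'a set set" where
  "ae_hull M F = {A \<in> sets M. \<exists>B\<in>F. AE \<omega> in M. \<omega> \<in> A \<longleftrightarrow> \<omega> \<in> B}"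

lemma ae_hullI: "A \<in> sets M \<Longrightarrow> B \<in> F \<Longrightarrow> AE \<omega> in M. \<omega> \<in> A \<longleftrightarrow> \<omega> \<in> B \<Longrightarrow> A \<in> ae_hull M F"
  by (auto simp: ae_hull_def)

lemma Int_stable_ae_hull:
  assumes "Int_stable F" shows "Int_stable (ae_hull M F)"
proof (rule Int_stableI)
  fix A A' assume "A \<in> ae_hull M F" "A' \<in> ae_hull M F"
  then obtain B B' where B: "B \<in> F" "AE \<omega> in M. \<omega> \<in> A \<longleftrightarrow> \<omega> \<in> B"
    and B': "B' \<in> F" "AE \<omega> in M. \<omega> \<in> A' \<longleftrightarrow> \<omega> \<in> B'" and A: "A \<in> sets M" "A' \<in> sets M"
    by (auto simp: ae_hull_def)
  have "AE \<omega> in M. \<omega> \<in> A \<inter> A' \<longleftrightarrow> \<omega> \<in> B \<inter> B'" using B(2) B'(2) by eventually_elim auto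
  then show "A \<inter> A' \<in> ae_hull M F"
    using A B(1) B'(1) Int_stableD[OF assms, of B B'] by (intro ae_hullI[of _ _ "B \<inter> B'"]) auto
qed

lemma null_sets_subset_ae_hull: "{} \<in> F \<Longrightarrow> null_sets M \<subseteq> ae_hull M F"
  by (auto intro!: ae_hullI[of _ _ "{}"] simp: AE_not_in)

lemma (in prob_space) indep_sets_ae_hull:
  assumes "indep_sets F I"
  shows "indep_sets (\<lambda>i. ae_hull M (F i)) I"
  unfolding ae_hull_def
proof (rule indep_setsI)
  fix A J assume J: "J \<noteq> {}" "J \<subseteq> I" "finite J"
    and A: "\<forall>j\<in>J. A j \<in> {A \<in> events. \<exists>B\<in>F j. AE \<omega> in M. \<omega> \<in> A \<longleftrightarrow> \<omega> \<in> B}"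
  from A have "\<forall>j\<in>J. \<exists>B. B \<in> F j \<and> (AE \<omega> in M. \<omega> \<in> A j \<longleftrightarrow> \<omega> \<in> B)" by auto
  then obtain B where B: "\<And>j. j \<in> J \<Longrightarrow> B j \<in> F j"
    "\<And>j. j \<in> J \<Longrightarrow> AE \<omega> in M. \<omega> \<in> A j \<longleftrightarrow> \<omega> \<in> B j" by metis
  have Bev: "B j \<in> events" if "j \<in> J" for j
    using assms B(1)[OF that] J(2) that by (auto simp: indep_sets_def)
  have Aev: "A j \<in> events" if "j \<in> J" for j using A that by auto
  have "prob (\<Inter>j\<in>J. A j) = prob (\<Inter>j\<in>J. B j)"
  proof (rule finite_measure_eq_AE)
    have "AE \<omega> in M. \<forall>j\<in>J. \<omega> \<in> A j \<longleftrightarrow> \<omega> \<in> B j"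
      using B(2) J(3) by (simp add: AE_finite_all)
    then show "AE \<omega> in M. \<omega> \<in> (\<Inter>j\<in>J. A j) \<longleftrightarrow> \<omega> \<in> (\<Inter>j\<in>J. B j)" by (auto elim: eventually_mono)
  qed (use J Aev Bev in \<open>auto intro!: sets.finite_INT\<close>)
  also have "\<dots> = (\<Prod>j\<in>J. prob (B j))"
    using assms J B by (intro indep_setsD) auto
  also have "\<dots> = (\<Prod>j\<in>J. prob (A j))"
  proof (intro prod.cong refl finite_measure_eq_AE)
    fix j assume j: "j \<in> J"
    show "AE \<omega> in M. \<omega> \<in> B j \<longleftrightarrow> \<omega> \<in> A j" using B(2)[OF j] by (auto elim: eventually_mono)
  qed (use Aev Bev in auto)
  finally show "prob (\<Inter>j\<in>J. A j) = (\<Prod>j\<in>J. prob (A j))" .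
qed auto

lemma subset_ae_hull: "F \<subseteq> sets M \<Longrightarrow> F \<subseteq> ae_hull M F"
  by (auto intro!: ae_hullI)

lemma Int_stable_vimages: "Int_stable {f -` B \<inter> \<Omega> | B. B \<in> sets N}"
proof (rule Int_stableI)
  fix X Y assume "X \<in> {f -` B \<inter> \<Omega> | B. B \<in> sets N}" "Y \<in> {f -` B \<inter> \<Omega> | B. B \<in> sets N}"
  then obtain B C where "B \<in> sets N" "C \<in> sets N" "X = f -` B \<inter> \<Omega>" "Y = f -` C \<inter> \<Omega>" by auto
  then show "X \<inter> Y \<in> {f -` B \<inter> \<Omega> | B. B \<in> sets N}"
    by (intro CollectI exI[of _ "B \<inter> C"]) auto
qed

lemma (in prob_space) indep_set_mono:
  assumes "indep_set A B" "A' \<subseteq> A" "B' \<subseteq> B" shows "indep_set A' B'"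
proof -
  have *: "A \<subseteq> events" "B \<subseteq> events" "\<And>a b. a \<in> A \<Longrightarrow> b \<in> B \<Longrightarrow> prob (a \<inter> b) = prob a * prob b"
    using assms(1) by (auto simp: indep_sets2_eq)
  show ?thesis
    unfolding indep_sets2_eq
  proof (intro conjI ballI)
    show "A' \<subseteq> events" "B' \<subseteq> events" using *(1,2) assms(2,3) by blast+
    show "prob (a \<inter> b) = prob a * prob b" if "a \<in> A'" "b \<in> B'" for a b
      using that assms(2,3) by (intro *(3)) auto
  qed
qed

lemma (in prob_space) indep_set_ae_hull_sigma:
  assumes "indep_set F G" "Int_stable F" "Int_stable G"
  shows "indep_set (sigma_sets (space M) (ae_hull M F)) (sigma_sets (space M) (ae_hull M G))"
proof (rule indep_set_sigma_sets)
  have "indep_sets (\<lambda>i. ae_hull M (case_bool F G i)) UNIV"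
    using assms(1) unfolding indep_set_def by (rule indep_sets_ae_hull)
  also have "(\<lambda>i. ae_hull M (case_bool F G i)) = case_bool (ae_hull M F) (ae_hull M G)"
    by (simp add: fun_eq_iff split: bool.split)
  finally show "indep_set (ae_hull M F) (ae_hull M G)" unfolding indep_set_def .
qed (intro Int_stable_ae_hull assms)+

lemma (in prob_space) indep_vars_of_indep_subalgebras:
  assumes ind: "indep_sets (\<lambda>i. sets (F i)) I"
    and sp: "\<And>i. i \<in> I \<Longrightarrow> space (F i) = space M"
    and X: "\<And>i. i \<in> I \<Longrightarrow> X i \<in> measurable (F i) (N i)"
  shows "indep_vars N X I"
  unfolding indep_vars_def
proof (intro conjI ballI)
  have ev: "sets (F i) \<subseteq> events" if "i \<in> I" for i using ind that by (auto simp: indep_sets_def)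
  show "random_variable (N i) (X i)" if i: "i \<in> I" for i
    by (rule measurable_from_subalg[OF _ X[OF i]]) (simp add: subalgebra_def sp[OF i] ev[OF i])
  show "indep_sets (\<lambda>i. sigma_sets (space M) {X i -` A \<inter> space M | A. A \<in> sets (N i)}) I"
  proof (rule indep_sets_mono_sets[OF ind])
    fix i assume i: "i \<in> I"
    have "{X i -` A \<inter> space M | A. A \<in> sets (N i)} \<subseteq> sets (F i)"
      using measurable_sets[OF X[OF i]] by (auto simp: sp[OF i])
    then have "sigma_sets (space (F i)) {X i -` A \<inter> space M | A. A \<in> sets (N i)} \<subseteq> sets (F i)"
      by (rule sets.sigma_sets_subset)
    then show "sigma_sets (space M) {X i -` A \<inter> space M | A. A \<in> sets (N i)} \<subseteq> sets (F i)"
      by (simp add: sp[OF i])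
  qed
qed

section \<open>A uniform law of large numbers\<close>

text \<open>Induction on the index set. When a centred independent summand \<open>\<xi>\<close> is added to the partial sum
\<open>S\<close>, only even mixed terms survive:
\<open>E (S + \<xi>)\<^sup>4 = E S\<^sup>4 + 6 E S\<^sup>2 E \<xi>\<^sup>2 + E \<xi>\<^sup>4\<close>. The bound on second moments is carried along for the
middle term; the fourth moments grow only quadratically in the number of summands.\<close>

lemma (in prob_space) moments_sum_indep:
  fixes \<xi> :: "'i \<Rightarrow> 'a \<Rightarrow> real" and c :: real
  assumes "finite I" and "indep_vars (\<lambda>_. borel) \<xi> I"
    and "\<And>i. i \<in> I \<Longrightarrow> integrable M (\<lambda>\<omega>. \<xi> i \<omega> ^ 4)"
    and "\<And>i. i \<in> I \<Longrightarrow> expectation (\<xi> i) = 0"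
    and "\<And>i. i \<in> I \<Longrightarrow> expectation (\<lambda>\<omega>. \<xi> i \<omega> ^ 4) \<le> c\<^sup>2" and c: "0 < c"
  shows "integrable M (\<lambda>\<omega>. (\<Sum>i\<in>I. \<xi> i \<omega>) ^ 4) \<and>
    expectation (\<lambda>\<omega>. (\<Sum>i\<in>I. \<xi> i \<omega>) ^ 2) \<le> card I * c \<and>
    expectation (\<lambda>\<omega>. (\<Sum>i\<in>I. \<xi> i \<omega>) ^ 4) \<le> 3 * (card I)\<^sup>2 * c\<^sup>2"
proof -
  have low: "integrable M (\<lambda>\<omega>. X \<omega> ^ k)"
    if "random_variable borel X" "integrable M (\<lambda>\<omega>. X \<omega> ^ 4)" "k \<le> 4" for X :: "'a \<Rightarrow> real" and k
  proof (rule Bochner_Integration.integrable_bound)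
    show "integrable M (\<lambda>\<omega>. 1 + X \<omega> ^ 4)" using that by auto
    have "\<bar>x\<bar> ^ k \<le> 1 + \<bar>x\<bar> ^ 4" for x :: real
    proof (cases "\<bar>x\<bar> \<le> 1")
      case True
      then show ?thesis using power_le_one[of "\<bar>x\<bar>" k] by (simp add: add_increasing2)
    next
      case False
      then show ?thesis using power_increasing[of k 4 "\<bar>x\<bar>"] that by simp
    qed
    then show "AE \<omega> in M. norm (X \<omega> ^ k) \<le> norm (1 + X \<omega> ^ 4)" by (simp add: power_abs)
  qed (use that in measurable)
  show ?thesis
    using assms(1-5)
  proof (induction I rule: finite_induct)
    case empty
    then show ?case by simp
  next
    case (insert a I)
    define S where "S \<omega> = (\<Sum>i\<in>I. \<xi> i \<omega>)" for \<omega>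
    have IH: "integrable M (\<lambda>\<omega>. S \<omega> ^ 4)" "expectation (\<lambda>\<omega>. S \<omega> ^ 2) \<le> card I * c"
      "expectation (\<lambda>\<omega>. S \<omega> ^ 4) \<le> 3 * (card I)\<^sup>2 * c\<^sup>2"
      using insert.IH insert.prems indep_vars_subset[OF insert.prems(1)] by (auto simp: S_def)
    have rv: "random_variable borel (\<xi> i)" if "i \<in> insert a I" for i
      using insert.prems(1) that by (auto simp: indep_vars_def)
    then have Srv: "random_variable borel S" unfolding S_def by (intro borel_measurable_sum) auto
    have ind: "indep_var borel (\<xi> a) borel S"
      unfolding S_def by (rule indep_vars_sum[OF insert.hyps insert.prems(1)])
    have ipow: "integrable M (\<lambda>\<omega>. \<xi> a \<omega> ^ k)" "integrable M (\<lambda>\<omega>. S \<omega> ^ k)" if "k \<le> 4" for k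
      using low[OF rv _ that, of a] insert.prems(2)[of a] low[OF Srv IH(1) that] by auto
    have mix: "integrable M (\<lambda>\<omega>. \<xi> a \<omega> ^ k * S \<omega> ^ l)"
      "expectation (\<lambda>\<omega>. \<xi> a \<omega> ^ k * S \<omega> ^ l) = expectation (\<lambda>\<omega>. \<xi> a \<omega> ^ k) * expectation (\<lambda>\<omega>. S \<omega> ^ l)"
      if "k \<le> 4" "l \<le> 4" for k l
    proof -
      have "indep_var borel ((\<lambda>x. x ^ k) \<circ> \<xi> a) borel ((\<lambda>x. x ^ l) \<circ> S)"
        by (rule indep_var_compose[OF ind]) auto
      then show "integrable M (\<lambda>\<omega>. \<xi> a \<omega> ^ k * S \<omega> ^ l)"
        "expectation (\<lambda>\<omega>. \<xi> a \<omega> ^ k * S \<omega> ^ l) = expectation (\<lambda>\<omega>. \<xi> a \<omega> ^ k) * expectation (\<lambda>\<omega>. S \<omega> ^ l)"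
        using indep_var_integrable[of "\<lambda>\<omega>. \<xi> a \<omega> ^ k" "\<lambda>\<omega>. S \<omega> ^ l"]
          indep_var_lebesgue_integral[of "\<lambda>\<omega>. \<xi> a \<omega> ^ k" "\<lambda>\<omega>. S \<omega> ^ l"] ipow that
        by (auto simp: comp_def)
    qed
    have E1: "expectation (\<lambda>\<omega>. \<xi> a \<omega> ^ 1) = 0" using insert.prems(3)[of a] by simp
    have E4: "expectation (\<lambda>\<omega>. \<xi> a \<omega> ^ 4) \<le> c\<^sup>2" using insert.prems(4)[of a] by simp
    have ES1: "expectation (\<lambda>\<omega>. S \<omega> ^ 1) = 0"
    proof -
      have "integrable M (\<xi> i)" if "i \<in> I" for i
        using low[of "\<xi> i" 1] rv[of i] insert.prems(2)[of i] that by auto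
      then show ?thesis using insert.prems(3) by (simp add: S_def)
    qed
    (* The Cauchy-Schwarz bound for the second moment, from (x^2 - c)^2 >= 0. *)
    have E2: "expectation (\<lambda>\<omega>. \<xi> a \<omega> ^ 2) \<le> c"
    proof -
      have "2 * c * expectation (\<lambda>\<omega>. \<xi> a \<omega> ^ 2) = expectation (\<lambda>\<omega>. 2 * c * \<xi> a \<omega> ^ 2)" by simp
      also have "\<dots> \<le> expectation (\<lambda>\<omega>. \<xi> a \<omega> ^ 4 + c\<^sup>2)"
      proof (rule integral_mono)
        fix \<omega>
        have "0 \<le> (\<xi> a \<omega> ^ 2 - c)\<^sup>2" by simp
        then show "2 * c * \<xi> a \<omega> ^ 2 \<le> \<xi> a \<omega> ^ 4 + c\<^sup>2"
          by (simp add: power2_diff power_mult[symmetric] mult_ac)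
      qed (use ipow[of 2] ipow[of 4] in auto)
      also have "\<dots> \<le> c\<^sup>2 + c\<^sup>2" using E4 ipow[of 4] by (simp add: prob_space)
      finally show ?thesis using c by (simp add: power2_eq_square)
    qed
    have sum: "(\<Sum>i\<in>insert a I. \<xi> i \<omega>) = \<xi> a \<omega> + S \<omega>" for \<omega>
      using insert.hyps by (simp add: S_def)
    have ex4: "(\<xi> a \<omega> + S \<omega>) ^ 4 = \<xi> a \<omega> ^ 4 + 4 * (\<xi> a \<omega> ^ 3 * S \<omega> ^ 1) + 6 * (\<xi> a \<omega> ^ 2 * S \<omega> ^ 2)
        + 4 * (\<xi> a \<omega> ^ 1 * S \<omega> ^ 3) + S \<omega> ^ 4" for \<omega>
      by (simp add: eval_nat_numeral algebra_simps)
    have ex2: "(\<xi> a \<omega> + S \<omega>) ^ 2 = \<xi> a \<omega> ^ 2 + 2 * (\<xi> a \<omega> ^ 1 * S \<omega> ^ 1) + S \<omega> ^ 2" for \<omega>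
      by (simp add: eval_nat_numeral algebra_simps)
    have "expectation (\<lambda>\<omega>. (\<xi> a \<omega> + S \<omega>) ^ 2) = expectation (\<lambda>\<omega>. \<xi> a \<omega> ^ 2) + expectation (\<lambda>\<omega>. S \<omega> ^ 2)"
      unfolding ex2 using mix[of 1 1] ipow[of 2] E1 by simp
    then have two: "expectation (\<lambda>\<omega>. (\<xi> a \<omega> + S \<omega>) ^ 2) \<le> (card I + 1) * c"
      using E2 IH(2) by (simp add: algebra_simps)
    have "expectation (\<lambda>\<omega>. (\<xi> a \<omega> + S \<omega>) ^ 4) = expectation (\<lambda>\<omega>. \<xi> a \<omega> ^ 4)
        + 6 * (expectation (\<lambda>\<omega>. \<xi> a \<omega> ^ 2) * expectation (\<lambda>\<omega>. S \<omega> ^ 2)) + expectation (\<lambda>\<omega>. S \<omega> ^ 4)"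
      unfolding ex4 using mix[of 3 1] mix[of 2 2] mix[of 1 3] ipow[of 4] E1 ES1 by simp
    also have "\<dots> \<le> c\<^sup>2 + 6 * (c * (card I * c)) + 3 * (card I)\<^sup>2 * c\<^sup>2"
      using E4 IH E2 c by (intro add_mono mult_left_mono mult_mono) auto
    also have "\<dots> \<le> 3 * (card I + 1)\<^sup>2 * c\<^sup>2"
      using c by (simp add: power2_eq_square algebra_simps)
    finally have four: "expectation (\<lambda>\<omega>. (\<xi> a \<omega> + S \<omega>) ^ 4) \<le> 3 * (card I + 1)\<^sup>2 * c\<^sup>2" .
    have "integrable M (\<lambda>\<omega>. (\<xi> a \<omega> + S \<omega>) ^ 4)"
      unfolding ex4 using mix[of 3 1] mix[of 2 2] mix[of 1 3] ipow[of 4] by auto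
    then show ?case using two four insert.hyps by (simp add: sum add.commute)
  qed
qed

text \<open>A dyadic point of level \<open>m + 1\<close> is a point of level \<open>m\<close> or the right neighbour of one, so the
level-\<open>m\<close> steps add up to a geometric series. Continuity passes from dyadic points to all \<open>t\<close>.\<close>

lemma dyadic_chaining_bound:
  fixes x :: "real \<Rightarrow> real"
  assumes T: "0 < T" and q: "0 < q" "q < 1"
    and cont: "continuous_on {0..T} x" and x0: "x 0 = 0"
    and step: "\<And>m j. j < 2 ^ m \<Longrightarrow>
      \<bar>x (real (Suc j) * (T / 2 ^ m)) - x (real j * (T / 2 ^ m))\<bar> \<le> \<epsilon> * q ^ m"
    and t: "t \<in> {0..T}"
  shows "\<bar>x t\<bar> \<le> \<epsilon> / (1 - q)"
proof -
  have e0: "0 \<le> \<epsilon>" using step[of 0 0] by simp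
  have grid: "\<bar>x (real j * (T / 2 ^ m))\<bar> \<le> \<epsilon> * (\<Sum>k\<le>m. q ^ k)" if "j \<le> 2 ^ m" for j m
    using that
  proof (induction m arbitrary: j)
    case 0
    then have "j = 0 \<or> j = 1" by auto
    then show ?case using step[of 0 0] x0 e0 by auto
  next
    case (Suc m)
    have half: "real (2 * i) * (T / 2 ^ Suc m) = real i * (T / 2 ^ m)" for i by simp
    show ?case
    proof (cases "even j")
      case True
      then obtain i where i: "j = 2 * i" by blast
      have "\<bar>x (real j * (T / 2 ^ Suc m))\<bar> \<le> \<epsilon> * (\<Sum>k\<le>m. q ^ k)"
        unfolding i half using Suc i by auto
      also have "\<dots> \<le> \<epsilon> * (\<Sum>k\<le>Suc m. q ^ k)" using e0 q by (intro mult_left_mono) auto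
      finally show ?thesis .
    next
      case False
      then obtain i where i: "j = Suc (2 * i)" by (metis oddE Suc_eq_plus1)
      have "\<bar>x (real i * (T / 2 ^ m))\<bar> \<le> \<epsilon> * (\<Sum>k\<le>m. q ^ k)"
        using Suc i by auto
      moreover have "\<bar>x (real j * (T / 2 ^ Suc m)) - x (real i * (T / 2 ^ m))\<bar> \<le> \<epsilon> * q ^ Suc m"
        using step[of "2 * i" "Suc m"] Suc.prems unfolding i half by simp
      ultimately show ?thesis by (simp add: distrib_left)
    qed
  qed
  have geo: "\<epsilon> * (\<Sum>k\<le>m. q ^ k) \<le> \<epsilon> / (1 - q)" for m
  proof -
    have "(\<Sum>k\<le>m. q ^ k) = (1 - q ^ Suc m) / (1 - q)" using q by (subst sum_gp0) auto
    also have "\<dots> \<le> 1 / (1 - q)" using q by (intro divide_right_mono) auto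
    finally have "\<epsilon> * (\<Sum>k\<le>m. q ^ k) \<le> \<epsilon> * (1 / (1 - q))" by (rule mult_left_mono[OF _ e0])
    then show ?thesis by simp
  qed
  define s where "s m = real (nat \<lfloor>t / T * 2 ^ m\<rfloor>) * (T / 2 ^ m)" for m :: nat
  have fl: "real (nat \<lfloor>t / T * 2 ^ m\<rfloor>) \<le> t / T * 2 ^ m" "t / T * 2 ^ m - 1 \<le> real (nat \<lfloor>t / T * 2 ^ m\<rfloor>)"
    for m :: nat
  proof -
    have "0 \<le> t / T * 2 ^ m" using t T by simp
    then show "real (nat \<lfloor>t / T * 2 ^ m\<rfloor>) \<le> t / T * 2 ^ m" "t / T * 2 ^ m - 1 \<le> real (nat \<lfloor>t / T * 2 ^ m\<rfloor>)"
      by linarith+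
  qed
  have su: "s m \<le> t" and sl: "t - T / 2 ^ m \<le> s m" for m
  proof -
    have "s m \<le> t / T * 2 ^ m * (T / 2 ^ m)" unfolding s_def using T by (intro mult_right_mono fl) auto
    then show "s m \<le> t" using T by simp
    have "(t / T * 2 ^ m - 1) * (T / 2 ^ m) \<le> s m" unfolding s_def using T by (intro mult_right_mono fl) auto
    moreover have "(t / T * 2 ^ m - 1) * (T / 2 ^ m) = t - T / 2 ^ m"
    proof -
      have "(t / T * 2 ^ m - 1) * (T / 2 ^ m) = t / T * 2 ^ m * (T / 2 ^ m) - T / 2 ^ m"
        by (simp only: left_diff_distrib mult_1)
      also have "t / T * 2 ^ m * (T / 2 ^ m) = t" using T by simp
      finally show ?thesis .
    qed
    ultimately show "t - T / 2 ^ m \<le> s m" by (simp only:)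
  qed
  have s0: "0 \<le> s m" for m using T by (simp add: s_def)
  have sT: "s m \<in> {0..T}" for m using s0[of m] su[of m] t by simp
  have lim: "s \<longlonglongrightarrow> t"
  proof (rule tendsto_sandwich)
    have "(\<lambda>m. t - T * (1 / 2) ^ m) \<longlonglongrightarrow> t - T * 0"
      by (intro tendsto_intros LIMSEQ_power_zero) auto
    then show "(\<lambda>m. t - T / 2 ^ m) \<longlonglongrightarrow> t" by (simp add: power_one_over)
  qed (use su sl in auto)
  have "(\<lambda>m. x (s m)) \<longlonglongrightarrow> x t"
    by (rule continuous_on_tendsto_compose[OF cont lim]) (use t sT in auto)
  then have "(\<lambda>m. \<bar>x (s m)\<bar>) \<longlonglongrightarrow> \<bar>x t\<bar>" by (rule tendsto_rabs)
  moreover have "\<bar>x (s m)\<bar> \<le> \<epsilon> / (1 - q)" for m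
  proof -
    have "t / T * 2 ^ m \<le> 2 ^ m" using t T mult_right_mono[of "t / T" 1 "2 ^ m"] by simp
    then have "real (nat \<lfloor>t / T * 2 ^ m\<rfloor>) \<le> 2 ^ m" using fl(1)[of m] by linarith
    then have "nat \<lfloor>t / T * 2 ^ m\<rfloor> \<le> 2 ^ m" by (metis of_nat_le_iff of_nat_numeral of_nat_power)
    then show ?thesis unfolding s_def by (rule order_trans[OF grid geo])
  qed
  ultimately show ?thesis by (intro LIMSEQ_le_const2) auto
qed

text \<open>Strong law, uniform in time, for independent, not necessarily identically distributed processes. By
\<open>moments_sum_indep\<close> and Markov's inequality, an increment of the average over a dyadic interval of
level \<open>m\<close> exceeds \<open>\<epsilon> q\<^sup>m\<close> with probability \<open>O(4\<^sup>-\<^sup>m q\<^sup>-\<^sup>4\<^sup>m / N\<^sup>2)\<close>. There are \<open>2\<^sup>m\<close> such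
intervals, so for \<open>2 q\<^sup>4 > 1\<close> the sum over all levels is \<open>O(1/N\<^sup>2)\<close>, and Borel-Cantelli applies.\<close>

lemma (in prob_space) uniform_slln:
  fixes Z :: "nat \<Rightarrow> real \<Rightarrow> 'a \<Rightarrow> real"
  assumes T: "0 < T" and c: "0 < c"
    and ind: "\<And>s t. 0 \<le> s \<Longrightarrow> s < t \<Longrightarrow> t \<le> T \<Longrightarrow> indep_vars (\<lambda>_. borel) (\<lambda>i \<omega>. Z i t \<omega> - Z i s \<omega>) {1..}"
    and int: "\<And>i s t. 1 \<le> i \<Longrightarrow> 0 \<le> s \<Longrightarrow> s < t \<Longrightarrow> t \<le> T \<Longrightarrow> integrable M (\<lambda>\<omega>. (Z i t \<omega> - Z i s \<omega>) ^ 4)"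
    and mean: "\<And>i s t. 1 \<le> i \<Longrightarrow> 0 \<le> s \<Longrightarrow> s < t \<Longrightarrow> t \<le> T \<Longrightarrow> expectation (\<lambda>\<omega>. Z i t \<omega> - Z i s \<omega>) = 0"
    and m4: "\<And>i s t. 1 \<le> i \<Longrightarrow> 0 \<le> s \<Longrightarrow> s < t \<Longrightarrow> t \<le> T \<Longrightarrow>
      expectation (\<lambda>\<omega>. (Z i t \<omega> - Z i s \<omega>) ^ 4) \<le> (c * (t - s))\<^sup>2"
    and path: "\<And>i. 1 \<le> i \<Longrightarrow> AE \<omega> in M. continuous_on {0..T} (\<lambda>t. Z i t \<omega>) \<and> Z i 0 \<omega> = 0"
  shows "AE \<omega> in M. \<forall>\<epsilon>>0. \<exists>K. \<forall>N\<ge>K. \<forall>t\<in>{0..T}. \<bar>(\<Sum>i=1..N. Z i t \<omega>) / real N\<bar> \<le> \<epsilon>"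
proof -
  define X where "X N t \<omega> = (\<Sum>i=1..N. Z i t \<omega>) / real N" for N t \<omega>
  (* Any q < 1 with 2 q^4 > 1 gives both a convergent series of steps and summable probabilities. *)
  define q :: real where "q = 9 / 10"
  define t where "t m j = real j * (T / 2 ^ m)" for m j :: nat
  have tj: "0 \<le> t m j" "t m j < t m (Suc j)" "j < 2 ^ m \<Longrightarrow> t m (Suc j) \<le> T" "t m (Suc j) - t m j = T / 2 ^ m"
    for m j
  proof -
    show "0 \<le> t m j" "t m j < t m (Suc j)" using T by (simp_all add: t_def divide_strict_right_mono)
    show "t m (Suc j) - t m j = T / 2 ^ m" by (simp add: t_def ring_distribs diff_divide_distrib[symmetric])
    assume "j < 2 ^ m"
    then have "Suc j \<le> 2 ^ m" by simp
    then have "real (Suc j) \<le> 2 ^ m" by (metis of_nat_le_iff of_nat_numeral of_nat_power)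
    then have "t m (Suc j) \<le> 2 ^ m * (T / 2 ^ m)" unfolding t_def using T by (intro mult_right_mono) auto
    then show "t m (Suc j) \<le> T" by simp
  qed
  have X4: "integrable M (\<lambda>\<omega>. (X N v \<omega> - X N u \<omega>) ^ 4)"
    "expectation (\<lambda>\<omega>. (X N v \<omega> - X N u \<omega>) ^ 4) \<le> 3 * (c * (v - u))\<^sup>2 / (real N)\<^sup>2"
    if N: "1 \<le> N" and uv: "0 \<le> u" "u < v" "v \<le> T" for N u v
  proof -
    have eq: "(X N v \<omega> - X N u \<omega>) ^ 4 = (\<Sum>i\<in>{1..N}. Z i v \<omega> - Z i u \<omega>) ^ 4 / real N ^ 4" for \<omega>
      by (simp add: X_def diff_divide_distrib[symmetric] sum_subtractf power_divide)
    have *: "integrable M (\<lambda>\<omega>. (\<Sum>i\<in>{1..N}. Z i v \<omega> - Z i u \<omega>) ^ 4)"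
      "expectation (\<lambda>\<omega>. (\<Sum>i\<in>{1..N}. Z i v \<omega> - Z i u \<omega>) ^ 4) \<le> 3 * (real N)\<^sup>2 * (c * (v - u))\<^sup>2"
      using moments_sum_indep[of "{1..N}" "\<lambda>i \<omega>. Z i v \<omega> - Z i u \<omega>" "c * (v - u)"]
        indep_vars_subset[OF ind[OF uv], of "{1..N}"] int[OF _ uv] mean[OF _ uv] m4[OF _ uv] c uv
      by auto
    show "integrable M (\<lambda>\<omega>. (X N v \<omega> - X N u \<omega>) ^ 4)" unfolding eq using *(1) by simp
    have "expectation (\<lambda>\<omega>. (X N v \<omega> - X N u \<omega>) ^ 4) \<le> 3 * (real N)\<^sup>2 * (c * (v - u))\<^sup>2 / real N ^ 4"
      unfolding eq using *(2) by (simp add: divide_right_mono)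
    also have "\<dots> = 3 * (c * (v - u))\<^sup>2 / (real N)\<^sup>2"
      using N by (simp add: eval_nat_numeral)
    finally show "expectation (\<lambda>\<omega>. (X N v \<omega> - X N u \<omega>) ^ 4) \<le> 3 * (c * (v - u))\<^sup>2 / (real N)\<^sup>2" .
  qed
  define B where "B \<epsilon> N m j = {\<omega> \<in> space M. (\<epsilon> * q ^ m) ^ 4 \<le> (X N (t m (Suc j)) \<omega> - X N (t m j) \<omega>) ^ 4}"
    for \<epsilon> :: real and N m j
  have small: "AE \<omega> in M. \<exists>K. \<forall>N\<ge>K. \<forall>s\<in>{0..T}. \<bar>X N s \<omega>\<bar> \<le> 10 * \<epsilon>" if e: "0 < \<epsilon>" for \<epsilon>
  proof -
    define R where "R N = 3 * c\<^sup>2 * T\<^sup>2 / (\<epsilon> ^ 4 * (real N)\<^sup>2)" for N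
    define G where "G N m = (\<Union>j<2 ^ m. B \<epsilon> N m j)" for N m
    have q4: "0 < q" "q < 1" "0 \<le> 1 / (2 * q ^ 4)" "1 / (2 * q ^ 4) < 1"
      by (simp_all add: q_def eval_nat_numeral)
    have Bm: "B \<epsilon> N m j \<in> events" if "1 \<le> N" "j < 2 ^ m" for N m j
      using X4(1)[OF that(1) tj(1,2) tj(3)[OF that(2)]] unfolding B_def by measurable
    have PB: "prob (B \<epsilon> N m j) \<le> R N / (4 * q ^ 4) ^ m" if N: "1 \<le> N" and j: "j < 2 ^ m" for N m j
    proof -
      have "prob (B \<epsilon> N m j) \<le>
          expectation (\<lambda>\<omega>. (X N (t m (Suc j)) \<omega> - X N (t m j) \<omega>) ^ 4) / (\<epsilon> * q ^ m) ^ 4"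
        unfolding B_def using e q4
        by (intro integral_Markov_inequality_measure[where A = "{}"] X4 N tj j) auto
      also have "\<dots> \<le> 3 * (c * (T / 2 ^ m))\<^sup>2 / (real N)\<^sup>2 / (\<epsilon> * q ^ m) ^ 4"
        using X4(2)[OF N tj(1,2) tj(3)[OF j]] unfolding tj(4) by (intro divide_right_mono) auto
      also have "\<dots> = R N / (4 * q ^ 4) ^ m"
      proof -
        have "(2 ^ m)\<^sup>2 = (4::real) ^ m"
          by (simp add: power2_eq_square power_mult_distrib[symmetric])
        moreover have "(q ^ m) ^ 4 = (q ^ 4) ^ m"
          by (simp add: power_mult[symmetric] mult.commute)
        ultimately show ?thesis by (simp add: R_def power_mult_distrib power_divide mult_ac)
      qed
      finally show ?thesis .
    qed
    have Gm: "G N m \<in> events" if "1 \<le> N" for N m using Bm[OF that] by (auto simp: G_def)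
    have PG: "prob (G N m) \<le> R N * (1 / (2 * q ^ 4)) ^ m" if N: "1 \<le> N" for N m
    proof -
      have "prob (G N m) \<le> (\<Sum>j<2 ^ m. prob (B \<epsilon> N m j))"
        unfolding G_def using Bm[OF N] by (intro finite_measure_subadditive_finite) auto
      also have "\<dots> \<le> (\<Sum>j<(2::nat) ^ m. R N / (4 * q ^ 4) ^ m)" using PB[OF N] by (intro sum_mono) auto
      also have "\<dots> = R N * (2 ^ m / (4 * q ^ 4) ^ m)" by simp
      also have "\<dots> = R N * (2 / (4 * q ^ 4)) ^ m" by (simp only: power_divide)
      also have "2 / (4 * q ^ 4) = 1 / (2 * q ^ 4)" by simp
      finally show ?thesis .
    qed
    have geo: "summable (\<lambda>m. (1 / (2 * q ^ 4)) ^ m)" using q4 by (intro summable_geometric) auto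
    have PU: "prob (\<Union>m. G N m) \<le> R N * (\<Sum>m. (1 / (2 * q ^ 4)) ^ m)" if N: "1 \<le> N" for N
    proof -
      have s: "summable (\<lambda>m. prob (G N m))"
        by (rule summable_comparison_test'[OF summable_mult[OF geo]]) (use PG[OF N] in auto)
      have "prob (\<Union>m. G N m) \<le> (\<Sum>m. prob (G N m))"
        using Gm[OF N] s by (intro finite_measure_subadditive_countably) auto
      also have "\<dots> \<le> (\<Sum>m. R N * (1 / (2 * q ^ 4)) ^ m)"
        by (intro suminf_le PG N s summable_mult geo)
      also have "\<dots> = R N * (\<Sum>m. (1 / (2 * q ^ 4)) ^ m)" by (rule suminf_mult[OF geo])
      finally show ?thesis .
    qed
    (* The shift by Suc skips the empty average N = 0, to which the probability bounds do not apply. *)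
    have "AE \<omega> in M. eventually (\<lambda>N. \<omega> \<in> space M - (\<Union>m. G (Suc N) m)) sequentially"
    proof (rule borel_cantelli_AE1)
      show "(\<Union>m. G (Suc N) m) \<in> events" for N using Gm[of "Suc N"] by auto
      have R: "summable (\<lambda>N. R (Suc N) * (\<Sum>m. (1 / (2 * q ^ 4)) ^ m))"
      proof (rule summable_mult2)
        have "R (Suc N) = (3 * c\<^sup>2 * T\<^sup>2 / \<epsilon> ^ 4) * inverse ((real (Suc N))\<^sup>2)" for N
          by (simp add: R_def divide_inverse)
        moreover have "summable (\<lambda>N. inverse ((real (Suc N))\<^sup>2))"
          using inverse_power_summable[of 2, where 'a = real] by (subst summable_Suc_iff) auto
        ultimately show "summable (\<lambda>N. R (Suc N))" by (simp only: summable_mult)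
      qed
      show "summable (\<lambda>N. prob (\<Union>m. G (Suc N) m))"
        by (rule summable_comparison_test'[OF R]) (use PU in auto)
    qed (simp add: emeasure_eq_measure)
    moreover have "AE \<omega> in M. \<forall>i. 1 \<le> i \<longrightarrow> continuous_on {0..T} (\<lambda>t. Z i t \<omega>) \<and> Z i 0 \<omega> = 0"
      using path by (simp add: AE_all_countable)
    ultimately show ?thesis
    proof eventually_elim
      case (elim \<omega>)
      then obtain K where K: "\<And>N. N \<ge> K \<Longrightarrow> \<omega> \<in> space M - (\<Union>m. G (Suc N) m)"
        by (auto simp: eventually_sequentially)
      show ?case
      proof (intro exI allI impI ballI)
        fix N s assume N: "Suc K \<le> N" and s: "s \<in> {0..T}"
        then obtain N' where N': "N = Suc N'" "K \<le> N'" by (cases N) auto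
        have "\<bar>X N s \<omega>\<bar> \<le> \<epsilon> / (1 - q)"
        proof (rule dyadic_chaining_bound[OF T q4(1,2) _ _ _ s])
          show "continuous_on {0..T} (\<lambda>t. X N t \<omega>)"
            unfolding X_def using elim N by (intro continuous_intros) auto
          show "X N 0 \<omega> = 0" using elim by (simp add: X_def)
          fix m j :: nat assume j: "j < 2 ^ m"
          have "\<omega> \<in> space M" "\<omega> \<notin> B \<epsilon> N m j" using K[OF N'(2)] j unfolding N'(1) G_def by auto
          then have "\<bar>X N (t m (Suc j)) \<omega> - X N (t m j) \<omega>\<bar> ^ 4 < (\<epsilon> * q ^ m) ^ 4"
            by (auto simp: B_def)
          then have "\<bar>X N (t m (Suc j)) \<omega> - X N (t m j) \<omega>\<bar> < \<epsilon> * q ^ m"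
            by (rule power_less_imp_less_base) (use e q4 in auto)
          then show "\<bar>X N (real (Suc j) * (T / 2 ^ m)) \<omega> - X N (real j * (T / 2 ^ m)) \<omega>\<bar> \<le> \<epsilon> * q ^ m"
            by (simp only: t_def)
        qed
        then show "\<bar>X N s \<omega>\<bar> \<le> 10 * \<epsilon>" by (simp add: q_def)
      qed
    qed
  qed
  have "AE \<omega> in M. \<forall>k::nat. \<exists>K. \<forall>N\<ge>K. \<forall>s\<in>{0..T}. \<bar>X N s \<omega>\<bar> \<le> 10 * (1 / real (Suc k))"
    unfolding AE_all_countable by (intro allI small) simp
  then show ?thesis
  proof eventually_elim
    case (elim \<omega>)
    show ?case
    proof (intro allI impI)
      fix \<epsilon> :: real assume "0 < \<epsilon>"
      then obtain k where k: "10 / \<epsilon> < real k" using reals_Archimedean2 by blast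
      then have "10 * (1 / real (Suc k)) \<le> \<epsilon>" using \<open>0 < \<epsilon>\<close> by (simp add: field_simps)
      moreover obtain K where "\<forall>N\<ge>K. \<forall>s\<in>{0..T}. \<bar>X N s \<omega>\<bar> \<le> 10 * (1 / real (Suc k))" using elim by blast
      ultimately show "\<exists>K. \<forall>N\<ge>K. \<forall>t\<in>{0..T}. \<bar>(\<Sum>i=1..N. Z i t \<omega>) / real N\<bar> \<le> \<epsilon>"
        unfolding X_def by (meson order_trans)
    qed
  qed
qed

section \<open>Wiener processes and their augmented filtrations\<close>

lemma strictly_increasing_enumeration:
  fixes S :: "real set"
  assumes "finite S" "S \<subseteq> {0..T}" "0 \<in> S"
  obtains n and t :: "nat \<Rightarrow> real"
  where "t 0 = 0" "\<And>j. j < n \<Longrightarrow> t j < t (Suc j)" "t ` {..n} = S"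
proof -
  define l where "l = sorted_list_of_set S"
  have l: "sorted_wrt (<) l" "set l = S" using assms by (simp_all add: l_def)
  then have ne: "length l > 0" using assms(3) by auto
  define n where "n = length l - 1"
  have len: "length l = Suc n" using ne by (simp add: n_def)
  have inc: "l ! j < l ! Suc j" if "j < n" for j
    using sorted_wrt_nth_less[OF l(1), of j "Suc j"] that len by simp
  have img: "(\<lambda>j. l ! j) ` {..n} = S"
    using l(2) len by (auto simp: set_conv_nth less_Suc_eq_le)
  have "l ! 0 = 0"
  proof -
    obtain j where j: "j \<le> n" "l ! j = 0" using img assms(3) by auto
    have "l ! 0 \<in> S" using img by blast
    then have "0 \<le> l ! 0" using assms(2) by auto
    moreover have "l ! 0 \<le> l ! j"
      using sorted_wrt_nth_less[OF l(1), of 0 j] j len by (cases "j = 0") auto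
    ultimately show ?thesis using j by simp
  qed
  from this inc img show thesis by (rule that)
qed

lemma
  shows space_aug_filtration: "space (aug_filtration M W t) = space M"
    and sets_aug_filtration: "sets (aug_filtration M W t) = sigma_sets (space M)
      ({W s -` B \<inter> space M | s B. s \<in> {0..t} \<and> B \<in> sets borel} \<union> null_sets M)"
proof -
  have "{W s -` B \<inter> space M | s B. s \<in> {0..t} \<and> B \<in> sets borel} \<union> null_sets M \<subseteq> Pow (space M)"
    using sets.sets_into_space[OF null_setsD2] by auto
  then show "space (aug_filtration M W t) = space M"
    "sets (aug_filtration M W t) = sigma_sets (space M)
      ({W s -` B \<inter> space M | s B. s \<in> {0..t} \<and> B \<in> sets borel} \<union> null_sets M)"
    by (simp_all add: aug_filtration_def)
qed

lemma aug_filtration_subset: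
  assumes "\<And>s. s \<in> {0..t} \<Longrightarrow> W s \<in> borel_measurable M"
  shows "sets (aug_filtration M W t) \<subseteq> sets M"
  unfolding sets_aug_filtration
proof (rule sets.sigma_sets_subset)
  have "W s -` B \<inter> space M \<in> sets M" if "s \<in> {0..t}" "B \<in> sets borel" for s B
    using assms[OF that(1)] that(2) by (rule measurable_sets)
  then show "{W s -` B \<inter> space M | s B. s \<in> {0..t} \<and> B \<in> sets borel} \<union> null_sets M \<subseteq> sets M"
    by auto
qed

lemma aug_filtration_mono:
  assumes "s \<le> t" shows "sets (aug_filtration M W s) \<subseteq> sets (aug_filtration M W t)"
  unfolding sets_aug_filtration 
proof (rule sigma_sets_mono')
  have "{0..s} \<subseteq> {0..t}" using assms by auto
  then show "{W u -` B \<inter> space M | u B. u \<in> {0..s} \<and> B \<in> sets borel} \<union> null_sets M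
    \<subseteq> {W u -` B \<inter> space M | u B. u \<in> {0..t} \<and> B \<in> sets borel} \<union> null_sets M"
    by blast
qed

lemma measurable_aug_filtration:
  assumes "f \<in> measurable (aug_filtration M W s) N" "s \<le> t"
  shows "f \<in> measurable (aug_filtration M W t) N"
proof (rule measurable_from_subalg[OF _ assms(1)])
  show "subalgebra (aug_filtration M W t) (aug_filtration M W s)"
    unfolding subalgebra_def space_aug_filtration using aug_filtration_mono[OF assms(2)] by simp
qed

lemma measurable_aug_filtration_base:
  assumes "f \<in> measurable (aug_filtration M W t) N" "\<And>s. s \<in> {0..t} \<Longrightarrow> W s \<in> borel_measurable M"
  shows "f \<in> measurable M N"
proof (rule measurable_from_subalg[OF _ assms(1)])
  show "subalgebra M (aug_filtration M W t)"
    unfolding subalgebra_def space_aug_filtration using aug_filtration_subset[OF assms(2)] by simp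
qed

lemma borel_measurable_aug_filtration_process:
  fixes W :: "real \<Rightarrow> 'w \<Rightarrow> 'b::topological_space"
  assumes "s \<in> {0..t}" shows "W s \<in> borel_measurable (aug_filtration M W t)"
proof (rule measurableI)
  fix B :: "'b set" assume "B \<in> sets borel"
  then show "W s -` B \<inter> space (aug_filtration M W t) \<in> sets (aug_filtration M W t)"
    unfolding space_aug_filtration sets_aug_filtration using assms
    by (intro sigma_sets.Basic UnI1 CollectI exI[of _ s] exI[of _ B] conjI refl)
qed simp

lemma std_wienerD:
  assumes "std_wiener M T W"
  shows "\<And>t. t \<in> {0..T} \<Longrightarrow> W t \<in> borel_measurable M"
    and "AE \<omega> in M. W 0 \<omega> = 0"
    and "AE \<omega> in M. continuous_on {0..T} (\<lambda>t. W t \<omega>)"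
    and "\<And>s t k. 0 \<le> s \<Longrightarrow> s < t \<Longrightarrow> t \<le> T \<Longrightarrow> distributed M lborel (\<lambda>\<omega>. W t \<omega> $ k - W s \<omega> $ k)
          (\<lambda>x. ennreal (normal_density 0 (sqrt (t - s)) x))"
    and "\<And>n t. 0 \<le> t 0 \<Longrightarrow> (\<And>j. j < n \<Longrightarrow> t j < t (Suc j)) \<Longrightarrow> t n \<le> T \<Longrightarrow>
        prob_space.indep_vars M (\<lambda>_. borel)
          (\<lambda>(j, k) \<omega>. W (t (Suc j)) \<omega> $ k - W (t j) \<omega> $ k) ({..<n} \<times> UNIV)"
  using assms unfolding std_wiener_def by simp_all

lemma (in prob_space) wiener_increment_moments:
  fixes W :: "real \<Rightarrow> 'a \<Rightarrow> real^'r::finite"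
  assumes "std_wiener M T W" "0 \<le> s" "s < t" "t \<le> T"
  shows "integrable M (\<lambda>\<omega>. W t \<omega> $ k - W s \<omega> $ k)"
    and "expectation (\<lambda>\<omega>. W t \<omega> $ k - W s \<omega> $ k) = 0"
    and "integrable M (\<lambda>\<omega>. (W t \<omega> $ k - W s \<omega> $ k) ^ 4)"
    and "expectation (\<lambda>\<omega>. (W t \<omega> $ k - W s \<omega> $ k) ^ 4) = 3 * (t - s)\<^sup>2"
proof -
  note D = std_wienerD(4)[OF assms, of k]
  have pos: "0 < sqrt (t - s)" using assms by simp
  have nn: "\<And>x. 0 \<le> normal_density 0 (sqrt (t - s)) x" by simp
  show "integrable M (\<lambda>\<omega>. W t \<omega> $ k - W s \<omega> $ k)"
    using distributed_integrable[OF D, of "\<lambda>x. x"] integrable_normal_moment_nz_1[OF pos, of 0] by simp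
  show "expectation (\<lambda>\<omega>. W t \<omega> $ k - W s \<omega> $ k) = 0"
    by (rule normal_distributed_expectation[OF pos D])
  have m: "has_bochner_integral lborel (\<lambda>x. normal_density 0 (sqrt (t - s)) x * x ^ 4) (3 * (t - s)\<^sup>2)"
  proof -
    have "fact (2 * 2) = (24 :: real)" "fact 2 = (2 :: real)" by (simp_all add: fact_numeral)
    moreover have "(sqrt (t - s))\<^sup>2 = t - s" using assms by simp
    ultimately have "fact (2 * 2) / ((2 / (sqrt (t - s))\<^sup>2)\<^sup>2 * fact 2) = 3 * (t - s)\<^sup>2"
      by (simp add: power_divide)
    then show ?thesis using normal_moment_even[OF pos, of 0 2] by simp
  qed
  show "integrable M (\<lambda>\<omega>. (W t \<omega> $ k - W s \<omega> $ k) ^ 4)"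
    using distributed_integrable[OF D, of "\<lambda>x. x ^ 4"] m by (auto simp: has_bochner_integral_iff)
  show "expectation (\<lambda>\<omega>. (W t \<omega> $ k - W s \<omega> $ k) ^ 4) = 3 * (t - s)\<^sup>2"
    using distributed_integral[OF D, of "\<lambda>x. x ^ 4"] m by (auto simp: has_bochner_integral_iff)
qed

text \<open>The finite-dimensional events up to time \<open>a\<close>: an intersection-stable generator of the
filtration, apart from the null sets.\<close>

definition cylinders :: "'w measure \<Rightarrow> (real \<Rightarrow> 'w \<Rightarrow> 'b::topological_space) \<Rightarrow> real \<Rightarrow> 'w set set" where
  "cylinders M W a = {{\<omega> \<in> space M. \<forall>s\<in>S. W s \<omega> \<in> B s} | S B.
     finite S \<and> S \<subseteq> {0..a} \<and> (\<forall>s. B s \<in> sets borel)}"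

lemma Int_stable_cylinders: "Int_stable (cylinders M W a)"
proof (rule Int_stableI)
  fix C C' assume "C \<in> cylinders M W a" "C' \<in> cylinders M W a"
  then obtain S B S' B' where
    C: "finite S" "S \<subseteq> {0..a}" "\<And>s. B s \<in> sets borel" "C = {\<omega> \<in> space M. \<forall>s\<in>S. W s \<omega> \<in> B s}" and
    C': "finite S'" "S' \<subseteq> {0..a}" "\<And>s. B' s \<in> sets borel" "C' = {\<omega> \<in> space M. \<forall>s\<in>S'. W s \<omega> \<in> B' s}"
    unfolding cylinders_def by blast
  define D where "D s = (if s \<in> S then B s else UNIV) \<inter> (if s \<in> S' then B' s else UNIV)" for s
  have "C \<inter> C' = {\<omega> \<in> space M. \<forall>s\<in>S \<union> S'. W s \<omega> \<in> D s}"
    unfolding C C' D_def by auto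
  moreover have "D s \<in> sets borel" for s using C(3) C'(3) by (auto simp: D_def)
  ultimately show "C \<inter> C' \<in> cylinders M W a"
    unfolding cylinders_def using C(1,2) C'(1,2) by blast
qed

lemma cylinders_subset_sets:
  assumes "\<And>s. s \<in> {0..a} \<Longrightarrow> W s \<in> borel_measurable M"
  shows "cylinders M W a \<subseteq> sets M"
proof
  fix C assume "C \<in> cylinders M W a"
  then obtain S B where S: "finite S" "S \<subseteq> {0..a}" and B: "\<And>s. B s \<in> sets borel"
    and C: "C = {\<omega> \<in> space M. \<forall>s\<in>S. W s \<omega> \<in> B s}" unfolding cylinders_def by blast
  have "{\<omega> \<in> space M. W s \<omega> \<in> B s} \<in> sets M" if "s \<in> S" for s
  proof -
    have "W s -` B s \<inter> space M \<in> sets M" using assms[of s] that S(2) B by (intro measurable_sets) auto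
    then show ?thesis by (simp only: vimage_def Int_def mem_Collect_eq conj_commute)
  qed
  then show "C \<in> sets M" unfolding C using S(1) by (intro sets.sets_Collect_finite_All)
qed

text \<open>Adding the null sets does not leave the \<open>\<sigma>\<close>-algebra generated by the hull, since a null set
agrees almost surely with the empty set.\<close>

lemma aug_filtration_subset_ae_hull:
  fixes W :: "real \<Rightarrow> 'w \<Rightarrow> 'b::topological_space"
  assumes meas: "\<And>s. s \<in> {0..a} \<Longrightarrow> W s \<in> borel_measurable M"
    and base: "\<And>s B. s \<in> {0..a} \<Longrightarrow> B \<in> sets borel \<Longrightarrow> W s -` B \<inter> space M \<in> F" and empty: "{} \<in> F"
  shows "sets (aug_filtration M W a) \<subseteq> sigma_sets (space M) (ae_hull M F)"
proof -
  have "W s -` B \<inter> space M \<in> ae_hull M F" if "s \<in> {0..a}" "B \<in> sets borel" for s B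
    using measurable_sets[OF meas[OF that(1)] that(2)] base[OF that] by (intro ae_hullI) auto
  then show ?thesis
    unfolding sets_aug_filtration using null_sets_subset_ae_hull[OF empty, of M]
    by (intro sigma_sets_mono') auto
qed

text \<open>A cylinder involves finitely many times. Sorting them together with \<open>0\<close>, \<open>a\<close> and \<open>b\<close> makes the
values before \<open>a\<close> sums of increments with index below that of \<open>a\<close>, and the increment over \<open>[a, b]\<close>
a sum of later ones; disjoint groups of independent increments are independent. Intersection
stability then extends this from cylinders to the generated \<open>\<sigma>\<close>-algebra.\<close>

lemma (in prob_space) wiener_increment_indep_filtration:
  fixes W :: "real \<Rightarrow> 'a \<Rightarrow> real^'r::finite"
  assumes W: "std_wiener M T W" and ab: "0 \<le> a" "a < b" "b \<le> T"
  shows "indep_set (sigma_sets (space M) {(\<lambda>\<omega>. W b \<omega> $ k - W a \<omega> $ k) -` B \<inter> space M | B. B \<in> sets borel})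
    (sets (aug_filtration M W a))"
proof -
  note Wm = std_wienerD(1)[OF W]
  define w where "w \<omega> = W b \<omega> $ k - W a \<omega> $ k" for \<omega>
  have wm: "w \<in> borel_measurable M"
    unfolding w_def using Wm[of a] Wm[of b] ab 
    by (intro borel_measurable_diff measurable_compose[OF _ borel_measurable_nth]) auto
  define Inc where "Inc = {w -` B \<inter> space M | B. B \<in> sets borel}"
  have prod: "prob (w -` X \<inter> space M \<inter> C) = prob (w -` X \<inter> space M) * prob C"
    if X: "X \<in> sets borel" and C: "C \<in> cylinders M W a" for X C
  proof -
    obtain S B where S: "finite S" "S \<subseteq> {0..a}" and B: "\<And>s. B s \<in> sets borel"
      and Ceq: "C = {\<omega> \<in> space M. \<forall>s\<in>S. W s \<omega> \<in> B s}" using C unfolding cylinders_def by blast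
    have Sab: "finite (S \<union> {0, a, b})" "S \<union> {0, a, b} \<subseteq> {0..T}" "0 \<in> S \<union> {0, a, b}" using S ab by auto
    obtain n t where t0: "t 0 = 0" and inc: "\<And>j. j < n \<Longrightarrow> t j < t (Suc j)"
      and img: "t ` {..n} = S \<union> {0, a, b}"
      using strictly_increasing_enumeration[OF Sab] by metis
    have tT: "t n \<le> T" 
    proof -
      have "t n \<in> t ` {..n}" by simp
      then show ?thesis unfolding img using Sab(2) by auto
    qed
    have mono: "t i < t j" if "i < j" "j \<le> n" for i j
      using that
    proof (induction j)
      case (Suc j)
      then have "t i \<le> t j" by (cases "i = j") auto
      then show ?case using inc[of j] Suc.prems by simp
    qed simp
    have "a \<in> t ` {..n}" unfolding img by simp
    then obtain m where m: "m \<le> n" "t m = a" by auto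
    have "b \<in> t ` {..n}" unfolding img by simp
    then obtain p where p: "p \<le> n" "t p = b" by auto
    have mp: "m \<le> p" using mono[of p m] m p ab by (cases "p < m") auto
    have "\<forall>s\<in>S. \<exists>i\<le>m. t i = s"
    proof
      fix s assume s: "s \<in> S"
      then have "s \<in> t ` {..n}" unfolding img by simp
      then obtain i where i: "i \<le> n" "t i = s" by auto
      have "i \<le> m" using mono[of m i] i m s S by (cases "m < i") auto
      then show "\<exists>i\<le>m. t i = s" using i by auto
    qed
    then obtain idx where idx: "\<And>s. s \<in> S \<Longrightarrow> idx s \<le> m" "\<And>s. s \<in> S \<Longrightarrow> t (idx s) = s" by metis
    define D where "D = (\<lambda>(j, k) \<omega>. W (t (Suc j)) \<omega> $ k - W (t j) \<omega> $ k)"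
    have ind: "indep_vars (\<lambda>_. borel) D ({..<n} \<times> UNIV)"
      unfolding D_def using t0 inc tT by (intro std_wienerD(5)[OF W]) auto
    define past where "past = {..<m} \<times> (UNIV :: 'r set)"
    define future where "future = {m..<n} \<times> (UNIV :: 'r set)"
    have iv: "indep_var (PiM future (\<lambda>_. borel)) (\<lambda>\<omega>. restrict (\<lambda>i. D i \<omega>) future)
        (PiM past (\<lambda>_. borel)) (\<lambda>\<omega>. restrict (\<lambda>i. D i \<omega>) past)"
      by (rule indep_var_restrict[OF ind]) (use m in \<open>auto simp: past_def future_def\<close>)
    define g where "g s f = (\<Sum>j<idx s. \<Sum>l\<in>UNIV. f (j, l) *\<^sub>R axis l (1::real))" for s and f :: "nat \<times> 'r \<Rightarrow> real"
    define u where "u f = (\<Sum>j=m..<p. f (j, k))" for f :: "nat \<times> 'r \<Rightarrow> real"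
    have um: "u \<in> borel_measurable (PiM future (\<lambda>_. borel))"
      unfolding u_def using p by (intro borel_measurable_sum measurable_component_singleton) (auto simp: future_def)
    have gm: "g s \<in> borel_measurable (PiM past (\<lambda>_. borel))" if "s \<in> S" for s
      unfolding g_def using idx(1)[OF that]
      by (intro borel_measurable_sum borel_measurable_scaleR measurable_component_singleton) (auto simp: past_def)
    have wu: "w \<omega> = u (restrict (\<lambda>i. D i \<omega>) future)" for \<omega>
    proof -
      have "u (restrict (\<lambda>i. D i \<omega>) future) = (\<Sum>j=m..<p. W (t (Suc j)) \<omega> $ k - W (t j) \<omega> $ k)"
        unfolding u_def D_def using p by (intro sum.cong) (auto simp: future_def)
      also have "\<dots> = W (t p) \<omega> $ k - W (t m) \<omega> $ k" by (rule sum_Suc_diff'[OF mp])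
      finally show ?thesis by (simp add: w_def m p)
    qed
    have Wg: "W s \<omega> = g s (restrict (\<lambda>i. D i \<omega>) past)" if s: "s \<in> S" and 0: "W 0 \<omega> = 0" for s \<omega>
    proof -
      have "g s (restrict (\<lambda>i. D i \<omega>) past)
          = (\<Sum>j<idx s. \<Sum>l\<in>UNIV. (W (t (Suc j)) \<omega> - W (t j) \<omega>) $ l *\<^sub>R axis l 1)"
        unfolding g_def D_def using idx(1)[OF s] by (intro sum.cong) (auto simp: past_def)
      also have "\<dots> = (\<Sum>j<idx s. W (t (Suc j)) \<omega> - W (t j) \<omega>)"
        by (intro sum.cong refl) (simp add: vec_eq_iff axis_def if_distrib cong: if_cong)
      also have "\<dots> = W (t (idx s)) \<omega> - W (t 0) \<omega>"
        by (rule sum_lessThan_telescope)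
      finally show ?thesis using 0 t0 idx(2)[OF s] by simp
    qed
    define V where "V = u -` X \<inter> space (PiM future (\<lambda>_. borel))"
    define U where "U = {f \<in> space (PiM past (\<lambda>_. borel)). \<forall>s\<in>S. g s f \<in> B s}"
    have Vs: "V \<in> sets (PiM future (\<lambda>_. borel))" unfolding V_def using um X by (rule measurable_sets)
    have Us: "U \<in> sets (PiM past (\<lambda>_. borel))"
      unfolding U_def
    proof (rule sets.sets_Collect_finite_All[OF _ S(1)])
      fix s assume "s \<in> S"
      then have "g s -` B s \<inter> space (PiM past (\<lambda>_. borel)) \<in> sets (PiM past (\<lambda>_. borel))"
        using gm B by (intro measurable_sets)
      then show "{f \<in> space (PiM past (\<lambda>_. borel)). g s f \<in> B s} \<in> sets (PiM past (\<lambda>_. borel))"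
        by (simp only: vimage_def Int_def mem_Collect_eq conj_commute)
    qed
    let ?f = "\<lambda>\<omega>. restrict (\<lambda>i. D i \<omega>) future" and ?p = "\<lambda>\<omega>. restrict (\<lambda>i. D i \<omega>) past"
    have rv: "?f \<in> measurable M (PiM future (\<lambda>_. borel))" "?p \<in> measurable M (PiM past (\<lambda>_. borel))"
      using iv by (auto simp: indep_var_eq)
    have pre_future: "?f -` V \<inter> space M = w -` X \<inter> space M"
      unfolding V_def wu using measurable_space[OF rv(1)] by auto
    have Cev: "C \<in> events" using cylinders_subset_sets[of a W M] Wm C ab by auto
    have AE_C: "AE \<omega> in M. \<omega> \<in> ?p -` U \<inter> space M \<longleftrightarrow> \<omega> \<in> C"
      using std_wienerD(2)[OF W] AE_space
    proof eventually_elim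
      case (elim \<omega>)
      have "?p \<omega> \<in> space (PiM past (\<lambda>_. borel))" using measurable_space[OF rv(2)] elim by blast
      moreover have "\<forall>s\<in>S. W s \<omega> = g s (?p \<omega>)" using Wg elim by blast
      ultimately show ?case using elim by (simp add: U_def Ceq)
    qed
    have "prob (?p -` U \<inter> space M) = prob C"
      using rv(2) Us Cev by (intro finite_measure_eq_AE AE_C measurable_sets)
    moreover have "prob ((\<lambda>x. (?f x, ?p x)) -` (V \<times> U) \<inter> space M) = prob (?f -` V \<inter> space M) * prob (?p -` U \<inter> space M)"
      by (rule indep_varD[OF iv Vs Us])
    moreover have "prob ((\<lambda>x. (?f x, ?p x)) -` (V \<times> U) \<inter> space M) = prob (w -` X \<inter> space M \<inter> C)"
    proof (rule finite_measure_eq_AE)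
      have *: "(\<lambda>x. (?f x, ?p x)) -` (V \<times> U) \<inter> space M = (?f -` V \<inter> space M) \<inter> (?p -` U \<inter> space M)" by auto
      show "(\<lambda>x. (?f x, ?p x)) -` (V \<times> U) \<inter> space M \<in> events"
        unfolding * using rv Vs Us by (intro sets.Int measurable_sets)
      show "AE \<omega> in M. \<omega> \<in> (\<lambda>x. (?f x, ?p x)) -` (V \<times> U) \<inter> space M \<longleftrightarrow> \<omega> \<in> w -` X \<inter> space M \<inter> C"
        unfolding * pre_future using AE_C by eventually_elim blast
      show "w -` X \<inter> space M \<inter> C \<in> events" using wm X Cev by (intro sets.Int measurable_sets)
    qed
    ultimately show ?thesis by (simp add: pre_future)
  qed
  have Ces: "cylinders M W a \<subseteq> events" using cylinders_subset_sets[of a W M] Wm ab by auto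
  have Ies: "Inc \<subseteq> events" unfolding Inc_def using wm by (auto intro: measurable_sets)
  have "indep_set Inc (cylinders M W a)"
    unfolding indep_sets2_eq using Ces Ies prod by (auto simp: Inc_def)
  then have *: "indep_set (sigma_sets (space M) (ae_hull M Inc)) (sigma_sets (space M) (ae_hull M (cylinders M W a)))"
    unfolding Inc_def by (intro indep_set_ae_hull_sigma Int_stable_vimages Int_stable_cylinders)
  have "sets (aug_filtration M W a) \<subseteq> sigma_sets (space M) (ae_hull M (cylinders M W a))"
  proof (rule aug_filtration_subset_ae_hull)
    show "W s -` B \<inter> space M \<in> cylinders M W a" if "s \<in> {0..a}" "B \<in> sets borel" for s B
      unfolding cylinders_def using that by (intro CollectI exI[of _ "{s}"] exI[of _ "\<lambda>_. B"]) auto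
    show "{} \<in> cylinders M W a"
      unfolding cylinders_def using ab by (intro CollectI exI[of _ "{0}"] exI[of _ "\<lambda>_. {}"]) auto
    show "W s \<in> borel_measurable M" if "s \<in> {0..a}" for s using Wm[of s] that ab by auto
  qed
  moreover have "sigma_sets (space M) Inc \<subseteq> sigma_sets (space M) (ae_hull M Inc)"
    by (intro sigma_sets_mono' subset_ae_hull Ies)
  ultimately show ?thesis
    using indep_set_mono[OF *] unfolding Inc_def w_def by blast
qed

section \<open>Stochastic integrals have mean zero\<close>

lemma (in prob_space) wiener_increment_scaleR_mean_zero:
  fixes W :: "real \<Rightarrow> 'a \<Rightarrow> real^'r::finite" and \<xi> :: "'a \<Rightarrow> 'b::euclidean_space"
  assumes W: "std_wiener M T W" and ab: "0 \<le> a" "a \<le> b" "b \<le> T"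
    and \<xi>: "\<xi> \<in> borel_measurable (aug_filtration M W a)"
    and C: "\<And>\<omega>. \<omega> \<in> space M \<Longrightarrow> norm (\<xi> \<omega>) \<le> C"
  shows "integrable M (\<lambda>\<omega>. (W b \<omega> $ k - W a \<omega> $ k) *\<^sub>R \<xi> \<omega>) \<and>
    expectation (\<lambda>\<omega>. (W b \<omega> $ k - W a \<omega> $ k) *\<^sub>R \<xi> \<omega>) = 0"
proof (cases "a = b")
  case False
  then have ab': "a < b" using ab by simp
  define w where "w \<omega> = W b \<omega> $ k - W a \<omega> $ k" for \<omega>
  have wi: "integrable M w" and w0: "expectation w = 0"
    unfolding w_def by (rule wiener_increment_moments(1,2)[OF W ab(1) ab' ab(3)])+
  have \<xi>M: "\<xi> \<in> borel_measurable M"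
  proof (rule measurable_aug_filtration_base[OF \<xi>])
    show "W s \<in> borel_measurable M" if "s \<in> {0..a}" for s
      using std_wienerD(1)[OF W, of s] that ab by simp
  qed
  have int: "integrable M (\<lambda>\<omega>. w \<omega> *\<^sub>R \<xi> \<omega>)"
  proof (rule Bochner_Integration.integrable_bound)
    show "integrable M (\<lambda>\<omega>. C * w \<omega>)" using wi by simp
    show "(\<lambda>\<omega>. w \<omega> *\<^sub>R \<xi> \<omega>) \<in> borel_measurable M"
      using borel_measurable_integrable[OF wi] \<xi>M by (rule borel_measurable_scaleR)
    have "norm (w \<omega> *\<^sub>R \<xi> \<omega>) \<le> norm (C * w \<omega>)" if "\<omega> \<in> space M" for \<omega>
    proof -
      have "0 \<le> C" using C[OF that] norm_ge_zero order_trans by blast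
      then have "norm (C * w \<omega>) = \<bar>w \<omega>\<bar> * C" by (simp add: abs_mult)
      then show ?thesis using C[OF that] by (simp add: mult_left_mono)
    qed
    then show "AE \<omega> in M. norm (w \<omega> *\<^sub>R \<xi> \<omega>) \<le> norm (C * w \<omega>)" by simp
  qed
  have "expectation (\<lambda>\<omega>. w \<omega> *\<^sub>R \<xi> \<omega>) \<bullet> e = 0 \<bullet> e" if e: "e \<in> Basis" for e
  proof -
    have m: "(\<lambda>\<omega>. \<xi> \<omega> \<bullet> e) \<in> borel_measurable (aug_filtration M W a)"
      using \<xi> by simp
    have "sigma_sets (space M) {(\<lambda>\<omega>. \<xi> \<omega> \<bullet> e) -` A \<inter> space M | A. A \<in> sets borel} \<subseteq> sets (aug_filtration M W a)"
    proof -
      have "(\<lambda>\<omega>. \<xi> \<omega> \<bullet> e) -` A \<inter> space M \<in> sets (aug_filtration M W a)" if "A \<in> sets borel" for A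
        using measurable_sets[OF m that] by (simp add: space_aug_filtration)
      then have "sigma_sets (space (aug_filtration M W a)) {(\<lambda>\<omega>. \<xi> \<omega> \<bullet> e) -` A \<inter> space M | A. A \<in> sets borel} \<subseteq> sets (aug_filtration M W a)"
        by (intro sets.sigma_sets_subset) auto
      then show ?thesis by (simp add: space_aug_filtration)
    qed
    then have "indep_set (sigma_sets (space M) {w -` A \<inter> space M | A. A \<in> sets borel})
       (sigma_sets (space M) {(\<lambda>\<omega>. \<xi> \<omega> \<bullet> e) -` A \<inter> space M | A. A \<in> sets borel})"
      unfolding w_def
      by (intro indep_set_mono[OF wiener_increment_indep_filtration[OF W ab(1) ab' ab(3), of k]]) simp_all
    then have ind: "indep_var borel w borel (\<lambda>\<omega>. \<xi> \<omega> \<bullet> e)"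
      unfolding indep_var_eq using borel_measurable_integrable[OF wi] borel_measurable_inner[OF \<xi>M] by simp
    have \<xi>i: "integrable M (\<lambda>\<omega>. \<xi> \<omega> \<bullet> e)"
    proof (rule integrable_const_bound[of _ C])
      have "norm (\<xi> \<omega> \<bullet> e) \<le> C" if "\<omega> \<in> space M" for \<omega>
        using Basis_le_norm[OF e, of "\<xi> \<omega>"] C[OF that] by simp
      then show "AE \<omega> in M. norm (\<xi> \<omega> \<bullet> e) \<le> C" by simp
    qed (use \<xi>M in simp)
    have "expectation (\<lambda>\<omega>. w \<omega> *\<^sub>R \<xi> \<omega>) \<bullet> e = expectation (\<lambda>\<omega>. w \<omega> * (\<xi> \<omega> \<bullet> e))"
      using int by (subst integral_inner_left[symmetric]) simp_all
    also have "\<dots> = expectation w * expectation (\<lambda>\<omega>. \<xi> \<omega> \<bullet> e)"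
      by (rule indep_var_lebesgue_integral[OF ind wi \<xi>i])
    finally show ?thesis using w0 by simp
  qed
  then have "expectation (\<lambda>\<omega>. w \<omega> *\<^sub>R \<xi> \<omega>) = 0" by (rule euclidean_eqI)
  with int show ?thesis unfolding w_def by blast
next
  case True
  then show ?thesis by simp
qed

lemma elementary_times:
  assumes "elementary T F n t \<xi>" "j \<le> n"
  shows "0 \<le> t j" "t j \<le> T"
proof -
  note E = assms(1)[unfolded elementary_def]
  show "0 \<le> t j" using assms(2)
  proof (induction j)
    case (Suc j)
    then have "t j \<le> t (Suc j)" using E by auto
    with Suc show ?case by simp
  qed (use E in auto)
  have "t j \<le> t n" using assms(2)
  proof (induction rule: inc_induct)
    case (step m)
    then have "t m \<le> t (Suc m)" using E by auto
    with step show ?case by simp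
  qed simp
  then show "t j \<le> T" using E by auto
qed

lemma (in prob_space) elem_integral_mean_zero:
  fixes W :: "real \<Rightarrow> 'a \<Rightarrow> real^'r::finite" and \<xi> :: "nat \<Rightarrow> 'a \<Rightarrow> 'b::euclidean_space"
  assumes W: "std_wiener M T W" and E: "elementary T (aug_filtration M W) n t \<xi>" and u: "u \<in> {0..T}"
  shows "integrable M (elem_integral (\<lambda>t \<omega>. W t \<omega> $ k) n t \<xi> u)"
    and "expectation (elem_integral (\<lambda>t \<omega>. W t \<omega> $ k) n t \<xi> u) = 0"
proof -
  have *: "integrable M (\<lambda>\<omega>. (W (min (t (Suc j)) u) \<omega> $ k - W (min (t j) u) \<omega> $ k) *\<^sub>R \<xi> j \<omega>) \<and>
      expectation (\<lambda>\<omega>. (W (min (t (Suc j)) u) \<omega> $ k - W (min (t j) u) \<omega> $ k) *\<^sub>R \<xi> j \<omega>) = 0"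
    if j: "j < n" for j
  proof (cases "u \<le> t j")
    case True
    moreover have "t j \<le> t (Suc j)" using E j by (auto simp: elementary_def)
    ultimately show ?thesis by (simp add: min_absorb2)
  next
    case False
    have "\<exists>C. \<forall>\<omega>\<in>space M. norm (\<xi> j \<omega>) \<le> C"
      using E j by (simp add: elementary_def space_aug_filtration)
    then obtain C where C: "\<And>\<omega>. \<omega> \<in> space M \<Longrightarrow> norm (\<xi> j \<omega>) \<le> C" by blast
    have tj: "t j \<le> t (Suc j)" "\<xi> j \<in> borel_measurable (aug_filtration M W (t j))"
      using E j by (auto simp: elementary_def)
    have min: "min (t j) u = t j" using False by simp
    show ?thesis
      unfolding min
      using wiener_increment_scaleR_mean_zero[OF W _ _ _ tj(2), of "min (t (Suc j)) u" C]
        elementary_times[OF E, of j] j u False tj(1) C by simp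
  qed
  show "integrable M (elem_integral (\<lambda>t \<omega>. W t \<omega> $ k) n t \<xi> u)"
    using * unfolding elem_integral_def by (intro Bochner_Integration.integrable_sum) auto
  show "expectation (elem_integral (\<lambda>t \<omega>. W t \<omega> $ k) n t \<xi> u) = 0"
    unfolding elem_integral_def using * by (subst Bochner_Integration.integral_sum) auto
qed

text \<open>Elementary integrals have mean zero by independence of increment and integrand, and mean zero
survives \<open>L\<^sup>2\<close> limits. Instead of Jensen's inequality the pointwise bound
\<open>\<bar>x\<bar> \<le> \<delta>/2 + x\<^sup>2/(2\<delta>)\<close> converts second into first moments.\<close>

lemma (in prob_space) ito_integral_mean_zero:
  fixes W :: "real \<Rightarrow> 'a \<Rightarrow> real^'r::finite" and I :: "real \<Rightarrow> 'a \<Rightarrow> 'b::euclidean_space"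
  assumes W: "std_wiener M T W"
    and I: "ito_integral M T (aug_filtration M W) (\<lambda>t \<omega>. W t \<omega> $ k) X I" and u: "u \<in> {0..T}"
  shows "integrable M (I u)" and "expectation (I u) = 0"
proof -
  obtain n t \<xi> where E: "\<And>m. elementary T (aug_filtration M W) (n m) (t m) (\<xi> m)"
    and lim: "(\<lambda>m. \<integral>\<^sup>+ \<omega>. ennreal ((norm (I u \<omega> - elem_integral (\<lambda>t \<omega>. W t \<omega> $ k) (n m) (t m) (\<xi> m) u \<omega>))\<^sup>2) \<partial>M)
          \<longlonglongrightarrow> 0"
    using I u unfolding ito_integral_def by blast
  have "I u \<in> borel_measurable (aug_filtration M W u)" using I u unfolding ito_integral_def by blast
  then have Im: "I u \<in> borel_measurable M"
    by (rule measurable_aug_filtration_base) (use u in \<open>auto intro: std_wienerD(1)[OF W]\<close>)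
  have key: "integrable M (I u) \<and> norm (expectation (I u)) \<le> \<delta>" if d: "0 < \<delta>" for \<delta>
  proof -
    have "\<forall>\<^sub>F m in sequentially. (\<integral>\<^sup>+ \<omega>. ennreal ((norm (I u \<omega> -
        elem_integral (\<lambda>t \<omega>. W t \<omega> $ k) (n m) (t m) (\<xi> m) u \<omega>))\<^sup>2) \<partial>M) < ennreal (\<delta>\<^sup>2)"
      using d by (intro order_tendstoD(2)[OF lim]) simp
    then obtain m where m: "(\<integral>\<^sup>+ \<omega>. ennreal ((norm (I u \<omega> -
        elem_integral (\<lambda>t \<omega>. W t \<omega> $ k) (n m) (t m) (\<xi> m) u \<omega>))\<^sup>2) \<partial>M) < ennreal (\<delta>\<^sup>2)"
      by (auto simp: eventually_sequentially)
    define J where "J = elem_integral (\<lambda>t \<omega>. W t \<omega> $ k) (n m) (t m) (\<xi> m) u"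
    define D where "D \<omega> = I u \<omega> - J \<omega>" for \<omega>
    have J: "integrable M J" "expectation J = 0"
      unfolding J_def by (rule elem_integral_mean_zero[OF W E u])+
    have Dm: "D \<in> borel_measurable M" unfolding D_def using Im J(1) by (intro borel_measurable_diff) auto
    have nn: "(\<integral>\<^sup>+ \<omega>. ennreal ((norm (D \<omega>))\<^sup>2) \<partial>M) < ennreal (\<delta>\<^sup>2)" using m by (simp add: D_def J_def)
    have D2: "integrable M (\<lambda>\<omega>. (norm (D \<omega>))\<^sup>2)"
      using nn Dm by (intro integrableI_bounded) (auto intro: order_less_trans)
    have "ennreal (expectation (\<lambda>\<omega>. (norm (D \<omega>))\<^sup>2)) < ennreal (\<delta>\<^sup>2)"
      using nn D2 by (subst nn_integral_eq_integral[symmetric]) auto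
    then have ED2: "expectation (\<lambda>\<omega>. (norm (D \<omega>))\<^sup>2) \<le> \<delta>\<^sup>2" by (simp add: ennreal_less_iff)
    have pt: "norm (D \<omega>) \<le> \<delta> / 2 + (norm (D \<omega>))\<^sup>2 / (2 * \<delta>)" for \<omega>
    proof -
      have "0 \<le> (norm (D \<omega>) - \<delta>)\<^sup>2" by simp
      then have "2 * \<delta> * norm (D \<omega>) \<le> \<delta>\<^sup>2 + (norm (D \<omega>))\<^sup>2" by (simp add: power2_diff mult_ac)
      then show ?thesis using d by (simp add: field_simps power2_eq_square)
    qed
    have Di: "integrable M D"
    proof (rule Bochner_Integration.integrable_bound)
      show "integrable M (\<lambda>\<omega>. \<delta> / 2 + (norm (D \<omega>))\<^sup>2 / (2 * \<delta>))" using D2 by simp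
      show "AE \<omega> in M. norm (D \<omega>) \<le> norm (\<delta> / 2 + (norm (D \<omega>))\<^sup>2 / (2 * \<delta>))" using pt d by simp
    qed (rule Dm)
    have Ieq: "I u = (\<lambda>\<omega>. D \<omega> + J \<omega>)" by (simp add: D_def fun_eq_iff)
    have "expectation (I u) = expectation D" unfolding Ieq using Di J by simp
    also have "norm \<dots> \<le> expectation (\<lambda>\<omega>. norm (D \<omega>))" by (rule integral_norm_bound)
    also have "\<dots> \<le> expectation (\<lambda>\<omega>. \<delta> / 2 + (norm (D \<omega>))\<^sup>2 / (2 * \<delta>))"
      using Di D2 pt by (intro integral_mono) auto
    also have "\<dots> = \<delta> / 2 + expectation (\<lambda>\<omega>. (norm (D \<omega>))\<^sup>2) / (2 * \<delta>)"
      using D2 by (simp add: prob_space)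
    also have "\<dots> \<le> \<delta> / 2 + \<delta>\<^sup>2 / (2 * \<delta>)"
      using ED2 d by (intro add_left_mono divide_right_mono) auto
    also have "\<dots> = \<delta>" using d by (simp add: power2_eq_square)
    finally show ?thesis using Di J(1) unfolding Ieq by auto
  qed
  show "integrable M (I u)" using key[of 1] by simp
  have "norm (expectation (I u)) \<le> 0" by (rule field_le_epsilon) (use key in auto)
  then show "expectation (I u) = 0" by simp
qed

section \<open>The mean state\<close>

text \<open>Clamping the time to \<open>[0, t]\<close> makes the process jointly measurable on the whole line, so
that Fubini's theorem for Lebesgue measure applies without restricted measure spaces.\<close>

lemma progressive_clamp_measurable:
  fixes X :: "real \<Rightarrow> 'w \<Rightarrow> 'b::topological_space"
  assumes "progressive T F X" "t \<in> {0..T}"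
  shows "(\<lambda>(\<omega>, s). X (max 0 (min t s)) \<omega>) \<in> borel_measurable (F t \<Otimes>\<^sub>M lborel)"
proof -
  have X: "(\<lambda>(s, \<omega>). X s \<omega>) \<in> borel_measurable (restrict_space borel {0..t} \<Otimes>\<^sub>M F t)"
    using assms by (auto simp: progressive_def)
  have clamp: "(\<lambda>s. max 0 (min t s)) \<in> measurable borel (restrict_space borel {0..t})"
    using assms by (intro measurable_restrict_space2) auto
  have "(\<lambda>x. (max 0 (min t (snd x)), fst x)) \<in> measurable (F t \<Otimes>\<^sub>M lborel) (restrict_space borel {0..t} \<Otimes>\<^sub>M F t)"
    by (intro measurable_Pair measurable_compose[OF _ clamp]) auto
  from measurable_compose[OF this X] show ?thesis by (simp add: split_beta')
qed

lemma progressive_measurable: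
  fixes X :: "real \<Rightarrow> 'w \<Rightarrow> 'b::topological_space"
  assumes "progressive T F X" "t \<in> {0..T}"
  shows "X t \<in> borel_measurable (F t)"
proof -
  have "(\<lambda>\<omega>. (\<omega>, t)) \<in> measurable (F t) (F t \<Otimes>\<^sub>M lborel)" by simp
  from measurable_compose[OF this progressive_clamp_measurable[OF assms]] show ?thesis
    using assms(2) by simp
qed

lemma indicator_clamp:
  fixes f :: "'b \<Rightarrow> 'c::real_vector" and s t :: real
  shows "indicator {0..t} s *\<^sub>R f (X (max 0 (min t s)) \<omega>) = indicator {0..t} s *\<^sub>R f (X s \<omega>)"
  by (auto simp: indicator_def)

lemma progressive_integral_measurable:
  fixes X :: "real \<Rightarrow> 'w \<Rightarrow> 'b::euclidean_space" and f :: "'b \<Rightarrow> 'c::euclidean_space"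
  assumes "progressive T F X" "t \<in> {0..T}" "bounded_linear f"
  shows "(\<lambda>\<omega>. LINT s:{0..t}|lborel. f (X s \<omega>)) \<in> borel_measurable (F t)"
proof -
  have f: "f \<in> borel_measurable borel"
    by (rule borel_measurable_continuous_onI[OF linear_continuous_on[OF assms(3)]])
  have "(\<lambda>x. indicator {0..t} (snd x) *\<^sub>R f (case x of (\<omega>, s) \<Rightarrow> X (max 0 (min t s)) \<omega>)) \<in> borel_measurable (F t \<Otimes>\<^sub>M lborel)"
    by (intro borel_measurable_scaleR measurable_compose[OF progressive_clamp_measurable[OF assms(1,2)] f]
        measurable_compose[OF measurable_snd]) auto
  then have "(\<lambda>(\<omega>, s). indicator {0..t} s *\<^sub>R f (X s \<omega>)) \<in> borel_measurable (F t \<Otimes>\<^sub>M lborel)"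
    by (simp add: split_beta' indicator_clamp)
  then show ?thesis
    unfolding set_lebesgue_integral_def by (rule lborel.borel_measurable_lebesgue_integral)
qed

lemma (in prob_space) progressive_Fubini:
  fixes X :: "real \<Rightarrow> 'a \<Rightarrow> 'b::euclidean_space" and f :: "'b \<Rightarrow> 'c::euclidean_space"
  assumes X: "progressive T F X" and t: "t \<in> {0..T}" and f: "bounded_linear f"
    and F: "space (F t) = space M" "sets (F t) \<subseteq> events"
    and Xm: "\<And>s. s \<in> {0..T} \<Longrightarrow> X s \<in> borel_measurable M"
    and C: "AE \<omega> in M. \<forall>s\<in>{0..T}. norm (X s \<omega>) \<le> C"
  shows "integrable M (\<lambda>\<omega>. LINT s:{0..t}|lborel. f (X s \<omega>))"
    and "expectation (\<lambda>\<omega>. LINT s:{0..t}|lborel. f (X s \<omega>)) = (LINT s:{0..t}|lborel. f (expectation (X s)))"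
    and "set_integrable lborel {0..t} (\<lambda>s. f (expectation (X s)))"
    and "AE \<omega> in M. set_integrable lborel {0..t} (\<lambda>s. f (X s \<omega>))"
proof -
  interpret P: pair_sigma_finite M lborel ..
  obtain K where K: "\<And>x. norm (f x) \<le> norm x * K" and K0: "0 < K" using bounded_linear.pos_bounded[OF f] by auto
  have fm: "f \<in> borel_measurable borel"
    by (rule borel_measurable_continuous_onI[OF linear_continuous_on[OF f]])
  have "(\<lambda>x. (fst x, snd x)) \<in> measurable (M \<Otimes>\<^sub>M lborel) (F t \<Otimes>\<^sub>M lborel)"
  proof (intro measurable_Pair)
    have "subalgebra M (F t)" unfolding subalgebra_def using F by simp
    then show "fst \<in> measurable (M \<Otimes>\<^sub>M lborel) (F t)"
      using measurable_compose[OF measurable_fst measurable_from_subalg[OF _ measurable_ident]] by simp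
  qed simp
  from measurable_compose[OF this progressive_clamp_measurable[OF X t]]
  have clM: "(\<lambda>x. X (max 0 (min t (snd x))) (fst x)) \<in> borel_measurable (M \<Otimes>\<^sub>M lborel)" by simp
  define g where "g \<omega> s = indicator {0..t} s *\<^sub>R f (X s \<omega>)" for \<omega> s
  have gm: "case_prod g \<in> borel_measurable (M \<Otimes>\<^sub>M lborel)"
  proof -
    have "(\<lambda>x. indicator {0..t} (snd x) *\<^sub>R f (X (max 0 (min t (snd x))) (fst x))) \<in> borel_measurable (M \<Otimes>\<^sub>M lborel)"
      by (intro borel_measurable_scaleR measurable_compose[OF clM fm] measurable_compose[OF measurable_snd]) auto
    then show ?thesis by (simp add: g_def split_beta' indicator_clamp)
  qed
  have gs: "g \<omega> \<in> borel_measurable lborel" if "\<omega> \<in> space M" for \<omega>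
    using measurable_compose[OF measurable_Pair1'[OF that] gm] by simp
  have bnd: "AE \<omega> in M. \<forall>s. norm (g \<omega> s) \<le> indicator {0..t} s * (C * K)"
    using C
  proof eventually_elim
    case (elim \<omega>)
    show ?case
    proof
      fix s show "norm (g \<omega> s) \<le> indicator {0..t} s * (C * K)"
      proof (cases "s \<in> {0..t}")
        case True
        then have "norm (X s \<omega>) \<le> C" using elim t by auto
        then have "norm (X s \<omega>) * K \<le> C * K" using K0 by (intro mult_right_mono) auto
        then show ?thesis using K[of "X s \<omega>"] True by (simp add: g_def)
      qed (simp add: g_def)
    qed
  qed
  have ind: "integrable lborel (\<lambda>s. indicator {0..t} s * (C * K))"
    by (intro integrable_mult_left integrable_real_indicator) (auto simp: emeasure_lborel_Icc_eq)
  have gi: "AE \<omega> in M. integrable lborel (g \<omega>)"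
    using bnd AE_space
  proof eventually_elim
    case (elim \<omega>)
    have "norm (g \<omega> s) \<le> norm (indicator {0..t} s * (C * K))" for s
      using elim(1) abs_ge_self order_trans unfolding real_norm_def by blast
    then show ?case
      by (intro Bochner_Integration.integrable_bound[OF ind gs[OF elim(2)]]) simp
  qed
  then show "AE \<omega> in M. set_integrable lborel {0..t} (\<lambda>s. f (X s \<omega>))"
    unfolding set_integrable_def g_def .
  have prod: "integrable (M \<Otimes>\<^sub>M lborel) (case_prod g)"
  proof (rule P.Fubini_integrable[OF gm])
    show "AE \<omega> in M. integrable lborel (\<lambda>s. case_prod g (\<omega>, s))" using gi by simp
    have "(\<lambda>\<omega>. \<integral>s. norm (g \<omega> s) \<partial>lborel) \<in> borel_measurable M"
      by (rule lborel.borel_measurable_lebesgue_integral) (use gm in \<open>simp add: split_beta'\<close>)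
    moreover have "AE \<omega> in M. norm (\<integral>s. norm (g \<omega> s) \<partial>lborel) \<le> (\<integral>s. indicator {0..t} s * (C * K) \<partial>lborel)"
      using gi bnd
    proof eventually_elim
      case (elim \<omega>)
      then have "(\<integral>s. norm (g \<omega> s) \<partial>lborel) \<le> (\<integral>s. indicator {0..t} s * (C * K) \<partial>lborel)"
        using ind by (intro integral_mono) auto
      then show ?case by simp
    qed
    ultimately show "integrable M (\<lambda>\<omega>. \<integral>s. norm (case_prod g (\<omega>, s)) \<partial>lborel)"
      by (intro integrable_const_bound) auto
  qed
  have Xi: "integrable M (X s)" if s: "s \<in> {0..T}" for s
  proof (rule integrable_const_bound[OF _ Xm[OF s]])
    show "AE \<omega> in M. norm (X s \<omega>) \<le> C" using C by eventually_elim (use s in blast)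
  qed
  have gE: "(\<integral>\<omega>. g \<omega> s \<partial>M) = indicator {0..t} s *\<^sub>R f (expectation (X s))" for s
  proof (cases "s \<in> {0..t}")
    case True
    then show ?thesis using integral_bounded_linear[OF f Xi[of s]] t by (simp add: g_def)
  qed (simp add: g_def)
  show "integrable M (\<lambda>\<omega>. LINT s:{0..t}|lborel. f (X s \<omega>))"
    using P.integrable_fst[OF prod] by (simp add: set_lebesgue_integral_def g_def)
  show "set_integrable lborel {0..t} (\<lambda>s. f (expectation (X s)))"
    using P.integrable_snd[OF prod] unfolding gE set_integrable_def by simp
  show "expectation (\<lambda>\<omega>. LINT s:{0..t}|lborel. f (X s \<omega>)) = (LINT s:{0..t}|lborel. f (expectation (X s)))"
    using P.Fubini_integral[OF prod] unfolding gE by (simp add: set_lebesgue_integral_def g_def)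
qed

text \<open>Take expectations in the stochastic equation: the stochastic integrals drop out, and since the
drift is linear in the state, expectation and drift commute.\<close>

lemma (in prob_space) mean_state_equation:
  fixes W :: "real \<Rightarrow> 'a \<Rightarrow> real^'r::finite" and \<rho> :: "real \<Rightarrow> 'a \<Rightarrow> complex^'d^'d"
  assumes W: "std_wiener M T W" and sde: "sde_solution M T W H L \<rho>0 \<rho>"
    and dens: "AE \<omega> in M. \<forall>t\<in>{0..T}. density_matrix (\<rho> t \<omega>)" and T: "0 \<le> T"
  shows "\<And>t. t \<in> {0..T} \<Longrightarrow> \<rho> t \<in> borel_measurable M"
    and "AE \<omega> in M. \<forall>t\<in>{0..T}. norm (\<rho> t \<omega>) \<le> real CARD('d) * real CARD('d)"
    and "\<And>t. t \<in> {0..T} \<Longrightarrow> norm (expectation (\<rho> t)) \<le> real CARD('d) * real CARD('d)"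
    and "\<And>t. t \<in> {0..T} \<Longrightarrow>
      expectation (\<rho> t) = \<rho>0 + (LINT s:{0..t}|lborel. lindblad H L (expectation (\<rho> s)))"
    and "set_integrable lborel {0..T} (\<lambda>s. lindblad H L (expectation (\<rho> s)))"
proof -
  let ?C = "real CARD('d) * real CARD('d)"
  have prog: "progressive T (aug_filtration M W) \<rho>" using sde by (simp add: sde_solution_def)
  have sub: "sets (aug_filtration M W t) \<subseteq> events" if "t \<in> {0..T}" for t
    by (rule aug_filtration_subset, rule std_wienerD(1)[OF W]) (use that in auto)
  show meas: "\<rho> t \<in> borel_measurable M" if t: "t \<in> {0..T}" for t
    by (rule measurable_aug_filtration_base[OF progressive_measurable[OF prog t]], rule std_wienerD(1)[OF W])
      (use t in auto)
  show bnd: "AE \<omega> in M. \<forall>t\<in>{0..T}. norm (\<rho> t \<omega>) \<le> ?C"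
    using dens by eventually_elim (use norm_density_matrix_le in blast)
  have int: "integrable M (\<rho> t)" "norm (expectation (\<rho> t)) \<le> ?C" if t: "t \<in> {0..T}" for t
  proof -
    have b: "AE \<omega> in M. norm (\<rho> t \<omega>) \<le> ?C" using bnd by eventually_elim (use t in blast)
    show i: "integrable M (\<rho> t)" by (rule integrable_const_bound[OF b meas[OF t]])
    have "norm (expectation (\<rho> t)) \<le> expectation (\<lambda>\<omega>. norm (\<rho> t \<omega>))" by (rule integral_norm_bound)
    also have "\<dots> \<le> expectation (\<lambda>_. ?C)" using i b by (intro integral_mono_AE) auto
    finally show "norm (expectation (\<rho> t)) \<le> ?C" by (simp add: prob_space)
  qed
  show "norm (expectation (\<rho> t)) \<le> ?C" if "t \<in> {0..T}" for t by (rule int(2)[OF that])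
  note Fub = progressive_Fubini[OF prog _ bounded_linear_lindblad space_aug_filtration sub meas bnd]
  show "set_integrable lborel {0..T} (\<lambda>s. lindblad H L (expectation (\<rho> s)))"
    by (rule Fub(3)) (use T in auto)
  obtain I where I: "\<And>k. ito_integral M T (aug_filtration M W) (\<lambda>t \<omega>. W t \<omega> $ k)
               (\<lambda>t \<omega>. diffusion (L k) (\<rho> t \<omega>)) (I k)"
    and eq: "AE \<omega> in M. \<forall>t\<in>{0..T}.
           \<rho> t \<omega> = \<rho>0 + (LINT s:{0..t}|lborel. lindblad H L (\<rho> s \<omega>)) + (\<Sum>k\<in>UNIV. I k t \<omega>)"
    using sde unfolding sde_solution_def by blast
  show "expectation (\<rho> t) = \<rho>0 + (LINT s:{0..t}|lborel. lindblad H L (expectation (\<rho> s)))"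
    if t: "t \<in> {0..T}" for t
  proof -
    note F = Fub(1)[OF t t] Fub(2)[OF t t]
    note Ik = ito_integral_mean_zero[OF W I t]
    have "expectation (\<rho> t) = expectation (\<lambda>\<omega>. \<rho>0 + (LINT s:{0..t}|lborel. lindblad H L (\<rho> s \<omega>)) + (\<Sum>k\<in>UNIV. I k t \<omega>))"
    proof (rule integral_cong_AE)
      show "AE \<omega> in M. \<rho> t \<omega> = \<rho>0 + (LINT s:{0..t}|lborel. lindblad H L (\<rho> s \<omega>)) + (\<Sum>k\<in>UNIV. I k t \<omega>)"
        using eq by eventually_elim (use t in blast)
      show "(\<lambda>\<omega>. \<rho>0 + (LINT s:{0..t}|lborel. lindblad H L (\<rho> s \<omega>)) + (\<Sum>k\<in>UNIV. I k t \<omega>)) \<in> borel_measurable M"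
        by (intro borel_measurable_add borel_measurable_sum borel_measurable_integrable[OF F(1)]
            borel_measurable_integrable[OF Ik(1)]) simp
    qed (rule meas[OF t])
    also have "\<dots> = expectation (\<lambda>\<omega>. \<rho>0 + (LINT s:{0..t}|lborel. lindblad H L (\<rho> s \<omega>)))
        + expectation (\<lambda>\<omega>. \<Sum>k\<in>UNIV. I k t \<omega>)"
      by (intro Bochner_Integration.integral_add Bochner_Integration.integrable_add
          Bochner_Integration.integrable_sum F(1) Ik(1) integrable_const)
    also have "expectation (\<lambda>\<omega>. \<Sum>k\<in>UNIV. I k t \<omega>) = 0"
      by (subst Bochner_Integration.integral_sum) (simp_all add: Ik)
    also have "expectation (\<lambda>\<omega>. \<rho>0 + (LINT s:{0..t}|lborel. lindblad H L (\<rho> s \<omega>)))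
        = \<rho>0 + expectation (\<lambda>\<omega>. LINT s:{0..t}|lborel. lindblad H L (\<rho> s \<omega>))"
    proof -
      have "expectation (\<lambda>_. \<rho>0) = \<rho>0" by (simp add: prob_space)
      then show ?thesis by (simp only: Bochner_Integration.integral_add[OF integrable_const F(1)])
    qed
    also have "\<rho>0 + expectation (\<lambda>\<omega>. LINT s:{0..t}|lborel. lindblad H L (\<rho> s \<omega>)) + 0
        = \<rho>0 + expectation (\<lambda>\<omega>. LINT s:{0..t}|lborel. lindblad H L (\<rho> s \<omega>))" by simp
    finally show ?thesis by (simp only: F(2))
  qed
qed

section \<open>The averaged record\<close>

text \<open>The paths \<open>W\<^sup>i\<close> are independent as random elements of a product space; the augmented filtration
at time \<open>T\<close> contains only sets that differ from path events by null sets.\<close>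

lemma (in prob_space) indep_aug_filtrations:
  fixes W :: "nat \<Rightarrow> real \<Rightarrow> 'a \<Rightarrow> 'b::topological_space"
  assumes ind: "indep_processes M T W I" and T: "0 \<le> T"
    and meas: "\<And>i s. i \<in> I \<Longrightarrow> s \<in> {0..T} \<Longrightarrow> W i s \<in> borel_measurable M"
  shows "indep_sets (\<lambda>i. sets (aug_filtration M (W i) T)) I"
proof -
  let ?P = "\<Pi>\<^sub>M t\<in>{0..T}. borel :: 'b measure" and ?X = "\<lambda>i \<omega>. \<lambda>t\<in>{0..T}. W i t \<omega>"
  define F where "F i = {?X i -` A \<inter> space M | A. A \<in> sets ?P}" for i
  have "indep_sets (\<lambda>i. sigma_sets (space M) (F i)) I"
    using ind unfolding indep_processes_def indep_vars_def F_def by simp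
  then have "indep_sets F I" by (rule indep_sets_mono_sets) (auto intro: sigma_sets.Basic)
  then have "indep_sets (\<lambda>i. ae_hull M (F i)) I" by (rule indep_sets_ae_hull)
  then have "indep_sets (\<lambda>i. sigma_sets (space M) (ae_hull M (F i))) I"
    by (rule indep_sets_sigma) (unfold F_def, intro Int_stable_ae_hull Int_stable_vimages)
  then show ?thesis
  proof (rule indep_sets_mono_sets)
    fix i assume i: "i \<in> I"
    show "sets (aug_filtration M (W i) T) \<subseteq> sigma_sets (space M) (ae_hull M (F i))"
    proof (rule aug_filtration_subset_ae_hull[OF meas[OF i]])
      show "{} \<in> F i" unfolding F_def by (intro CollectI exI[of _ "{}"]) simp
      fix s B assume s: "s \<in> {0..T}" and B: "B \<in> sets (borel :: 'b measure)"
      have "(\<lambda>f. f s) -` B \<inter> space ?P \<in> sets ?P"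
        using measurable_component_singleton[OF s] B by (rule measurable_sets)
      moreover have "W i s -` B \<inter> space M = ?X i -` ((\<lambda>f. f s) -` B \<inter> space ?P) \<inter> space M"
        using s by (auto simp: space_PiM)
      ultimately show "W i s -` B \<inter> space M \<in> F i" unfolding F_def by blast
    qed
  qed
qed

text \<open>After centring, an increment of a record is the sum of a bounded part of size \<open>O(t - s)\<close>,
coming from the drift, and a Wiener increment, whose fourth moment is \<open>3 (t - s)\<^sup>2\<close>. So
\<open>uniform_slln\<close> applies to each component. The records are only almost surely equal to measurable
processes, hence the auxiliary processes \<open>V\<close>.\<close>

lemma (in prob_space) mean_record_uniform_slln:
  fixes W :: "nat \<Rightarrow> real \<Rightarrow> 'a \<Rightarrow> real^'r::finite" and \<rho> :: "nat \<Rightarrow> real \<Rightarrow> 'a \<Rightarrow> complex^'d^'d"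
  assumes T: "0 < T" and C: "0 \<le> C"
    and W: "\<And>i. 1 \<le> i \<Longrightarrow> std_wiener M T (W i)"
    and ind: "indep_processes M T W {1..}"
    and prog: "\<And>i. 1 \<le> i \<Longrightarrow> progressive T (aug_filtration M (W i)) (\<rho> i)"
    and bnd: "\<And>i. 1 \<le> i \<Longrightarrow> AE \<omega> in M. \<forall>t\<in>{0..T}. norm (\<rho> i t \<omega>) \<le> C"
    and mean: "\<And>i t. 1 \<le> i \<Longrightarrow> t \<in> {0..T} \<Longrightarrow> expectation (\<rho> i t) = e t"
    and obs: "\<And>i. 1 \<le> i \<Longrightarrow> observation M T (W i) L (\<rho> i) (Y i)"
  shows "AE \<omega> in M. \<forall>\<epsilon>>0. \<exists>K. \<forall>N\<ge>K. \<forall>t\<in>{0..T}.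
    norm (mean_record Y N t \<omega> - (LINT s:{0..t}|lborel. bvec L (e s))) \<le> \<epsilon>"
proof -
  define B where "B i t \<omega> = (LINT s:{0..t}|lborel. bvec L (\<rho> i s \<omega>))" for i t \<omega>
  define y where "y t = (LINT s:{0..t}|lborel. bvec L (e s))" for t
  define V where "V i t \<omega> = B i t \<omega> + (W i t \<omega> - W i 0 \<omega>)" for i t \<omega>
  obtain K0 where K0: "\<And>x. norm (bvec L x) \<le> norm x * K0" "0 < K0"
    using bounded_linear.pos_bounded[OF bounded_linear_bvec] by metis
  define b where "b = C * K0"
  have b0: "0 \<le> b" using C K0 by (simp add: b_def)
  have bvec_le: "norm (bvec L x) \<le> b" if "norm x \<le> C" for x
    unfolding b_def using K0(1)[of x] mult_right_mono[OF that, of K0] K0(2) by linarith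
  have sub: "sets (aug_filtration M (W i) t) \<subseteq> events" if "1 \<le> i" "t \<in> {0..T}" for i t
    by (rule aug_filtration_subset, rule std_wienerD(1)[OF W[OF that(1)]]) (use that in auto)
  have Wm: "W i t \<in> borel_measurable (aug_filtration M (W i) T)" if "t \<in> {0..T}" for i t
    by (rule borel_measurable_aug_filtration_process[OF that])
  have Bm: "B i t \<in> borel_measurable (aug_filtration M (W i) T)" if "1 \<le> i" "t \<in> {0..T}" for i t
    unfolding B_def
    by (rule measurable_aug_filtration[OF progressive_integral_measurable[OF prog[OF that(1)] that(2) bounded_linear_bvec]])
      (use that in auto)
  have rm: "\<rho> i t \<in> borel_measurable M" if "1 \<le> i" "t \<in> {0..T}" for i t
    by (rule measurable_aug_filtration_base[OF progressive_measurable[OF prog[OF that(1)] that(2)]],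
        rule std_wienerD(1)[OF W[OF that(1)]]) (use that in auto)
  have Fub: "integrable M (B i t)" "expectation (B i t) = y t"
      "set_integrable lborel {0..t} (\<lambda>s. bvec L (e s))"
      "AE \<omega> in M. set_integrable lborel {0..t} (\<lambda>s. bvec L (\<rho> i s \<omega>))"
    if i: "1 \<le> i" and t: "t \<in> {0..T}" for i t
  proof -
    note F = progressive_Fubini[OF prog[OF i] t bounded_linear_bvec space_aug_filtration sub[OF i t] rm[OF i] bnd[OF i]]
    have cong: "(LINT s:{0..t}|lborel. bvec L (expectation (\<rho> i s))) = y t"
      unfolding y_def using mean[OF i] t by (intro set_lebesgue_integral_cong) auto
    have "set_integrable lborel {0..t} (\<lambda>s. bvec L (expectation (\<rho> i s)))
        \<longleftrightarrow> set_integrable lborel {0..t} (\<lambda>s. bvec L (e s))"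
      using mean[OF i] t by (intro set_integrable_cong) auto
    from iffD1[OF this F(3)] show "set_integrable lborel {0..t} (\<lambda>s. bvec L (e s))" .
    show "integrable M (B i t)" unfolding B_def by (rule F(1))
    show "expectation (B i t) = y t" unfolding B_def cong[symmetric] by (rule F(2))
    show "AE \<omega> in M. set_integrable lborel {0..t} (\<lambda>s. bvec L (\<rho> i s \<omega>))" by (rule F(4))
  qed
  have TT: "T \<in> {0..T}" using T by simp
  have Blip: "AE \<omega> in M. \<forall>s\<in>{0..T}. \<forall>t\<in>{0..T}. norm (B i t \<omega> - B i s \<omega>) \<le> b * \<bar>t - s\<bar>" if i: "1 \<le> i" for i
    using Fub(4)[OF i TT] bnd[OF i]
  proof eventually_elim
    case (elim \<omega>)
    then show ?case unfolding B_def using T bvec_le by (intro ballI set_integral_increment_bound) auto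
  qed
  have Em: "norm (e t) \<le> C" if t: "t \<in> {0..T}" for t
  proof -
    have "AE \<omega> in M. norm (\<rho> 1 t \<omega>) \<le> C" using bnd[of 1] t by (auto elim: eventually_mono)
    then have "expectation (\<lambda>\<omega>. norm (\<rho> 1 t \<omega>)) \<le> expectation (\<lambda>_. C)"
      using integrable_const_bound[OF _ rm[of 1 t]] t by (intro integral_mono_AE) auto
    then have "expectation (\<lambda>\<omega>. norm (\<rho> 1 t \<omega>)) \<le> C" by (simp add: prob_space)
    then have "norm (expectation (\<rho> 1 t)) \<le> C" by (rule order_trans[OF integral_norm_bound])
    then show ?thesis using mean[of 1 t] t by simp
  qed
  have ylip: "norm (y t - y s) \<le> b * \<bar>t - s\<bar>" if "s \<in> {0..T}" "t \<in> {0..T}" for s t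
    unfolding y_def using Fub(3)[of 1 T] T that by (intro set_integral_increment_bound bvec_le Em) auto
  have at_zero: "(LINT s:{0..0}|lborel. f s) = 0" for f :: "real \<Rightarrow> real^'r"
    unfolding set_lebesgue_integral_def
  proof (rule integral_eq_zero_AE)
    show "AE s in lborel. indicator {0..0} s *\<^sub>R f s = 0"
      using AE_lborel_singleton[of "0::real"] by eventually_elim simp
  qed
  have comp: "AE \<omega> in M. \<forall>\<epsilon>>0. \<exists>K. \<forall>N\<ge>K. \<forall>t\<in>{0..T}. \<bar>(\<Sum>i=1..N. (V i t \<omega> - y t) $ k) / real N\<bar> \<le> \<epsilon>" for k
  proof (rule uniform_slln[OF T])
    (* From (x + v)^4 <= 8 (x^4 + v^4) with |x| <= 2 b (t - s) and E v^4 = 3 (t - s)^2; as c >= 1,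
       the bound c (t - s)^2 is at most the square (c (t - s))^2 that the strong law asks for. *)
    define c where "c = 8 * (16 * b ^ 4 * T\<^sup>2 + 3)"
    show c0: "0 < c" unfolding c_def by (intro mult_pos_pos add_nonneg_pos) auto
    have incr: "(V i t \<omega> - y t) $ k - (V i s \<omega> - y s) $ k
        = ((B i t \<omega> - B i s \<omega>) - (y t - y s)) $ k + (W i t \<omega> $ k - W i s \<omega> $ k)" for i s t \<omega>
      by (simp add: V_def)
    fix s t :: real assume st: "0 \<le> s" "s < t" "t \<le> T"
    then have sT: "s \<in> {0..T}" and tT: "t \<in> {0..T}" and zT: "0 \<in> {0..T}" by auto
    show "indep_vars (\<lambda>_. borel) (\<lambda>i \<omega>. (V i t \<omega> - y t) $ k - (V i s \<omega> - y s) $ k) {1..}"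
    proof (rule indep_vars_of_indep_subalgebras)
      show "indep_sets (\<lambda>i. sets (aug_filtration M (W i) T)) {1..}"
        by (rule indep_aug_filtrations[OF ind]) (use T std_wienerD(1)[OF W] in auto)
      fix i :: nat assume "i \<in> {1..}"
      then have i: "1 \<le> i" by simp
      show "(\<lambda>\<omega>. (V i t \<omega> - y t) $ k - (V i s \<omega> - y s) $ k) \<in> borel_measurable (aug_filtration M (W i) T)"
        unfolding V_def
        by (intro borel_measurable_diff borel_measurable_add measurable_compose[OF _ borel_measurable_nth]
            Bm[OF i] Wm sT tT zT borel_measurable_const)
    qed (rule space_aug_filtration)
    fix i :: nat assume i: "1 \<le> i"
    define D where "D \<omega> = ((B i t \<omega> - B i s \<omega>) - (y t - y s)) $ k" for \<omega>
    define w where "w \<omega> = W i t \<omega> $ k - W i s \<omega> $ k" for \<omega>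
    note w = wiener_increment_moments[OF W[OF i] st, of k, folded w_def]
    have BI: "integrable M (\<lambda>\<omega>. (B i t \<omega> - B i s \<omega>) - (y t - y s))"
      using Fub(1)[OF i tT] Fub(1)[OF i sT] by simp
    have DI: "integrable M D" unfolding D_def
      by (rule integrable_bounded_linear[OF bounded_linear_vec_nth BI])
    have D0: "expectation D = 0"
      unfolding D_def
      using integral_bounded_linear[OF bounded_linear_vec_nth BI, of k] Fub(1,2)[OF i tT] Fub(1,2)[OF i sT]
      by (simp add: prob_space)
    have Db: "AE \<omega> in M. \<bar>D \<omega>\<bar> \<le> 2 * b * (t - s)"
      using Blip[OF i]
    proof eventually_elim
      case (elim \<omega>)
      have "\<bar>D \<omega>\<bar> \<le> norm ((B i t \<omega> - B i s \<omega>) - (y t - y s))"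
        unfolding D_def by (rule component_le_norm_cart)
      also have "\<dots> \<le> norm (B i t \<omega> - B i s \<omega>) + norm (y t - y s)" by (rule norm_triangle_ineq4)
      also have "\<dots> \<le> b * \<bar>t - s\<bar> + b * \<bar>t - s\<bar>" using elim sT tT by (intro add_mono ylip) auto
      finally show ?case using st by simp
    qed
    have pt: "(x + v) ^ 4 \<le> 8 * (x ^ 4 + v ^ 4)" for x v :: real
    proof -
      have sq: "(p + q)\<^sup>2 \<le> 2 * (p\<^sup>2 + q\<^sup>2)" for p q :: real
        using zero_le_power2[of "p - q"] by (simp add: power2_sum power2_diff)
      have "(x + v) ^ 4 = ((x + v)\<^sup>2)\<^sup>2" by simp
      also have "\<dots> \<le> (2 * (x\<^sup>2 + v\<^sup>2))\<^sup>2" by (intro power_mono sq) simp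
      also have "\<dots> = 4 * (x\<^sup>2 + v\<^sup>2)\<^sup>2" by (simp only: power_mult_distrib) simp
      also have "\<dots> \<le> 4 * (2 * ((x\<^sup>2)\<^sup>2 + (v\<^sup>2)\<^sup>2))" by (intro mult_left_mono sq) simp
      finally show ?thesis by simp
    qed
    have bound: "AE \<omega> in M. (D \<omega> + w \<omega>) ^ 4 \<le> 8 * ((2 * b * (t - s)) ^ 4 + w \<omega> ^ 4)"
      using Db
    proof eventually_elim
      case (elim \<omega>)
      have "D \<omega> ^ 4 \<le> (2 * b * (t - s)) ^ 4" using power_mono[OF elim, of 4] by (simp add: power_abs)
      then show ?case by (intro order_trans[OF pt] mult_left_mono add_right_mono) simp_all
    qed
    have rhs: "integrable M (\<lambda>\<omega>. 8 * ((2 * b * (t - s)) ^ 4 + w \<omega> ^ 4))" using w(3) by simp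
    have I4: "integrable M (\<lambda>\<omega>. (D \<omega> + w \<omega>) ^ 4)"
    proof (rule Bochner_Integration.integrable_bound[OF rhs])
      show "(\<lambda>\<omega>. (D \<omega> + w \<omega>) ^ 4) \<in> borel_measurable M"
        using borel_measurable_integrable[OF DI] borel_measurable_integrable[OF w(1)]
        by (intro borel_measurable_power borel_measurable_add)
      show "AE \<omega> in M. norm ((D \<omega> + w \<omega>) ^ 4) \<le> norm (8 * ((2 * b * (t - s)) ^ 4 + w \<omega> ^ 4))"
        using bound by eventually_elim simp
    qed
    show "integrable M (\<lambda>\<omega>. ((V i t \<omega> - y t) $ k - (V i s \<omega> - y s) $ k) ^ 4)"
      unfolding incr using I4 unfolding D_def w_def .
    show "expectation (\<lambda>\<omega>. (V i t \<omega> - y t) $ k - (V i s \<omega> - y s) $ k) = 0"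
      unfolding incr using Bochner_Integration.integral_add[OF DI w(1)] D0 w(2) unfolding D_def w_def by simp
    have "expectation (\<lambda>\<omega>. (D \<omega> + w \<omega>) ^ 4) \<le> expectation (\<lambda>\<omega>. 8 * ((2 * b * (t - s)) ^ 4 + w \<omega> ^ 4))"
      by (rule integral_mono_AE[OF I4 rhs bound])
    also have "\<dots> = 8 * ((2 * b * (t - s)) ^ 4 + 3 * (t - s)\<^sup>2)" using w(3,4) by (simp add: prob_space)
    also have "(2 * b * (t - s)) ^ 4 = 16 * b ^ 4 * (t - s)\<^sup>2 * (t - s)\<^sup>2"
      by (simp add: power_mult_distrib power2_eq_square eval_nat_numeral)
    also have "\<dots> \<le> 16 * b ^ 4 * T\<^sup>2 * (t - s)\<^sup>2"
      using st b0 by (intro mult_right_mono mult_left_mono power_mono) auto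
    also have "8 * (16 * b ^ 4 * T\<^sup>2 * (t - s)\<^sup>2 + 3 * (t - s)\<^sup>2) = c * (t - s)\<^sup>2"
      by (simp add: c_def algebra_simps)
    also have "\<dots> \<le> c\<^sup>2 * (t - s)\<^sup>2"
    proof (rule mult_right_mono)
      have "1 \<le> c" unfolding c_def by simp
      then show "c \<le> c\<^sup>2" by (simp add: power2_eq_square mult_le_cancel_left1)
    qed simp
    finally show "expectation (\<lambda>\<omega>. ((V i t \<omega> - y t) $ k - (V i s \<omega> - y s) $ k) ^ 4) \<le> (c * (t - s))\<^sup>2"
      unfolding incr unfolding D_def w_def by (simp add: power_mult_distrib)
  next
    fix i :: nat assume i: "1 \<le> i"
    show "AE \<omega> in M. continuous_on {0..T} (\<lambda>t. (V i t \<omega> - y t) $ k) \<and> (V i 0 \<omega> - y 0) $ k = 0"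
      using Blip[OF i] std_wienerD(3)[OF W[OF i]]
    proof eventually_elim
      case (elim \<omega>)
      have "b-lipschitz_on {0..T} (\<lambda>t. B i t \<omega>)"
        using elim(1) b0 by (auto intro!: lipschitz_onI simp: dist_norm dist_real_def)
      moreover have "b-lipschitz_on {0..T} y"
        using ylip b0 by (auto intro!: lipschitz_onI simp: dist_norm dist_real_def)
      ultimately have "continuous_on {0..T} (\<lambda>t. B i t \<omega>)" "continuous_on {0..T} y"
        by (auto intro: lipschitz_on_continuous_on)
      then have "continuous_on {0..T} (\<lambda>t. (V i t \<omega> - y t) $ k)"
        unfolding V_def using elim(2) by (intro continuous_intros)
      moreover have "B i 0 \<omega> = 0" "y 0 = 0"
        unfolding B_def y_def by (rule at_zero)+
      ultimately show ?case by (simp add: V_def)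
    qed
  qed
  have YV: "AE \<omega> in M. \<forall>i. 1 \<le> i \<longrightarrow> (\<forall>t\<in>{0..T}. Y i t \<omega> = V i t \<omega>)"
    unfolding AE_all_countable
  proof
    fix i show "AE \<omega> in M. 1 \<le> i \<longrightarrow> (\<forall>t\<in>{0..T}. Y i t \<omega> = V i t \<omega>)"
      using obs[of i] by (cases "1 \<le> i") (simp_all add: observation_def V_def B_def)
  qed
  have "AE \<omega> in M. \<forall>k. \<forall>\<epsilon>>0. \<exists>K. \<forall>N\<ge>K. \<forall>t\<in>{0..T}. \<bar>(\<Sum>i=1..N. (V i t \<omega> - y t) $ k) / real N\<bar> \<le> \<epsilon>"
    using comp by (simp add: AE_all_countable)
  then show ?thesis using YV
  proof eventually_elim
    case (elim \<omega>)
    show ?case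
    proof (intro allI impI)
      fix \<epsilon> :: real assume e: "0 < \<epsilon>"
      let ?\<delta> = "\<epsilon> / real CARD('r)"
      have d: "0 < ?\<delta>" using e by simp
      from elim(1) d have "\<forall>k. \<exists>K. \<forall>N\<ge>K. \<forall>t\<in>{0..T}. \<bar>(\<Sum>i=1..N. (V i t \<omega> - y t) $ k) / real N\<bar> \<le> ?\<delta>" by blast
      then obtain K where K: "\<And>k N t. N \<ge> K k \<Longrightarrow> t \<in> {0..T} \<Longrightarrow> \<bar>(\<Sum>i=1..N. (V i t \<omega> - y t) $ k) / real N\<bar> \<le> ?\<delta>"
        by metis
      show "\<exists>K. \<forall>N\<ge>K. \<forall>t\<in>{0..T}. norm (mean_record Y N t \<omega> - (LINT s:{0..t}|lborel. bvec L (e s))) \<le> \<epsilon>"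
      proof (intro exI allI impI ballI)
        fix N t assume N: "max 1 (Max (range K)) \<le> N" and t: "t \<in> {0..T}"
        have NK: "K k \<le> N" for k using N Max_ge[of "range K" "K k"] by simp
        have "(mean_record Y N t \<omega> - y t) $ k = (\<Sum>i=1..N. (V i t \<omega> - y t) $ k) / real N" for k
          using N elim(2) t by (simp add: mean_record_def sum_subtractf field_simps)
        then have "norm (mean_record Y N t \<omega> - y t) \<le> (\<Sum>k\<in>(UNIV::'r set). ?\<delta>)"
          using K[OF NK t] norm_le_l1_cart[of "mean_record Y N t \<omega> - y t"]
          by (metis (no_types, lifting) order_trans sum_mono)
        then show "norm (mean_record Y N t \<omega> - (LINT s:{0..t}|lborel. bvec L (e s))) \<le> \<epsilon>"
          unfolding y_def by simp
      qed
    qed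
  qed
qed

section \<open>The contrast and its maximizers\<close>

lemma double_limitI:
  assumes "\<And>\<epsilon>. 0 < \<epsilon> \<Longrightarrow> \<exists>K. \<forall>N\<ge>K. \<forall>n\<ge>K. norm (X N n - x) \<le> \<epsilon>"
  shows "double_limit X x"
  unfolding double_limit_def
proof (rule order_tendstoI)
  fix a :: ennreal assume "0 < a"
  then obtain b where b: "0 < b" "b < a" using dense by blast
  then obtain \<epsilon> where e: "b = ennreal \<epsilon>" "0 < \<epsilon>"
    by (metis ennreal_cases ennreal_less_zero_iff ennreal_zero_less_top less_ennreal.rep_eq not_less_iff_gr_or_eq order_less_trans top.not_eq_extremum top_greatest)
  obtain K where K: "\<And>N n. N \<ge> K \<Longrightarrow> n \<ge> K \<Longrightarrow> norm (X N n - x) \<le> \<epsilon>" using assms[OF e(2)] by blast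
  have "(SUP (N, n)\<in>{k..} \<times> {k..}. ennreal (norm (X N n - x))) \<le> b" if "k \<ge> K" for k
    unfolding e using K that e(2) by (intro SUP_least) (auto intro!: ennreal_leI)
  then show "\<forall>\<^sub>F k in sequentially. (SUP (N, n)\<in>{k..} \<times> {k..}. ennreal (norm (X N n - x))) < a"
    using b(2) by (auto simp: eventually_sequentially intro: le_less_trans)
qed simp

lemma summation_by_parts:
  fixes a u :: "nat \<Rightarrow> 'a::real_inner"
  shows "(\<Sum>j<n. a j \<bullet> (u (Suc j) - u j)) = a n \<bullet> u n - a 0 \<bullet> u 0 - (\<Sum>j<n. (a (Suc j) - a j) \<bullet> u (Suc j))"
  by (induction n) (simp_all add: inner_diff_left inner_diff_right)

lemma contrast_eq:
  "contrast T h y n \<theta> = (\<Sum>j<n. h (real j * (T / real n)) \<theta> \<bullet>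
      (y (real (Suc j) * (T / real n)) - y (real j * (T / real n))) - (norm (h (real j * (T / real n)) \<theta>))\<^sup>2 / 2 * (T / real n))"
proof -
  have *: "(\<Sum>j=1..n. f (j - 1)) = (\<Sum>j<n. f j)" for f :: "nat \<Rightarrow> real"
    using sum.atLeast1_atMost_eq[of "\<lambda>j. f (j - 1)" n] by simp
  have **: "(\<Sum>j=1..n. g j (j - 1)) = (\<Sum>j<n. g (Suc j) j)" for g :: "nat \<Rightarrow> nat \<Rightarrow> real"
    using sum.atLeast1_atMost_eq[of "\<lambda>j. g j (j - 1)" n] by simp
  show ?thesis
    unfolding contrast_def Let_def
    unfolding **[of "\<lambda>j i. h (real i * (T / real n)) \<theta> \<bullet> (y (real j * (T / real n)) - y (real i * (T / real n)))"]
      *[of "\<lambda>i. (norm (h (real i * (T / real n)) \<theta>))\<^sup>2 * (T / real n)"]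
    by (simp add: sum_subtractf sum_distrib_left)
qed

lemma grid_point:
  assumes "0 < T" "0 < n" "j \<le> n"
  shows "real j * (T / real n) \<in> {0..T}"
proof -
  have "real j * T \<le> real n * T" using assms by (intro mult_right_mono) auto
  then show ?thesis using assms by (simp add: field_simps)
qed

text \<open>The record enters through its increments, which a uniform estimate of the record does not
control in sum over a fine grid. Summation by parts replaces them by increments of \<open>h\<close>, whose
total is at most \<open>C T\<close> for every mesh.\<close>

lemma contrast_perturbation:
  fixes h :: "real \<Rightarrow> 'q \<Rightarrow> real^'r::finite"
  assumes T: "0 < T" and n: "0 < n" and C: "0 \<le> C"
    and bound: "\<And>s. s \<in> {0..T} \<Longrightarrow> norm (h s \<theta>) \<le> C"
    and lip: "\<And>s t. s \<in> {0..T} \<Longrightarrow> t \<in> {0..T} \<Longrightarrow> norm (h t \<theta> - h s \<theta>) \<le> C * \<bar>t - s\<bar>"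
    and close: "\<And>t. t \<in> {0..T} \<Longrightarrow> norm (z t - y t) \<le> \<epsilon>"
  shows "\<bar>contrast T h z n \<theta> - contrast T h y n \<theta>\<bar> \<le> C * (2 + T) * \<epsilon>"
proof -
  define t where "t j = real j * (T / real n)" for j
  define a where "a j = h (t j) \<theta>" for j
  define u where "u j = z (t j) - y (t j)" for j
  have t: "t j \<in> {0..T}" if "j \<le> n" for j unfolding t_def by (rule grid_point[OF T n that])
  have e0: "0 \<le> \<epsilon>" using close[OF t[of 0]] norm_ge_zero order_trans by blast
  have a: "norm (a j) \<le> C" "norm (u j) \<le> \<epsilon>" if "j \<le> n" for j
    unfolding a_def u_def using bound close t[OF that] by auto
  have da: "norm (a (Suc j) - a j) \<le> C * (T / real n)" if "j < n" for j
  proof -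
    have "t (Suc j) - t j = T / real n" by (simp add: t_def distrib_right add_divide_distrib)
    then show ?thesis using lip[OF t[of j] t[of "Suc j"]] that T unfolding a_def by simp
  qed
  have ip: "\<bar>x \<bullet> v\<bar> \<le> p * q" if "norm x \<le> p" "norm v \<le> q" for x v :: "real^'r" and p q
    by (rule order_trans[OF Cauchy_Schwarz_ineq2 mult_mono[OF that]])
      (use that norm_ge_zero order_trans in blast)+
  have "contrast T h z n \<theta> - contrast T h y n \<theta> = (\<Sum>j<n. a j \<bullet> (u (Suc j) - u j))"
    unfolding contrast_eq a_def u_def t_def by (simp add: sum_subtractf[symmetric] inner_diff_right algebra_simps)
  also have "\<dots> = a n \<bullet> u n - a 0 \<bullet> u 0 - (\<Sum>j<n. (a (Suc j) - a j) \<bullet> u (Suc j))"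
    by (rule summation_by_parts)
  also have "\<bar>\<dots>\<bar> \<le> C * \<epsilon> + C * \<epsilon> + (\<Sum>j<n. C * (T / real n) * \<epsilon>)"
  proof -
    have "\<bar>\<Sum>j<n. (a (Suc j) - a j) \<bullet> u (Suc j)\<bar> \<le> (\<Sum>j<n. C * (T / real n) * \<epsilon>)"
      by (intro order_trans[OF sum_abs] sum_mono ip da a) auto
    moreover have "\<bar>a n \<bullet> u n\<bar> \<le> C * \<epsilon>" "\<bar>a 0 \<bullet> u 0\<bar> \<le> C * \<epsilon>" using a by (auto intro!: ip)
    ultimately show ?thesis by linarith
  qed
  also have "\<dots> = C * (2 + T) * \<epsilon>" using n by (simp add: algebra_simps)
  finally show ?thesis .
qed

text \<open>On a grid interval of length \<open>d\<close>, evaluating \<open>h\<close> at the left endpoint costs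
\<open>C d \<cdot> C\<close> in the linear term and the same in the quadratic term, hence \<open>2 C\<^sup>2 d\<^sup>2\<close> after
integration; there are \<open>n = T/d\<close> intervals.\<close>

lemma contrast_riemann_error:
  fixes h :: "real \<Rightarrow> 'q \<Rightarrow> real^'r::finite"
  assumes T: "0 < T" and n: "0 < n" and C: "0 \<le> C"
    and bound: "\<And>s. s \<in> {0..T} \<Longrightarrow> norm (h s \<theta>) \<le> C"
    and lip: "\<And>s t. s \<in> {0..T} \<Longrightarrow> t \<in> {0..T} \<Longrightarrow> norm (h t \<theta> - h s \<theta>) \<le> C * \<bar>t - s\<bar>"
    and g: "continuous_on {0..T} g" "\<And>s. s \<in> {0..T} \<Longrightarrow> norm (g s) \<le> C"
    and y: "\<And>t. t \<in> {0..T} \<Longrightarrow> y t = integral {0..t} g"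
  shows "\<bar>contrast T h y n \<theta> - integral {0..T} (\<lambda>s. h s \<theta> \<bullet> g s - (norm (h s \<theta>))\<^sup>2 / 2)\<bar>
    \<le> 2 * C\<^sup>2 * T\<^sup>2 / real n"
proof -
  define d where "d = T / real n"
  define t where "t j = real j * d" for j
  have t: "t j \<in> {0..T}" if "j \<le> n" for j unfolding t_def d_def by (rule grid_point[OF T n that])
  have d0: "0 < d" using T n by (simp add: d_def)
  have ts: "t (Suc j) = t j + d" for j by (simp add: t_def algebra_simps)
  have hc: "continuous_on {0..T} (\<lambda>s. h s \<theta>)"
    by (rule lipschitz_on_continuous_on[of C]) (auto intro!: lipschitz_onI lip C simp: dist_norm dist_real_def)
  define G where "G s = h s \<theta> \<bullet> g s - (norm (h s \<theta>))\<^sup>2 / 2" for s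
  have Gc: "continuous_on {0..T} G" unfolding G_def by (intro continuous_intros hc g) simp
  have total: "integral {0..t m} G = (\<Sum>j<m. integral {t j..t (Suc j)} G)" if "m \<le> n" for m
    using that
  proof (induction m)
    case 0
    then show ?case by (simp add: t_def)
  next
    case (Suc m)
    have "G integrable_on {0..t (Suc m)}"
      using Suc.prems t[of "Suc m"] by (intro integrable_continuous_real continuous_on_subset[OF Gc]) auto
    then have "integral {0..t m} G + integral {t m..t (Suc m)} G = integral {0..t (Suc m)} G"
      using Suc.prems t[of m] d0 ts[of m] by (intro Henstock_Kurzweil_Integration.integral_combine) auto
    then show ?case using Suc by simp
  qed
  have local: "\<bar>h (t j) \<theta> \<bullet> (y (t (Suc j)) - y (t j)) - (norm (h (t j) \<theta>))\<^sup>2 / 2 * d - integral {t j..t (Suc j)} G\<bar>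
      \<le> 2 * C\<^sup>2 * d\<^sup>2" if j: "j < n" for j
  proof -
    have tj: "t j \<in> {0..T}" "t (Suc j) \<in> {0..T}" using t[of j] t[of "Suc j"] j by auto
    have le: "t j \<le> t (Suc j)" using ts d0 by simp
    have sub: "{t j..t (Suc j)} \<subseteq> {0..T}" using tj by auto
    note cs = continuous_on_subset[OF hc sub] continuous_on_subset[OF g(1) sub]
    have "g integrable_on {0..t (Suc j)}"
      using tj by (intro integrable_continuous_real continuous_on_subset[OF g(1)]) auto
    then have "integral {0..t j} g + integral {t j..t (Suc j)} g = integral {0..t (Suc j)} g"
      using tj le by (intro Henstock_Kurzweil_Integration.integral_combine) auto
    then have "integral {0..t (Suc j)} g - integral {0..t j} g = integral {t j..t (Suc j)} g"
      by (simp add: algebra_simps)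
    then have "y (t (Suc j)) - y (t j) = integral {t j..t (Suc j)} g" using y tj by simp
    then have "h (t j) \<theta> \<bullet> (y (t (Suc j)) - y (t j)) = integral {t j..t (Suc j)} (\<lambda>s. h (t j) \<theta> \<bullet> g s)"
      using integral_linear[OF integrable_continuous_real[OF cs(2)] bounded_linear_inner_right[of "h (t j) \<theta>"]]
      by (simp add: comp_def)
    moreover have "(norm (h (t j) \<theta>))\<^sup>2 / 2 * d = integral {t j..t (Suc j)} (\<lambda>s. (norm (h (t j) \<theta>))\<^sup>2 / 2)"
      using le by (simp add: ts)
    ultimately have "h (t j) \<theta> \<bullet> (y (t (Suc j)) - y (t j)) - (norm (h (t j) \<theta>))\<^sup>2 / 2 * d - integral {t j..t (Suc j)} G
      = integral {t j..t (Suc j)} (\<lambda>s. h (t j) \<theta> \<bullet> g s - (norm (h (t j) \<theta>))\<^sup>2 / 2 - G s)"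
      using cs continuous_on_subset[OF Gc sub]
      by (simp add: integral_diff integrable_continuous_real continuous_intros)
    also have "norm \<dots> \<le> integral {t j..t (Suc j)} (\<lambda>_. 2 * C\<^sup>2 * d)"
    proof (intro integral_norm_bound_integral integrable_continuous_real continuous_intros cs
        continuous_on_subset[OF Gc sub])
      fix s assume s: "s \<in> {t j..t (Suc j)}"
      then have sT: "s \<in> {0..T}" and sd: "\<bar>t j - s\<bar> \<le> d" using sub ts[of j] by auto
      let ?x = "h (t j) \<theta>" and ?v = "h s \<theta>"
      have xv: "norm (?x - ?v) \<le> C * d"
        using lip[OF sT tj(1)] sd C by (meson mult_left_mono order_trans)
      have "?x \<bullet> g s - (norm ?x)\<^sup>2 / 2 - G s = (?x - ?v) \<bullet> g s - ((?x - ?v) \<bullet> (?x + ?v)) / 2"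
        by (simp add: G_def power2_norm_eq_inner algebra_simps inner_commute diff_divide_distrib)
      also have "norm \<dots> \<le> \<bar>(?x - ?v) \<bullet> g s\<bar> + \<bar>(?x - ?v) \<bullet> (?x + ?v)\<bar> / 2" by simp
      also have "\<dots> \<le> (C * d) * C + (C * d) * (C + C) / 2"
      proof (intro add_mono divide_right_mono)
        show "\<bar>(?x - ?v) \<bullet> g s\<bar> \<le> (C * d) * C"
          by (rule order_trans[OF Cauchy_Schwarz_ineq2 mult_mono[OF xv g(2)[OF sT]]]) (use C d0 in auto)
        have "norm (?x + ?v) \<le> C + C" by (intro order_trans[OF norm_triangle_ineq] add_mono bound tj sT)
        then show "\<bar>(?x - ?v) \<bullet> (?x + ?v)\<bar> \<le> (C * d) * (C + C)"
          by (intro order_trans[OF Cauchy_Schwarz_ineq2 mult_mono[OF xv]]) (use C d0 in auto)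
      qed simp
      also have "\<dots> = 2 * C\<^sup>2 * d" by (simp add: power2_eq_square algebra_simps)
      finally show "norm (?x \<bullet> g s - (norm ?x)\<^sup>2 / 2 - G s) \<le> 2 * C\<^sup>2 * d" .
    qed
    also have "\<dots> = 2 * C\<^sup>2 * d\<^sup>2" using le by (simp add: ts power2_eq_square)
    finally show ?thesis by simp
  qed
  have tn: "t n = T" using n by (simp add: t_def d_def)
  have "contrast T h y n \<theta> - integral {0..T} G =
    (\<Sum>j<n. h (t j) \<theta> \<bullet> (y (t (Suc j)) - y (t j)) - (norm (h (t j) \<theta>))\<^sup>2 / 2 * d - integral {t j..t (Suc j)} G)"
  proof -
    have "integral {0..T} G = (\<Sum>j<n. integral {t j..t (Suc j)} G)" using total[of n] tn by simp
    then show ?thesis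
      unfolding contrast_eq by (simp add: sum_subtractf) (simp add: t_def d_def mult.commute)
  qed
  also have "\<bar>\<dots>\<bar> \<le> (\<Sum>j<n. 2 * C\<^sup>2 * d\<^sup>2)"
    by (intro order_trans[OF sum_abs] sum_mono local) auto
  also have "\<dots> = 2 * C\<^sup>2 * T\<^sup>2 / real n"
    using n by (simp add: d_def power2_eq_square)
  finally show ?thesis unfolding G_def .
qed

lemma continuous_on_param_time:
  fixes h :: "real \<Rightarrow> 'q::metric_space \<Rightarrow> 'b::real_normed_vector"
  assumes cont: "\<And>s. s \<in> {0..T} \<Longrightarrow> continuous_on \<Theta> (h s)"
    and lip: "\<And>\<theta> s t. \<theta> \<in> \<Theta> \<Longrightarrow> s \<in> {0..T} \<Longrightarrow> t \<in> {0..T} \<Longrightarrow> norm (h t \<theta> - h s \<theta>) \<le> C * \<bar>t - s\<bar>"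
  shows "continuous_on (\<Theta> \<times> {0..T}) (\<lambda>(\<theta>, s). h s \<theta>)"
  unfolding continuous_on_def
proof (intro ballI)
  fix x assume "x \<in> \<Theta> \<times> {0..T}"
  then obtain \<theta> s where x: "x = (\<theta>, s)" "\<theta> \<in> \<Theta>" "s \<in> {0..T}" by auto
  let ?F = "at x within \<Theta> \<times> {0..T}"
  have in_F: "\<forall>\<^sub>F z in ?F. fst z \<in> \<Theta> \<and> snd z \<in> {0..T}"
    unfolding eventually_at_filter by (intro always_eventually) auto
  have idl: "((\<lambda>z. z) \<longlongrightarrow> x) ?F" by (rule tendsto_ident_at)
  have fl: "(fst \<longlongrightarrow> \<theta>) ?F" "(snd \<longlongrightarrow> s) ?F"
    using tendsto_fst[OF idl] tendsto_snd[OF idl] by (simp_all add: x)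
  have hs: "((\<lambda>z. h s (fst z)) \<longlongrightarrow> h s \<theta>) ?F"
    by (rule continuous_on_tendsto_compose[OF cont[OF x(3)] fl(1) x(2)]) (use in_F in \<open>auto elim: eventually_mono\<close>)
  have "((\<lambda>z. h (snd z) (fst z) - h s (fst z)) \<longlongrightarrow> 0) ?F"
  proof (rule Lim_null_comparison)
    show "\<forall>\<^sub>F z in ?F. norm (h (snd z) (fst z) - h s (fst z)) \<le> C * \<bar>snd z - s\<bar>"
      using in_F by eventually_elim (use lip x(3) in blast)
    have "((\<lambda>z. C * \<bar>snd z - s\<bar>) \<longlongrightarrow> C * \<bar>s - s\<bar>) ?F" by (intro tendsto_intros fl)
    then show "((\<lambda>z. C * \<bar>snd z - s\<bar>) \<longlongrightarrow> 0) ?F" by simp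
  qed
  from tendsto_add[OF this hs] show "((\<lambda>(\<theta>, s). h s \<theta>) \<longlongrightarrow> (case x of (\<theta>, s) \<Rightarrow> h s \<theta>)) ?F"
    by (simp add: x split_beta')
qed

text \<open>The deterministic core. Outside a ball around \<open>\<theta>\<^sub>0\<close> the gap \<open>D \<theta> = J \<theta>\<^sub>0 - J \<theta>\<close> is bounded below
by some \<open>\<delta> > 0\<close>, by compactness. Once the contrast is within \<open>\<delta>/4\<close> of \<open>J\<close> on all of \<open>\<Theta>\<close>, a maximizer
has \<open>D \<le> \<delta>/2\<close> and so lies inside the ball.\<close>

lemma contrast_argmax_consistent:
  fixes h :: "real \<Rightarrow> 'q::real_normed_vector \<Rightarrow> real^'r::finite"
  assumes T: "0 < T" and C: "0 \<le> C" and \<Theta>: "compact \<Theta>" "\<theta>\<^sub>0 \<in> \<Theta>"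
    and cont: "\<And>s. s \<in> {0..T} \<Longrightarrow> continuous_on \<Theta> (h s)"
    and bound: "\<And>\<theta> s. \<theta> \<in> \<Theta> \<Longrightarrow> s \<in> {0..T} \<Longrightarrow> norm (h s \<theta>) \<le> C"
    and lip: "\<And>\<theta> s t. \<theta> \<in> \<Theta> \<Longrightarrow> s \<in> {0..T} \<Longrightarrow> t \<in> {0..T} \<Longrightarrow> norm (h t \<theta> - h s \<theta>) \<le> C * \<bar>t - s\<bar>"
    and ident: "\<And>\<theta>. \<theta> \<in> \<Theta> \<Longrightarrow> \<theta> \<noteq> \<theta>\<^sub>0 \<Longrightarrow> \<exists>s\<in>{0..T}. h s \<theta> \<noteq> h s \<theta>\<^sub>0"
    and y: "\<And>t. t \<in> {0..T} \<Longrightarrow> y t = integral {0..t} (\<lambda>s. h s \<theta>\<^sub>0)"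
    and conv: "\<And>\<epsilon>. 0 < \<epsilon> \<Longrightarrow> \<exists>K. \<forall>N\<ge>K. \<forall>t\<in>{0..T}. norm (z N t - y t) \<le> \<epsilon>"
    and argmax: "\<And>N n. 1 \<le> N \<Longrightarrow> 1 \<le> n \<Longrightarrow>
      is_arg_max (contrast T h (z N) n) (\<lambda>\<theta>. \<theta> \<in> \<Theta>) (\<theta>hat N n)"
  shows "double_limit \<theta>hat \<theta>\<^sub>0"
proof (rule double_limitI)
  fix \<epsilon> :: real assume e: "0 < \<epsilon>"
  have joint: "continuous_on (\<Theta> \<times> {0..T}) (\<lambda>(\<theta>, s). h s \<theta>)"
    by (rule continuous_on_param_time[OF cont lip])
  have hc: "continuous_on {0..T} (\<lambda>s. h s \<theta>)" if "\<theta> \<in> \<Theta>" for \<theta>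
    by (rule lipschitz_on_continuous_on[of C]) (auto intro!: lipschitz_onI lip C that simp: dist_norm dist_real_def)
  define J where "J \<theta> = integral {0..T} (\<lambda>s. h s \<theta> \<bullet> h s \<theta>\<^sub>0 - (norm (h s \<theta>))\<^sup>2 / 2)" for \<theta>
  define D where "D \<theta> = integral {0..T} (\<lambda>s. (norm (h s \<theta> - h s \<theta>\<^sub>0))\<^sup>2 / 2)" for \<theta>
  have JD: "J \<theta>\<^sub>0 - J \<theta> = D \<theta>" if "\<theta> \<in> \<Theta>" for \<theta>
  proof -
    have "J \<theta>\<^sub>0 - J \<theta> = integral {0..T} (\<lambda>s. (h s \<theta>\<^sub>0 \<bullet> h s \<theta>\<^sub>0 - (norm (h s \<theta>\<^sub>0))\<^sup>2 / 2) -
        (h s \<theta> \<bullet> h s \<theta>\<^sub>0 - (norm (h s \<theta>))\<^sup>2 / 2))"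
      unfolding J_def using hc[OF that] hc[OF \<Theta>(2)]
      by (intro integral_diff[symmetric] integrable_continuous_real continuous_intros) simp_all
    also have "\<dots> = D \<theta>"
      unfolding D_def
      by (intro arg_cong[where f = "integral {0..T}"] ext)
        (simp add: power2_norm_eq_inner inner_diff_left inner_diff_right inner_commute field_simps)
    finally show ?thesis .
  qed
  have Dc: "continuous_on \<Theta> D"
  proof -
    have "continuous_on (\<Theta> \<times> {0..T}) (\<lambda>x. (norm ((case x of (\<theta>, s) \<Rightarrow> h s \<theta>) - h (snd x) \<theta>\<^sub>0))\<^sup>2 / 2)"
    proof (intro continuous_intros joint)
      show "continuous_on (\<Theta> \<times> {0..T}) (\<lambda>x. h (snd x) \<theta>\<^sub>0)"
        by (rule continuous_on_compose2[OF hc[OF \<Theta>(2)] continuous_on_snd[OF continuous_on_id]]) auto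
    qed simp
    then have "continuous_on (\<Theta> \<times> cbox 0 T) (\<lambda>(\<theta>, s). (norm (h s \<theta> - h s \<theta>\<^sub>0))\<^sup>2 / 2)"
      by (simp add: split_beta')
    from integral_continuous_on_param[OF this] show ?thesis unfolding D_def by simp
  qed
  have Dpos: "0 < D \<theta>" if \<theta>: "\<theta> \<in> \<Theta>" "\<theta> \<noteq> \<theta>\<^sub>0" for \<theta>
  proof -
    have c: "continuous_on {0..T} (\<lambda>s. (norm (h s \<theta> - h s \<theta>\<^sub>0))\<^sup>2 / 2)"
      by (intro continuous_intros hc \<theta> \<Theta>) simp
    have ge: "0 \<le> D \<theta>" unfolding D_def by (intro integral_nonneg integrable_continuous_real c) simp
    have "D \<theta> \<noteq> 0"
    proof
      assume "D \<theta> = 0"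
      then have "((\<lambda>s. (norm (h s \<theta> - h s \<theta>\<^sub>0))\<^sup>2 / 2) has_integral 0) (cbox 0 T)"
        using integrable_integral[OF integrable_continuous_real[OF c]] by (simp add: D_def)
      then have "(norm (h s \<theta> - h s \<theta>\<^sub>0))\<^sup>2 / 2 = 0" if "s \<in> {0..T}" for s
        using has_integral_0_cbox_imp_0[of 0 T "\<lambda>s. (norm (h s \<theta> - h s \<theta>\<^sub>0))\<^sup>2 / 2" s] c that T by simp
      then show False using ident[OF \<theta>] by auto
    qed
    with ge show ?thesis by simp
  qed
  obtain \<delta> where d: "0 < \<delta>" and far: "\<And>\<theta>. \<theta> \<in> \<Theta> \<Longrightarrow> \<epsilon> < norm (\<theta> - \<theta>\<^sub>0) \<Longrightarrow> \<delta> \<le> D \<theta>"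
  proof (cases "\<Theta> \<inter> {\<theta>. \<epsilon> \<le> norm (\<theta> - \<theta>\<^sub>0)} = {}")
    case True
    then show ?thesis using that[of 1] by force
  next
    case False
    have "closed {\<theta>. \<epsilon> \<le> norm (\<theta> - \<theta>\<^sub>0)}" by (intro closed_Collect_le continuous_intros)
    then have "compact (\<Theta> \<inter> {\<theta>. \<epsilon> \<le> norm (\<theta> - \<theta>\<^sub>0)})" using \<Theta>(1) by (rule compact_Int_closed[rotated])
    from continuous_attains_inf[OF this False continuous_on_subset[OF Dc]]
    obtain \<theta>1 where t1: "\<theta>1 \<in> \<Theta>" "\<epsilon> \<le> norm (\<theta>1 - \<theta>\<^sub>0)"
      and min: "\<And>\<theta>. \<theta> \<in> \<Theta> \<Longrightarrow> \<epsilon> \<le> norm (\<theta> - \<theta>\<^sub>0) \<Longrightarrow> D \<theta>1 \<le> D \<theta>" by auto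
    then have "0 < D \<theta>1" using e by (intro Dpos) auto
    then show ?thesis using that[of "D \<theta>1"] min by simp
  qed
  (* With this accuracy of the record and k below, each of the two errors is at most \<delta>/8. *)
  define \<eta> where "\<eta> = \<delta> / (8 * (C * (2 + T) + 1))"
  have CT: "0 \<le> C * (2 + T)" using C T by simp
  then have eta: "0 < \<eta>" "C * (2 + T) * \<eta> \<le> \<delta> / 8"
    using d by (simp_all add: \<eta>_def field_simps)
  obtain K where K: "\<And>N t. N \<ge> K \<Longrightarrow> t \<in> {0..T} \<Longrightarrow> norm (z N t - y t) \<le> \<eta>" using conv[OF eta(1)] by blast
  obtain k :: nat where k: "16 * C\<^sup>2 * T\<^sup>2 / \<delta> < real k" using reals_Archimedean2 by blast
  have unif: "\<bar>contrast T h (z N) n \<theta> - J \<theta>\<bar> \<le> \<delta> / 4" if N: "N \<ge> K" and n: "n \<ge> Suc k" and \<theta>: "\<theta> \<in> \<Theta>" for N n \<theta>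
  proof -
    have n0: "0 < n" using n by simp
    have "\<bar>contrast T h (z N) n \<theta> - contrast T h y n \<theta>\<bar> \<le> C * (2 + T) * \<eta>"
      by (rule contrast_perturbation[where h = h and \<theta> = \<theta> and z = "z N" and y = y and \<epsilon> = \<eta>, OF T n0 C bound[OF \<theta>] lip[OF \<theta>] K[OF N]])
    moreover have "\<bar>contrast T h y n \<theta> - J \<theta>\<bar> \<le> 2 * C\<^sup>2 * T\<^sup>2 / real n"
      unfolding J_def
      by (rule contrast_riemann_error[where h = h and \<theta> = \<theta> and g = "\<lambda>s. h s \<theta>\<^sub>0" and y = y, OF T n0 C bound[OF \<theta>] lip[OF \<theta>] hc[OF \<Theta>(2)] bound[OF \<Theta>(2)] y])
    moreover have "2 * C\<^sup>2 * T\<^sup>2 / real n \<le> \<delta> / 8"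
    proof -
      have "16 * C\<^sup>2 * T\<^sup>2 / \<delta> \<le> real n" using k n by linarith
      then have "16 * C\<^sup>2 * T\<^sup>2 \<le> real n * \<delta>" using d by (simp add: pos_divide_le_eq)
      then show ?thesis using n0 by (simp add: field_simps)
    qed
    ultimately show ?thesis using eta(2) by linarith
  qed
  show "\<exists>K. \<forall>N\<ge>K. \<forall>n\<ge>K. norm (\<theta>hat N n - \<theta>\<^sub>0) \<le> \<epsilon>"
  proof (intro exI allI impI)
    fix N n assume Nn: "max K (Suc k) \<le> N" "max K (Suc k) \<le> n"
    have am: "is_arg_max (contrast T h (z N) n) (\<lambda>\<theta>. \<theta> \<in> \<Theta>) (\<theta>hat N n)" using Nn by (intro argmax) auto
    then have hat: "\<theta>hat N n \<in> \<Theta>" "contrast T h (z N) n \<theta>\<^sub>0 \<le> contrast T h (z N) n (\<theta>hat N n)"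
      using \<Theta>(2) by (auto simp: is_arg_max_linorder)
    have "D (\<theta>hat N n) \<le> \<delta> / 2"
    proof -
      have "\<bar>contrast T h (z N) n (\<theta>hat N n) - J (\<theta>hat N n)\<bar> \<le> \<delta> / 4"
        "\<bar>contrast T h (z N) n \<theta>\<^sub>0 - J \<theta>\<^sub>0\<bar> \<le> \<delta> / 4"
        using unif[OF _ _ hat(1), of N n] unif[OF _ _ \<Theta>(2), of N n] Nn by simp_all
      then show ?thesis using hat(2) JD[OF hat(1)] by linarith
    qed
    then show "norm (\<theta>hat N n - \<theta>\<^sub>0) \<le> \<epsilon>" using far[OF hat(1)] d by force
  qed
qed

section \<open>Consistency\<close>

theorem theorem3p4:
  fixes M :: "'w measure" and T :: real
    and \<Theta>\<^sub>o \<Theta> :: "(real^'p) set" and \<theta>\<^sub>0 :: "real^'p" and A :: "'p set"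
    and H :: "real^'p \<Rightarrow> complex^'d^'d"
    and L :: "real^'p \<Rightarrow> 'r::finite \<Rightarrow> complex^'d^'d"
    and \<rho>\<^sub>0 :: "complex^'d^'d"
    and W :: "nat \<Rightarrow> real \<Rightarrow> 'w \<Rightarrow> real^'r"
    and \<rho> :: "real^'p \<Rightarrow> nat \<Rightarrow> real \<Rightarrow> 'w \<Rightarrow> complex^'d^'d"
    and Y :: "nat \<Rightarrow> real \<Rightarrow> 'w \<Rightarrow> real^'r"
    and \<alpha> \<beta> :: "real^'p \<Rightarrow> real^'p"
    and rhobar :: "real^'p \<Rightarrow> real \<Rightarrow> complex^'d^'d"
    and h :: "real \<Rightarrow> real^'p \<Rightarrow> real^'r"
    and \<Phi> :: "nat \<Rightarrow> nat \<Rightarrow> 'w \<Rightarrow> real^'p \<Rightarrow> real"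
    and \<theta>hat :: "nat \<Rightarrow> nat \<Rightarrow> 'w \<Rightarrow> real^'p"
  defines "\<alpha> \<equiv> coords A"
    and "\<beta> \<equiv> coords (- A)"
    and "rhobar \<equiv> (\<lambda>\<theta> t. prob_space.expectation M (\<rho> \<theta> 1 t))"
    and "h \<equiv> (\<lambda>t \<theta>. bvec (L (\<beta> \<theta>)) (rhobar \<theta> t))"
    and "\<Phi> \<equiv> (\<lambda>N n \<omega>. contrast T h (\<lambda>t. mean_record Y N t \<omega>) n)"
  assumes "prob_space M" and "T > 0"
    and "open \<Theta>\<^sub>o" and "bounded \<Theta>\<^sub>o" and "convex \<Theta>\<^sub>o"
    and "\<Theta> = closure \<Theta>\<^sub>o" and "\<theta>\<^sub>0 \<in> \<Theta>\<^sub>o"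
    and "\<And>\<theta>. \<theta> \<in> \<Theta> \<Longrightarrow> selfadjoint (H (\<alpha> \<theta>))"
    and "density_matrix \<rho>\<^sub>0"
    and "\<And>i. i \<ge> 1 \<Longrightarrow> std_wiener M T (W i)"
    and "indep_processes M T W {1..}"
    and "\<And>\<theta> i. \<theta> \<in> \<Theta> \<Longrightarrow> i \<ge> 1 \<Longrightarrow>
           sde_solution M T (W i) (H (\<alpha> \<theta>)) (L (\<beta> \<theta>)) \<rho>\<^sub>0 (\<rho> \<theta> i)"
    and "\<And>\<theta> i. \<theta> \<in> \<Theta> \<Longrightarrow> i \<ge> 1 \<Longrightarrow>
           AE \<omega> in M. \<forall>t\<in>{0..T}. density_matrix (\<rho> \<theta> i t \<omega>)"
    and "\<And>i. i \<ge> 1 \<Longrightarrow> observation M T (W i) (L (\<beta> \<theta>\<^sub>0)) (\<rho> \<theta>\<^sub>0 i) (Y i)"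
    and "C1_on_closure \<Theta>\<^sub>o (\<lambda>\<theta>. H (\<alpha> \<theta>))"
    and "\<And>k. C1_on_closure \<Theta>\<^sub>o (\<lambda>\<theta>. L (\<beta> \<theta>) k)"
    and "\<And>\<theta>. \<theta> \<in> \<Theta> \<Longrightarrow> \<theta> \<noteq> \<theta>\<^sub>0 \<Longrightarrow>
           \<exists>t\<in>{0..T}. bvec (L (\<beta> \<theta>)) (rhobar \<theta> t) \<noteq> bvec (L (\<beta> \<theta>\<^sub>0)) (rhobar \<theta>\<^sub>0 t)"
    and "\<And>N n. N \<ge> 1 \<Longrightarrow> n \<ge> 1 \<Longrightarrow> \<theta>hat N n \<in> borel_measurable M"
    and "\<And>N n \<omega>. N \<ge> 1 \<Longrightarrow> n \<ge> 1 \<Longrightarrow> \<omega> \<in> space M \<Longrightarrow>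
           is_arg_max (\<Phi> N n \<omega>) (\<lambda>\<theta>. \<theta> \<in> \<Theta>) (\<theta>hat N n \<omega>)"
  shows "AE \<omega> in M. double_limit (\<lambda>N n. \<theta>hat N n \<omega>) \<theta>\<^sub>0"
proof -
  interpret prob_space M by fact
  note T = \<open>T > 0\<close> and \<Theta>_eq = \<open>\<Theta> = closure \<Theta>\<^sub>o\<close>
  note W = \<open>\<And>i. i \<ge> 1 \<Longrightarrow> std_wiener M T (W i)\<close>
  note sde = \<open>\<And>\<theta> i. \<theta> \<in> \<Theta> \<Longrightarrow> i \<ge> 1 \<Longrightarrow>
           sde_solution M T (W i) (H (\<alpha> \<theta>)) (L (\<beta> \<theta>)) \<rho>\<^sub>0 (\<rho> \<theta> i)\<close>
  note dens = \<open>\<And>\<theta> i. \<theta> \<in> \<Theta> \<Longrightarrow> i \<ge> 1 \<Longrightarrow>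
           AE \<omega> in M. \<forall>t\<in>{0..T}. density_matrix (\<rho> \<theta> i t \<omega>)\<close>
  define B where "B = real CARD('d) * real CARD('d)"
  have B0: "0 \<le> B" by (simp add: B_def)
  have \<Theta>: "compact \<Theta>" "\<theta>\<^sub>0 \<in> \<Theta>"
    using \<open>bounded \<Theta>\<^sub>o\<close> \<open>\<theta>\<^sub>0 \<in> \<Theta>\<^sub>o\<close> closure_subset by (auto simp: \<Theta>_eq compact_closure)
  have Hc: "continuous_on \<Theta> (\<lambda>\<theta>. H (\<alpha> \<theta>))" and Lc: "\<And>k. continuous_on \<Theta> (\<lambda>\<theta>. L (\<beta> \<theta>) k)"
    using \<open>C1_on_closure \<Theta>\<^sub>o (\<lambda>\<theta>. H (\<alpha> \<theta>))\<close> \<open>\<And>k. C1_on_closure \<Theta>\<^sub>o (\<lambda>\<theta>. L (\<beta> \<theta>) k)\<close>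
    by (simp_all add: C1_on_closure_def \<Theta>_eq)
  note mse = mean_state_equation[OF W sde dens less_imp_le[OF T], folded B_def]
  have mean: "expectation (\<rho> \<theta> i t) = rhobar \<theta> t" if \<theta>: "\<theta> \<in> \<Theta>" and i: "1 \<le> i" and t: "t \<in> {0..T}" for \<theta> i t
  proof -
    define \<Lambda> where "\<Lambda> = Blinfun (lindblad (H (\<alpha> \<theta>)) (L (\<beta> \<theta>)))"
    have \<Lambda>: "blinfun_apply \<Lambda> = lindblad (H (\<alpha> \<theta>)) (L (\<beta> \<theta>))"
      unfolding \<Lambda>_def by (rule bounded_linear_Blinfun_apply[OF bounded_linear_lindblad])
    have one: "1 \<le> (1::nat)" by simp
    have "norm (expectation (\<rho> \<theta> i t) - expectation (\<rho> \<theta> 1 t))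
        \<le> 2 * (norm (\<Lambda> - \<Lambda>) * B * T) * exp (2 * (norm \<Lambda> + 1) * T)"
    proof (rule integral_equation_stability[where e = "\<lambda>t. expectation (\<rho> \<theta> i t)" and e' = "\<lambda>t. expectation (\<rho> \<theta> 1 t)"])
      show "norm \<Lambda> \<le> norm \<Lambda> + 1" "0 < norm \<Lambda> + 1" by (simp_all add: add_nonneg_pos)
    qed (unfold \<Lambda>, (rule mse(4)[OF i \<theta> i \<theta> i] mse(4)[OF one \<theta> one \<theta> one]
        mse(5)[OF i \<theta> i \<theta> i] mse(5)[OF one \<theta> one \<theta> one] mse(3)[OF i \<theta> i \<theta> i] mse(3)[OF one \<theta> one \<theta> one] t; assumption?)+)
    then show ?thesis by (simp add: rhobar_def)
  qed
  have one: "1 \<le> (1::nat)" by simp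
  obtain C where C: "0 \<le> C"
    and hb: "\<And>\<theta> t. \<theta> \<in> \<Theta> \<Longrightarrow> t \<in> {0..T} \<Longrightarrow> norm (h t \<theta>) \<le> C"
    and hl: "\<And>\<theta> s t. \<theta> \<in> \<Theta> \<Longrightarrow> s \<in> {0..T} \<Longrightarrow> t \<in> {0..T} \<Longrightarrow> norm (h t \<theta> - h s \<theta>) \<le> C * \<bar>t - s\<bar>"
    and hc: "\<And>t. t \<in> {0..T} \<Longrightarrow> continuous_on \<Theta> (h t)"
    unfolding h_def
  proof (rule mean_signal_regularity[OF T \<Theta>(1) B0 Hc Lc])
    fix \<theta> assume \<theta>: "\<theta> \<in> \<Theta>"
    show "rhobar \<theta> t = \<rho>\<^sub>0 + (LINT s:{0..t}|lborel. lindblad (H (\<alpha> \<theta>)) (L (\<beta> \<theta>)) (rhobar \<theta> s))"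
      "norm (rhobar \<theta> t) \<le> B" if "t \<in> {0..T}" for t
      unfolding rhobar_def using mse(4,3)[OF one \<theta> one \<theta> one that] .
    show "set_integrable lborel {0..T} (\<lambda>s. lindblad (H (\<alpha> \<theta>)) (L (\<beta> \<theta>)) (rhobar \<theta> s))"
      unfolding rhobar_def by (rule mse(5)[OF one \<theta> one \<theta> one])
  qed blast
  define y where "y t = (LINT s:{0..t}|lborel. h s \<theta>\<^sub>0)" for t
  have hc0: "continuous_on {0..T} (\<lambda>s. h s \<theta>\<^sub>0)"
    by (rule lipschitz_on_continuous_on[of C]) (auto intro!: lipschitz_onI hl C \<Theta> simp: dist_norm dist_real_def)
  have y: "y t = integral {0..t} (\<lambda>s. h s \<theta>\<^sub>0)" if "t \<in> {0..T}" for t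
  proof -
    have "set_integrable lborel {0..t} (\<lambda>s. h s \<theta>\<^sub>0)"
      using that by (intro borel_integrable_atLeastAtMost' continuous_on_subset[OF hc0]) auto
    then show ?thesis unfolding y_def by (rule set_borel_integral_eq_integral(2))
  qed
  have "AE \<omega> in M. \<forall>\<epsilon>>0. \<exists>K. \<forall>N\<ge>K. \<forall>t\<in>{0..T}. norm (mean_record Y N t \<omega> - y t) \<le> \<epsilon>"
    unfolding y_def h_def
  proof (rule mean_record_uniform_slln[OF T B0 W \<open>indep_processes M T W {1..}\<close>])
    fix i :: nat assume i: "1 \<le> i"
    show "progressive T (aug_filtration M (W i)) (\<rho> \<theta>\<^sub>0 i)"
      using sde[OF \<Theta>(2) i] by (simp add: sde_solution_def)
    show "AE \<omega> in M. \<forall>t\<in>{0..T}. norm (\<rho> \<theta>\<^sub>0 i t \<omega>) \<le> B" by (rule mse(2)[OF i \<Theta>(2) i \<Theta>(2) i])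
    show "expectation (\<rho> \<theta>\<^sub>0 i t) = rhobar \<theta>\<^sub>0 t" if "t \<in> {0..T}" for t by (rule mean[OF \<Theta>(2) i that])
    show "observation M T (W i) (L (\<beta> \<theta>\<^sub>0)) (\<rho> \<theta>\<^sub>0 i) (Y i)" using i by fact
  qed
  then show ?thesis using AE_space
  proof eventually_elim
    case (elim \<omega>)
    show ?case
    proof (rule contrast_argmax_consistent[OF T C \<Theta> hc hb hl _ y])
      show "\<exists>s\<in>{0..T}. h s \<theta> \<noteq> h s \<theta>\<^sub>0" if "\<theta> \<in> \<Theta>" "\<theta> \<noteq> \<theta>\<^sub>0" for \<theta>
        unfolding h_def using that by fact
      show "\<exists>K. \<forall>N\<ge>K. \<forall>t\<in>{0..T}. norm (mean_record Y N t \<omega> - y t) \<le> \<epsilon>" if "0 < \<epsilon>" for \<epsilon>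
        using elim(1) that by blast
      show "is_arg_max (contrast T h (\<lambda>t. mean_record Y N t \<omega>) n) (\<lambda>\<theta>. \<theta> \<in> \<Theta>) (\<theta>hat N n \<omega>)"
        if "1 \<le> N" "1 \<le> n" for N n
        using \<open>\<And>N n \<omega>. N \<ge> 1 \<Longrightarrow> n \<ge> 1 \<Longrightarrow> \<omega> \<in> space M \<Longrightarrow>
           is_arg_max (\<Phi> N n \<omega>) (\<lambda>\<theta>. \<theta> \<in> \<Theta>) (\<theta>hat N n \<omega>)\<close>[OF that elim(2)] unfolding \<Phi>_def .
    qed
  qed
qed

end
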